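(* Let $Z$ be an autonomous piecewise smooth vector field on $\mathbb{R}^n$ with switching set $\Sigma$ and solution $\varphi$, and let $x\in\mathbb{R}^n\setminus\Sigma$. Let $T>0$ be such that $\{\varphi(t;x)\colon t\in[0,T]\}$ is well defined and intersects $\Sigma$ only in crossing points, and $\varphi(T;x)\notin\Sigma$. Then the time-$T$-map $\Phi^T$ is a $\mathcal{C}^\infty$-diffeomorphism in a neighborhood of $x$ (that is, from some neighborhood of $x$ onto its image).
   Context: Smooth means $\mathcal{C}^\infty$. Let $n\geq 2$, $h_1,\dots,h_N\colon\mathbb{R}^n\to\mathbb{R}$ smooth functions ($0$ need not be a regular value), $\Sigma_i=h_i^{-1}(\{0\})$, $\Sigma=\bigcup_{i=1}^N\Sigma_i$ (the switching set), and let $A_1,\dots,A_k$ ($k\geq2$) be the connected components of $\mathbb{R}^n\setminus\Sigma$. An autonomous piecewise smooth vector field $Z=(X_1,\dots,X_k)$ consists of smooth vector fields $X_j$ (its components), each defined in a neighborhood of $\overline{A_j}$. A point $x_0\in\Sigma$ is a crossing point if: (i) there is a unique $i$ with $x_0\in\Sigma_i$; (ii) $\nabla h_i(x_0)\ne0$; (iii) $\langle X_a(x_0),\nabla h_i(x_0)\rangle\,\langle X_b(x_0),\nabla h_i(x_0)\rangle>0$, where $X_a,X_b$ are the only two components with $x_0\in\overline{A_a}\cap\overline{A_b}$. The solution $\varphi(t;x)$ of $Z$ with $\varphi(0;x)=x$ follows $X_j$ while in $A_j$ and, at crossing points, is the concatenation of the trajectories of the two components there (consistent with their common crossing direction); it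 is considered on time intervals on which it meets $\Sigma$ only at crossing points. The time-$T$-map is $\Phi^T(r)=\varphi(T;r)$, defined at points $r$ for which the arc of orbit from time $0$ to time $T$ is well defined in this sense. *)

theory Defs
  imports "HOL-Analysis.Analysis"
begin

primrec C_k_on :: "nat \<Rightarrow> 'a::real_normed_vector set \<Rightarrow> ('a \<Rightarrow> 'b::real_normed_vector) \<Rightarrow> bool" where
  "C_k_on 0 S f \<longleftrightarrow> continuous_on S f"
| "C_k_on (Suc m) S f \<longleftrightarrow>
     (\<forall>x\<in>S. f differentiable (at x)) \<and> (\<forall>v. C_k_on m S (\<lambda>x. frechet_derivative f (at x) v))"

text \<open>The iterated directional derivatives are all required to exist and be continuous; for open
  sets in finite dimension this is the usual notion of a \<open>C\<^sup>\<infinity>\<close> map. Only open sets are used below.\<close>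

definition smooth_on :: "'a::real_normed_vector set \<Rightarrow> ('a \<Rightarrow> 'b::real_normed_vector) \<Rightarrow> bool" where
  "smooth_on S f \<longleftrightarrow> (\<forall>m. C_k_on m S f)"

definition smooth_diffeo :: "'a::real_normed_vector set \<Rightarrow> 'b::real_normed_vector set \<Rightarrow> ('a \<Rightarrow> 'b) \<Rightarrow> bool" where
  "smooth_diffeo U V f \<longleftrightarrow>
     open U \<and> open V \<and> bij_betw f U V \<and> smooth_on U f \<and> smooth_on V (inv_into U f)"

definition switching_set :: "nat \<Rightarrow> (nat \<Rightarrow> real^'n \<Rightarrow> real) \<Rightarrow> (real^'n) set" where
  "switching_set N h = (\<Union>i\<in>{1..N}. {x. h i x = 0})"

definition piecewise_smooth_field ::
  "nat \<Rightarrow> (nat \<Rightarrow> real^'n \<Rightarrow> real) \<Rightarrow> nat \<Rightarrow> (nat \<Rightarrow> (real^'n) set) \<Rightarrow> (nat \<Rightarrow> real^'n \<Rightarrow> real^'n) \<Rightarrow> bool"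
  where
  "piecewise_smooth_field N h k A X \<longleftrightarrow>
     (\<forall>i\<in>{1..N}. smooth_on UNIV (h i)) \<and>
     2 \<le> k \<and> bij_betw A {1..k} (components (UNIV - switching_set N h)) \<and>
     (\<forall>j\<in>{1..k}. \<exists>U. open U \<and> closure (A j) \<subseteq> U \<and> smooth_on U (X j))"

definition crossing_point ::
  "nat \<Rightarrow> (nat \<Rightarrow> real^'n \<Rightarrow> real) \<Rightarrow> nat \<Rightarrow> (nat \<Rightarrow> (real^'n) set) \<Rightarrow> (nat \<Rightarrow> real^'n \<Rightarrow> real^'n)
    \<Rightarrow> real^'n \<Rightarrow> bool" where
  "crossing_point N h k A X p \<longleftrightarrow>
     (\<exists>i v a b. {i'\<in>{1..N}. h i' p = 0} = {i} \<and>
        (GDERIV (h i) p :> v) \<and> v \<noteq> 0 \<and>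
        {j\<in>{1..k}. p \<in> closure (A j)} = {a, b} \<and> a \<noteq> b \<and>
        (X a p \<bullet> v) * (X b p \<bullet> v) > 0)"

definition trajectory ::
  "('a::real_normed_vector \<Rightarrow> 'a) \<Rightarrow> (real \<Rightarrow> 'a) \<Rightarrow> real set \<Rightarrow> bool" where
  "trajectory Y \<gamma> I \<longleftrightarrow> (\<forall>t\<in>I. (\<gamma> has_vector_derivative Y (\<gamma> t)) (at t within I))"

text \<open>When the curve meets the switching set at time \<open>t\<close>, it comes from one adjacent component
  and continues into the other one; excluding curves that stay in the switching set is essential for
  uniqueness. At an endpoint of the time interval only one of the two sides carries information, as a
  derivative within a singleton is unconstrained.\<close>

definition solution ::
  "nat \<Rightarrow> (nat \<Rightarrow> real^'n \<Rightarrow> real) \<Rightarrow> nat \<Rightarrow> (nat \<Rightarrow> (real^'n) set) \<Rightarrow> (nat \<Rightarrow> real^'n \<Rightarrow> real^'n)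
    \<Rightarrow> (real \<Rightarrow> real^'n) \<Rightarrow> real set \<Rightarrow> bool" where
  "solution N h k A X \<gamma> I \<longleftrightarrow>
     continuous_on I \<gamma> \<and>
     (\<forall>t\<in>I. \<forall>j\<in>{1..k}. \<gamma> t \<in> A j \<longrightarrow>
        (\<gamma> has_vector_derivative X j (\<gamma> t)) (at t within I)) \<and>
     (\<forall>t\<in>I. \<gamma> t \<in> switching_set N h \<longrightarrow>
        crossing_point N h k A X (\<gamma> t) \<and>
        (\<exists>a\<in>{1..k}. \<exists>b\<in>{1..k}. \<exists>\<epsilon>>0.
           a \<noteq> b \<and> \<gamma> t \<in> closure (A a) \<inter> closure (A b) \<and>
           \<gamma> ` (I \<inter> {t-\<epsilon>..<t}) \<subseteq> A a \<and> trajectory (X a) \<gamma> (I \<inter> {t-\<epsilon>..t}) \<and>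
           \<gamma> ` (I \<inter> {t<..t+\<epsilon>}) \<subseteq> A b \<and> trajectory (X b) \<gamma> (I \<inter> {t..t+\<epsilon>})))"

text \<open>The segment between \<open>0\<close> and \<open>t\<close> is \<open>{0..t}\<close> for \<open>t \<ge> 0\<close> and \<open>{t..0}\<close> otherwise.\<close>

definition flow_domain ::
  "nat \<Rightarrow> (nat \<Rightarrow> real^'n \<Rightarrow> real) \<Rightarrow> nat \<Rightarrow> (nat \<Rightarrow> (real^'n) set) \<Rightarrow> (nat \<Rightarrow> real^'n \<Rightarrow> real^'n)
    \<Rightarrow> real \<Rightarrow> (real^'n) set" where
  "flow_domain N h k A X t = {x. \<exists>\<gamma>. solution N h k A X \<gamma> (closed_segment 0 t) \<and> \<gamma> 0 = x}"

definition flow ::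
  "nat \<Rightarrow> (nat \<Rightarrow> real^'n \<Rightarrow> real) \<Rightarrow> nat \<Rightarrow> (nat \<Rightarrow> (real^'n) set) \<Rightarrow> (nat \<Rightarrow> real^'n \<Rightarrow> real^'n)
    \<Rightarrow> real \<Rightarrow> real^'n \<Rightarrow> real^'n" where
  "flow N h k A X t x =
     (THE y. \<exists>\<gamma>. solution N h k A X \<gamma> (closed_segment 0 t) \<and> \<gamma> 0 = x \<and> \<gamma> t = y)"

definition time_map ::
  "nat \<Rightarrow> (nat \<Rightarrow> real^'n \<Rightarrow> real) \<Rightarrow> nat \<Rightarrow> (nat \<Rightarrow> (real^'n) set) \<Rightarrow> (nat \<Rightarrow> real^'n \<Rightarrow> real^'n)
    \<Rightarrow> real \<Rightarrow> real^'n \<Rightarrow> real^'n" where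
  "time_map N h k A X T = (\<lambda>r. flow N h k A X T r)"

end

theory Submission
  imports Defs
begin

text \<open>A crossing of the switching set is described by smooth data only: the flows of the two adjacent
  components, each defined on both sides of the switching surface, and the hitting time \<open>\<tau>\<close> of the
  surface. Near the given orbit the time map is \<open>q \<mapsto> \<phi>\<^sub>b(\<phi>\<^sub>a(q, \<tau>(q)), t - \<tau>(q))\<close> across
  a crossing and a single smooth flow elsewhere; these pieces compose along the compact time
  interval. The inverse is the time map of the reversed field.

  Smoothness of flows is obtained for parametric equations \<open>y' = g(x, t, y)\<close>: the derivative of
  \<open>y\<close> in \<open>x\<close> solves the variational equation, which is again of this form and has the same
  Lipschitz constant \<open>L\<close>, so that an induction on the order of differentiability applies. Times
  are restricted to \<open>L |t| \<le> 1/2\<close>, where every estimate follows from the mean value inequality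
  without Gronwall's lemma.\<close>

section \<open>Calculus of continuously differentiable maps\<close>

text \<open>Two obstacles shape the argument. The field jumps across the switching set, but each
  component field is smooth on a neighbourhood of the closure of its region. Hence both one-sided
  flows continue past the surface, and the crossing formula makes sense for orbits that hit the
  surface earlier or later than the given one. Moreover, a solution started on the surface does not
  reveal which side it came from, so uniqueness and gluing are used only from points off the
  surface. All pieces are cut at such times, which are available because crossing times are
  isolated.

  The bound 1/2 serves absorption: a maximum M with M \<le> c + M/2 is at most 2c. As the
  variational equation keeps L, the time interval does not shrink from one order of
  differentiability to the next, so one box serves all orders at once.

  Taking the inverse from the reversed field yields its smoothness and the openness of the image
  without a Jacobian, in particular without following the jump of the derivative at a
  crossing.\<close>

lemma C_k_on_has_derivative:
  "C_k_on (Suc m) S f \<Longrightarrow> x \<in> S \<Longrightarrow> (f has_derivative frechet_derivative f (at x)) (at x)"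
  using frechet_derivative_works by auto

lemma C_k_on_subset: "C_k_on m S f \<Longrightarrow> T \<subseteq> S \<Longrightarrow> C_k_on m T f"
proof (induction m arbitrary: f)
  case 0
  then show ?case by (auto intro: continuous_on_subset)
next
  case (Suc m)
  then show ?case by auto
qed

text \<open>A derivative at \<open>x\<close> sees \<open>f\<close> near \<open>x\<close> only, and
  openness of \<open>S\<close> puts such a neighbourhood inside \<open>S\<close>. Values outside,
  arbitrary for the locally defined maps below, do not matter.\<close>

lemma C_k_on_cong:
  assumes "open S" "\<And>x. x \<in> S \<Longrightarrow> f x = g x" "C_k_on m S f"
  shows "C_k_on m S g"
  using assms
proof (induction m arbitrary: f g)
  case 0
  then show ?case unfolding C_k_on.simps(1) by (blast intro: continuous_on_eq)
next
  case (Suc m)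
  have g: "(g has_derivative frechet_derivative f (at x)) (at x)" if "x \<in> S" for x
    by (rule has_derivative_transform_within_open[OF C_k_on_has_derivative[OF Suc.prems(3) that]
          Suc.prems(1) that Suc.prems(2)])
  then have eq: "frechet_derivative f (at x) v = frechet_derivative g (at x) v" if "x \<in> S" for x v
    using that frechet_derivative_at by metis
  have Cf: "C_k_on m S (\<lambda>x. frechet_derivative f (at x) v)" for v
    using Suc.prems(3) by simp
  have "C_k_on m S (\<lambda>x. frechet_derivative g (at x) v)" for v
    by (rule Suc.IH[where f = "\<lambda>x. frechet_derivative f (at x) v" and g = "\<lambda>x. frechet_derivative g (at x) v",
          OF Suc.prems(1) eq Cf])
  moreover have "\<forall>x\<in>S. g differentiable (at x)"
    using g differentiable_def by blast
  ultimately show ?case unfolding C_k_on.simps(2) by blast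
qed

lemma C_k_on_SucD: "C_k_on (Suc m) S f \<Longrightarrow> C_k_on m S f"
proof (induction m arbitrary: f)
  case 0
  then show ?case
    by (simp add: continuous_at_imp_continuous_on differentiable_imp_continuous_within)
next
  case (Suc m)
  then show ?case by (simp del: C_k_on.simps(1))
qed

lemma C_k_on_antimono: "C_k_on m S f \<Longrightarrow> n \<le> m \<Longrightarrow> C_k_on n S f"
  by (induction m) (auto simp: le_Suc_eq dest: C_k_on_SucD simp del: C_k_on.simps)

lemma C_k_on_imp_continuous: "C_k_on m S f \<Longrightarrow> continuous_on S f"
  by (induction m) (auto dest: C_k_on_SucD simp del: C_k_on.simps(2))

text \<open>Admits an explicit derivative in place of \<open>frechet_derivative\<close>. The closure
  proofs below supply a formula for \<open>f'\<close> and apply the induction hypothesis in each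
  fixed direction \<open>v\<close>.\<close>

lemma C_k_on_SucI:
  assumes "\<And>x. x \<in> S \<Longrightarrow> (f has_derivative f' x) (at x)" "open S"
    and "\<And>v. C_k_on m S (\<lambda>x. f' x v)"
  shows "C_k_on (Suc m) S f"
proof -
  have "frechet_derivative f (at x) = f' x" if "x \<in> S" for x
    using assms(1)[OF that] by (rule frechet_derivative_at[symmetric])
  then have "C_k_on m S (\<lambda>x. frechet_derivative f (at x) v)" for v
    by (intro C_k_on_cong[OF assms(2) _ assms(3)[of v]]) simp
  moreover have "\<forall>x\<in>S. f differentiable (at x)"
    using assms(1) by (meson differentiable_def)
  ultimately show ?thesis unfolding C_k_on.simps(2) by blast
qed

lemma C_k_on_const [simp]: "open S \<Longrightarrow> C_k_on m S (\<lambda>x. c)"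
proof (induction m arbitrary: c)
  case (Suc m)
  show ?case
    by (rule C_k_on_SucI[where f' = "\<lambda>x v. 0", OF has_derivative_const Suc.prems Suc.IH[OF Suc.prems]])
qed simp

lemma C_k_on_linear: "bounded_linear f \<Longrightarrow> open S \<Longrightarrow> C_k_on m S f"
proof (cases m)
  case 0
  then show "bounded_linear f \<Longrightarrow> ?thesis" by (simp add: linear_continuous_on)
next
  case (Suc m')
  show ?thesis if "bounded_linear f" "open S"
    unfolding Suc
    using bounded_linear_imp_has_derivative[OF that(1)] that(2)
    by (intro C_k_on_SucI[where f' = "\<lambda>x v. f v"] C_k_on_const)
qed

lemma C_k_on_linear_compose:
  assumes "bounded_linear l" "open S" "C_k_on m S f"
  shows "C_k_on m S (\<lambda>x. l (f x))"
  using assms(3)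
proof (induction m arbitrary: f)
  case 0
  then show ?case using assms by (auto intro: bounded_linear.continuous_on)
next
  case (Suc m)
  show ?case
  proof (rule C_k_on_SucI[where f' = "\<lambda>x v. l (frechet_derivative f (at x) v)"])
    fix v show "C_k_on m S (\<lambda>x. l (frechet_derivative f (at x) v))"
      using Suc.prems by (intro Suc.IH) simp
  qed (rule assms(2) | erule bounded_linear.has_derivative[OF assms(1) C_k_on_has_derivative[OF Suc.prems]])+
qed

lemma C_k_on_add:
  assumes "open S" "C_k_on m S f" "C_k_on m S g"
  shows "C_k_on m S (\<lambda>x. f x + g x)"
  using assms(2,3)
proof (induction m arbitrary: f g)
  case 0
  then show ?case by (auto intro: continuous_on_add)
next
  case (Suc m)
  show ?case
  proof (rule C_k_on_SucI[where f' = "\<lambda>x v. frechet_derivative f (at x) v + frechet_derivative g (at x) v"])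
    fix v show "C_k_on m S (\<lambda>x. frechet_derivative f (at x) v + frechet_derivative g (at x) v)"
      using Suc.prems by (intro Suc.IH) simp_all
  qed (rule assms(1) | intro has_derivative_add | erule C_k_on_has_derivative[OF Suc.prems(1)]
      C_k_on_has_derivative[OF Suc.prems(2)])+
qed

lemma C_k_on_sum:
  assumes "open S" "\<And>i. i \<in> I \<Longrightarrow> C_k_on m S (f i)"
  shows "C_k_on m S (\<lambda>x. \<Sum>i\<in>I. f i x)"
  using assms(2)
  by (induction I rule: infinite_finite_induct) (auto simp: assms(1) intro!: C_k_on_add)

lemma C_k_on_Pair:
  assumes "open S" "C_k_on m S f" "C_k_on m S g"
  shows "C_k_on m S (\<lambda>x. (f x, g x))"
proof -
  have "bounded_linear (\<lambda>a. (a, 0))" "bounded_linear (\<lambda>b. (0, b))"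
    by (intro bounded_linear_Pair bounded_linear_ident bounded_linear_zero)+
  from C_k_on_add[OF assms(1) C_k_on_linear_compose[OF this(1) assms(1,2)]
    C_k_on_linear_compose[OF this(2) assms(1,3)]]
  show ?thesis by simp
qed

lemma C_k_on_bilinear:
  assumes "bounded_bilinear b" "open S" "C_k_on m S f" "C_k_on m S g"
  shows "C_k_on m S (\<lambda>x. b (f x) (g x))"
  using assms(3,4)
proof (induction m arbitrary: f g)
  case 0
  then show ?case using assms by (auto intro: bounded_bilinear.continuous_on)
next
  case (Suc m)
  show ?case
  proof (rule C_k_on_SucI[where f' = "\<lambda>x v. b (f x) (frechet_derivative g (at x) v) + b (frechet_derivative f (at x) v) (g x)"])
    show "((\<lambda>x. b (f x) (g x)) has_derivative
      (\<lambda>v. b (f x) (frechet_derivative g (at x) v) + b (frechet_derivative f (at x) v) (g x))) (at x)"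
      if "x \<in> S" for x
      using Suc.prems that
      by (intro bounded_bilinear.FDERIV[OF assms(1)]) (auto intro: C_k_on_has_derivative simp del: C_k_on.simps)
  next
    fix v show "C_k_on m S (\<lambda>x. b (f x) (frechet_derivative g (at x) v) + b (frechet_derivative f (at x) v) (g x))"
      using Suc.prems
      by (auto intro!: C_k_on_add[OF assms(2)] Suc.IH[OF C_k_on_SucD[OF Suc.prems(1)]]
          Suc.IH[OF _ C_k_on_SucD[OF Suc.prems(2)]])
  qed fact
qed

text \<open>\<open>C_k_on\<close> controls derivatives in fixed directions only. Expanding in a
  basis reduces a derivative whose direction varies with the point to finitely many of
  those.\<close>

lemma linear_Basis_expansion:
  fixes f :: "'a::euclidean_space \<Rightarrow> 'b::real_vector"
  assumes "linear f"
  shows "f v = (\<Sum>b\<in>Basis. (v \<bullet> b) *\<^sub>R f b)"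
proof -
  have "f v = f (\<Sum>b\<in>Basis. (v \<bullet> b) *\<^sub>R b)" by (simp add: euclidean_representation)
  also have "\<dots> = (\<Sum>b\<in>Basis. (v \<bullet> b) *\<^sub>R f b)"
    by (simp add: linear_sum[OF assms] linear_cmul[OF assms])
  finally show ?thesis .
qed

text \<open>The chain rule differentiates \<open>f\<close> in a direction that depends on
  \<open>x\<close>; hence the basis expansion in the middle space, and its type
  \<open>euclidean_space\<close>.\<close>

lemma C_k_on_compose:
  fixes g :: "'a::real_normed_vector \<Rightarrow> 'b::euclidean_space" and f :: "'b \<Rightarrow> 'c::real_normed_vector"
  assumes "open S" "open T" "g ` S \<subseteq> T" "C_k_on m T f" "C_k_on m S g"
  shows "C_k_on m S (\<lambda>x. f (g x))"
  using assms(4,5)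
proof (induction m arbitrary: f)
  case 0
  then show ?case using assms(3) by (auto intro: continuous_on_compose2)
next
  case (Suc m)
  show ?case
  proof (rule C_k_on_SucI[where f' = "\<lambda>x v. \<Sum>b\<in>Basis. (frechet_derivative g (at x) v \<bullet> b) *\<^sub>R frechet_derivative f (at (g x)) b"])
    fix x assume x: "x \<in> S"
    then have f: "(f has_derivative frechet_derivative f (at (g x))) (at (g x))"
      using Suc.prems assms(3) by (auto intro: C_k_on_has_derivative simp del: C_k_on.simps)
    have "((\<lambda>x. f (g x)) has_derivative (\<lambda>v. frechet_derivative f (at (g x)) (frechet_derivative g (at x) v))) (at x)"
      by (rule has_derivative_compose[OF C_k_on_has_derivative[OF Suc.prems(2) x] f])
    then show "((\<lambda>x. f (g x)) has_derivative (\<lambda>v. \<Sum>b\<in>Basis. (frechet_derivative g (at x) v \<bullet> b) *\<^sub>R frechet_derivative f (at (g x)) b)) (at x)"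
      by (subst (asm) linear_Basis_expansion[OF has_derivative_linear[OF f]])
  next
    fix v show "C_k_on m S (\<lambda>x. \<Sum>b\<in>Basis. (frechet_derivative g (at x) v \<bullet> b) *\<^sub>R frechet_derivative f (at (g x)) b)"
    proof (intro C_k_on_sum C_k_on_bilinear[OF bounded_bilinear_scaleR] assms(1))
      fix b :: 'b
      show "C_k_on m S (\<lambda>x. frechet_derivative g (at x) v \<bullet> b)"
        using Suc.prems by (intro C_k_on_linear_compose[OF bounded_linear_inner_left] assms(1)) auto
      show "C_k_on m S (\<lambda>x. frechet_derivative f (at (g x)) b)"
        using Suc.prems(1) C_k_on_SucD[OF Suc.prems(2)] by (intro Suc.IH[OF _ C_k_on_SucD[OF Suc.prems(2)]]) simp
    qed
  qed fact
qed

lemma C_k_on_inverse: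
  fixes f :: "'a::real_normed_vector \<Rightarrow> real"
  assumes "open S" "\<And>x. x \<in> S \<Longrightarrow> f x \<noteq> 0" "C_k_on m S f"
  shows "C_k_on m S (\<lambda>x. inverse (f x))"
  using assms(3)
proof (induction m)
  case 0
  then show ?case using assms by (auto intro: continuous_on_inverse)
next
  case (Suc m)
  \<comment> \<open>The derivative of the reciprocal contains the reciprocal again, but only to
    order \<open>m\<close>, which the induction hypothesis supplies.\<close>
  have IH: "C_k_on m S (\<lambda>x. inverse (f x))"
    using Suc C_k_on_SucD by blast
  show ?case
  proof (rule C_k_on_SucI[where f' = "\<lambda>x v. - (inverse (f x) * frechet_derivative f (at x) v * inverse (f x))"])
    fix v
    have "C_k_on m S (\<lambda>x. frechet_derivative f (at x) v)" using Suc.prems by simp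
    then show "C_k_on m S (\<lambda>x. - (inverse (f x) * frechet_derivative f (at x) v * inverse (f x)))"
      by (intro C_k_on_linear_compose[OF bounded_linear_minus[OF bounded_linear_ident]]
          C_k_on_bilinear[OF bounded_bilinear_mult] IH assms(1))
  next
    show "((\<lambda>x. inverse (f x)) has_derivative
        (\<lambda>v. - (inverse (f x) * frechet_derivative f (at x) v * inverse (f x)))) (at x)" if "x \<in> S" for x
      by (rule Deriv.has_derivative_inverse[OF assms(2)[OF that] C_k_on_has_derivative[OF Suc.prems that]])
  qed fact
qed

lemma C_k_on_frechet_derivative:
  fixes f :: "'a::euclidean_space \<Rightarrow> 'b::real_normed_vector" and P :: "'c::real_normed_vector \<Rightarrow> 'a"
  assumes "open S" "open T" "C_k_on (Suc m) T f" "C_k_on m S P" "P ` S \<subseteq> T" "C_k_on m S u"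
  shows "C_k_on m S (\<lambda>x. frechet_derivative f (at (P x)) (u x))"
proof (rule C_k_on_cong[OF assms(1)])
  show "(\<Sum>b\<in>Basis. (u x \<bullet> b) *\<^sub>R frechet_derivative f (at (P x)) b) = frechet_derivative f (at (P x)) (u x)"
    if "x \<in> S" for x
    using that assms(3,5) linear_frechet_derivative by (subst linear_Basis_expansion) auto
  have "C_k_on m T (\<lambda>x. frechet_derivative f (at x) b)" for b
    using assms(3) by simp
  then show "C_k_on m S (\<lambda>x. \<Sum>b\<in>Basis. (u x \<bullet> b) *\<^sub>R frechet_derivative f (at (P x)) b)"
    by (intro C_k_on_sum C_k_on_bilinear[OF bounded_bilinear_scaleR] assms(1)
        C_k_on_linear_compose[OF bounded_linear_inner_left] assms(6)
        C_k_on_compose[OF assms(1,2,5) _ assms(4)]) auto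
qed

text \<open>Strict differentiability: near \<open>p\<close> the map differs from its linear part by
  an \<open>e\<close>-Lipschitz function. This is the mean value inequality for \<open>g\<close>
  minus its derivative at \<open>p\<close>, on a ball where the derivative moves by at most
  \<open>e\<close>.\<close>

lemma C_1_strictly_differentiable:
  fixes g :: "'a::euclidean_space \<Rightarrow> 'b::real_normed_vector"
  assumes "open S" "p \<in> S" "C_k_on (Suc 0) S g" "e > 0"
  shows "\<exists>d>0. ball p d \<subseteq> S \<and> (\<forall>a\<in>ball p d. \<forall>v.
      norm (frechet_derivative g (at a) v - frechet_derivative g (at p) v) \<le> e * norm v) \<and>
    (\<forall>a\<in>ball p d. \<forall>b\<in>ball p d. norm (g b - g a - frechet_derivative g (at p) (b - a)) \<le> e * norm (b - a))"
proof -
  let ?D = "\<lambda>x. frechet_derivative g (at x)"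
  \<comment> \<open>A basis sum stands in for the operator norm of the difference: it is continuous
    because derivatives in fixed directions are, and it dominates the difference in every
    direction.\<close>
  let ?s = "\<lambda>x. \<Sum>b\<in>Basis. norm (?D x b - ?D p b)"
  have "continuous_on S (\<lambda>x. ?D x b)" for b using assms(3) by simp
  then have "continuous_on S ?s" by (intro continuous_intros)
  then have "open (S \<inter> ?s -` {..<e})"
    using assms(1) by (intro continuous_open_preimage) auto
  moreover have "p \<in> S \<inter> ?s -` {..<e}" using assms(2,4) by simp
  ultimately obtain d where d: "d > 0" "ball p d \<subseteq> S \<inter> ?s -` {..<e}"
    by (rule openE)
  have lin: "bounded_linear (?D x)" if "x \<in> S" for x
    using that assms(3) C_k_on_has_derivative has_derivative_bounded_linear by blast
  have bd: "norm (?D a v - ?D p v) \<le> e * norm v" if "a \<in> ball p d" for a v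
  proof -
    have "a \<in> S \<inter> ?s -` {..<e}" using that d(2) by blast
    then have a: "a \<in> S" "?s a < e" by simp_all
    have "linear (\<lambda>v. ?D a v - ?D p v)"
      using lin[OF a(1)] lin[OF assms(2)] by (intro bounded_linear.linear bounded_linear_sub)
    have "norm (?D a v - ?D p v) \<le> (\<Sum>b\<in>Basis. norm ((v \<bullet> b) *\<^sub>R (?D a b - ?D p b)))"
      unfolding linear_Basis_expansion[OF \<open>linear (\<lambda>v. ?D a v - ?D p v)\<close>, of v] by (rule norm_sum)
    also have "\<dots> \<le> (\<Sum>b\<in>Basis. norm v * norm (?D a b - ?D p b))"
      by (intro sum_mono) (simp add: Basis_le_norm mult_right_mono)
    also have "\<dots> = norm v * ?s a" by (simp add: sum_distrib_left)
    also have "\<dots> \<le> norm v * e" using a by (intro mult_left_mono) auto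
    finally show ?thesis by (simp add: mult.commute)
  qed
  have "norm ((g b - ?D p b) - (g a - ?D p a)) \<le> e * norm (b - a)"
    if "a \<in> ball p d" "b \<in> ball p d" for a b
  proof (rule differentiable_bound[OF convex_ball _ _ that(2,1)])
    fix x assume x: "x \<in> ball p d"
    then have "x \<in> S" using d by auto
    then have "((\<lambda>x. g x - ?D p x) has_derivative (\<lambda>v. ?D x v - ?D p v)) (at x)"
      using C_k_on_has_derivative[OF assms(3)] lin[OF assms(2)]
      by (intro has_derivative_diff bounded_linear_imp_has_derivative) auto
    then show "((\<lambda>x. g x - ?D p x) has_derivative (\<lambda>v. ?D x v - ?D p v)) (at x within ball p d)"
      by (rule has_derivative_at_withinI)
    show "onorm (\<lambda>v. ?D x v - ?D p v) \<le> e"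
      using bd[OF x] by (intro onorm_le)
  qed
  moreover have "g b - g a - ?D p (b - a) = (g b - ?D p b) - (g a - ?D p a)" for a b
    using linear_diff[OF bounded_linear.linear[OF lin[OF assms(2)]], of b a] by simp
  ultimately have "norm (g b - g a - ?D p (b - a)) \<le> e * norm (b - a)"
    if "a \<in> ball p d" "b \<in> ball p d" for a b
    using that by metis
  then show ?thesis using d bd by blast
qed

text \<open>One radius for all base points of a compact set. The estimate at \<open>x\<close> is
  read off at the centre \<open>p\<close> of a covering ball; replacing the derivative at
  \<open>p\<close> by that at \<open>x\<close> costs the second half of \<open>e\<close>.\<close>

lemma C_1_uniform_Taylor:
  fixes g :: "'a::euclidean_space \<Rightarrow> 'b::real_normed_vector"
  assumes "open S" "compact K" "K \<subseteq> S" "C_k_on (Suc 0) S g" "e > 0"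
  shows "\<exists>d>0. \<forall>p\<in>K. \<forall>q. norm q < d \<longrightarrow>
    p + q \<in> S \<and> norm (g (p + q) - g p - frechet_derivative g (at p) q) \<le> e * norm q"
proof -
  define good where "good p d \<longleftrightarrow> d > 0 \<and> ball p d \<subseteq> S \<and> (\<forall>a\<in>ball p d. \<forall>v.
      norm (frechet_derivative g (at a) v - frechet_derivative g (at p) v) \<le> e/2 * norm v) \<and>
      (\<forall>a\<in>ball p d. \<forall>b\<in>ball p d. norm (g b - g a - frechet_derivative g (at p) (b - a)) \<le> e/2 * norm (b - a))"
    for p d
  have "\<exists>d. good p d" if "p \<in> K" for p
  proof -
    have "p \<in> S" "e/2 > 0" using that assms(3,5) by auto
    then show ?thesis unfolding good_def
      by (rule C_1_strictly_differentiable[OF assms(1) _ assms(4)])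
  qed
  then obtain d where d: "\<And>p. p \<in> K \<Longrightarrow> good p (d p)" by metis
  have "K \<subseteq> \<Union>((\<lambda>p. ball p (d p)) ` K)" using d by (force simp: good_def)
  \<comment> \<open>\<open>\<eta>\<close> is a Lebesgue number of the cover.\<close>
  with assms(2) obtain \<eta> where \<eta>: "\<eta> > 0" "\<And>x. x \<in> K \<Longrightarrow> \<exists>p\<in>K. ball x \<eta> \<subseteq> ball p (d p)"
    by (rule Heine_Borel_lemma[where \<G> = "(\<lambda>p. ball p (d p)) ` K"]) auto
  have *: "x + q \<in> S \<and> norm (g (x + q) - g x - frechet_derivative g (at x) q) \<le> e * norm q"
    if x: "x \<in> K" "norm q < \<eta>" for x q
  proof -
    obtain p where p: "p \<in> K" "ball x \<eta> \<subseteq> ball p (d p)" using \<eta> x by blast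
    have "x \<in> ball x \<eta>" "x + q \<in> ball x \<eta>" using x \<eta> by (auto simp: dist_norm)
    then have xq: "x \<in> ball p (d p)" "x + q \<in> ball p (d p)" using p by blast+
    note good = d[OF p(1), unfolded good_def]
    have "norm (g (x + q) - g x - frechet_derivative g (at p) (x + q - x)) \<le> e/2 * norm (x + q - x)"
      using good xq by blast
    then have "norm (g (x + q) - g x - frechet_derivative g (at p) q) \<le> e/2 * norm q" by simp
    moreover have "norm (frechet_derivative g (at x) q - frechet_derivative g (at p) q) \<le> e/2 * norm q"
      using good xq by blast
    ultimately have "norm ((g (x + q) - g x - frechet_derivative g (at p) q) -
        (frechet_derivative g (at x) q - frechet_derivative g (at p) q)) \<le> e/2 * norm q + e/2 * norm q"
      by (rule order_trans[OF norm_triangle_ineq4 add_mono])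
    moreover have "x + q \<in> S" using good xq(2) by blast
    ultimately show ?thesis by (simp add: algebra_simps)
  qed
  show ?thesis using \<eta>(1) * by blast
qed

section \<open>Closure properties of smooth maps\<close>

lemma smooth_on_C_k: "smooth_on S f \<Longrightarrow> C_k_on m S f"
  by (simp add: smooth_on_def)

lemma smooth_on_subset: "smooth_on S f \<Longrightarrow> T \<subseteq> S \<Longrightarrow> smooth_on T f"
  unfolding smooth_on_def using C_k_on_subset by blast

lemma smooth_on_cong: "open S \<Longrightarrow> (\<And>x. x \<in> S \<Longrightarrow> f x = g x) \<Longrightarrow> smooth_on S f \<Longrightarrow> smooth_on S g"
  unfolding smooth_on_def using C_k_on_cong by blast

lemma smooth_on_imp_continuous: "smooth_on S f \<Longrightarrow> continuous_on S f"
  using C_k_on_imp_continuous[OF smooth_on_C_k] .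

lemma smooth_on_has_derivative:
  "smooth_on S f \<Longrightarrow> x \<in> S \<Longrightarrow> (f has_derivative frechet_derivative f (at x)) (at x)"
  by (rule C_k_on_has_derivative[OF smooth_on_C_k])

lemma smooth_on_linear: "bounded_linear f \<Longrightarrow> open S \<Longrightarrow> smooth_on S f"
  by (simp add: smooth_on_def C_k_on_linear)

lemma smooth_on_const: "open S \<Longrightarrow> smooth_on S (\<lambda>x. c)"
  by (simp add: smooth_on_def)

lemma smooth_on_linear_compose:
  "bounded_linear l \<Longrightarrow> open S \<Longrightarrow> smooth_on S f \<Longrightarrow> smooth_on S (\<lambda>x. l (f x))"
  by (simp add: smooth_on_def C_k_on_linear_compose)

lemma smooth_on_add:
  "open S \<Longrightarrow> smooth_on S f \<Longrightarrow> smooth_on S g \<Longrightarrow> smooth_on S (\<lambda>x. f x + g x)"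
  by (simp add: smooth_on_def C_k_on_add)

lemma smooth_on_Pair:
  "open S \<Longrightarrow> smooth_on S f \<Longrightarrow> smooth_on S g \<Longrightarrow> smooth_on S (\<lambda>x. (f x, g x))"
  by (simp add: smooth_on_def C_k_on_Pair)

lemma smooth_on_uminus: "open S \<Longrightarrow> smooth_on S f \<Longrightarrow> smooth_on S (\<lambda>x. - f x)"
  by (rule smooth_on_linear_compose[OF bounded_linear_minus[OF bounded_linear_ident]])

lemma smooth_on_compose:
  fixes g :: "'a::real_normed_vector \<Rightarrow> 'b::euclidean_space"
  shows "open S \<Longrightarrow> open T \<Longrightarrow> g ` S \<subseteq> T \<Longrightarrow> smooth_on T f \<Longrightarrow> smooth_on S g \<Longrightarrow> smooth_on S (\<lambda>x. f (g x))"
  by (simp add: smooth_on_def C_k_on_compose)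

lemma smooth_on_inverse:
  fixes f :: "'a::real_normed_vector \<Rightarrow> real"
  shows "open S \<Longrightarrow> (\<And>x. x \<in> S \<Longrightarrow> f x \<noteq> 0) \<Longrightarrow> smooth_on S f \<Longrightarrow> smooth_on S (\<lambda>x. inverse (f x))"
  by (simp add: smooth_on_def C_k_on_inverse)

lemma smooth_on_frechet_derivative:
  fixes f :: "'a::euclidean_space \<Rightarrow> 'b::real_normed_vector"
  assumes "open S" "open T" "smooth_on T f" "smooth_on S P" "P ` S \<subseteq> T" "smooth_on S u"
  shows "smooth_on S (\<lambda>x. frechet_derivative f (at (P x)) (u x))"
  using assms by (simp add: smooth_on_def C_k_on_frechet_derivative del: C_k_on.simps)

section \<open>Ordinary differential equations with parameters\<close>

lemma onorm_scaleR_le: "norm v \<le> B \<Longrightarrow> onorm (\<lambda>h. h *\<^sub>R v) \<le> B"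
proof (rule onorm_le)
  fix h :: real
  assume "norm v \<le> B"
  then show "norm (h *\<^sub>R v) \<le> B * norm h"
    using mult_right_mono[of "norm v" B "\<bar>h\<bar>"] by (simp add: mult.commute)
qed

text \<open>The norm is estimated at its maximum \<open>c\<close> on the segment. The mean value
  inequality bounds it there by its initial value plus at most half of itself plus the error term,
  and the half is absorbed.\<close>

lemma norm_le_of_derivative_bound:
  fixes w :: "real \<Rightarrow> 'a::real_normed_vector"
  assumes der: "\<And>s. s \<in> closed_segment a t \<Longrightarrow> (w has_vector_derivative w' s) (at s within closed_segment a t)"
    and bd: "\<And>s. s \<in> closed_segment a t \<Longrightarrow> norm (w' s) \<le> L * norm (w s) + \<eta>"
    and L: "0 \<le> L" "L * \<bar>t - a\<bar> \<le> 1/2"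
  shows "norm (w t) \<le> 2 * (norm (w a) + \<bar>t - a\<bar> * \<eta>)"
proof -
  let ?S = "closed_segment a t"
  have "continuous_on ?S w" using der
    by (meson continuous_on_eq_continuous_within has_vector_derivative_continuous)
  then have "continuous_on ?S (\<lambda>s. norm (w s))" by (rule continuous_on_norm)
  then obtain c where c: "c \<in> ?S" "\<And>s. s \<in> ?S \<Longrightarrow> norm (w s) \<le> norm (w c)"
    using continuous_attains_sup[of ?S "\<lambda>s. norm (w s)"] by auto
  define M where "M = norm (w c)"
  have le: "norm (w' s) \<le> L * M + \<eta>" if "s \<in> ?S" for s
    using bd[OF that] mult_left_mono[OF c(2)[OF that] L(1)] by (simp add: M_def)
  have "norm (w c - w a) \<le> (L * M + \<eta>) * norm (c - a)"
  proof (rule differentiable_bound[OF convex_closed_segment _ _ c(1)])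
    fix s assume s: "s \<in> ?S"
    show "(w has_derivative (\<lambda>h. h *\<^sub>R w' s)) (at s within ?S)"
      using der[OF s] by (simp add: has_vector_derivative_def)
    show "onorm (\<lambda>h. h *\<^sub>R w' s) \<le> L * M + \<eta>"
      using le[OF s] by (rule onorm_scaleR_le)
  qed simp
  also have "\<dots> \<le> (L * M + \<eta>) * \<bar>t - a\<bar>"
  proof (rule mult_left_mono)
    show "norm (c - a) \<le> \<bar>t - a\<bar>"
      using c(1) by (auto simp: closed_segment_eq_real_ivl split: if_splits)
    show "0 \<le> L * M + \<eta>" using le[OF c(1)] norm_ge_zero order_trans by blast
  qed
  also have "\<dots> = (L * \<bar>t - a\<bar>) * M + \<bar>t - a\<bar> * \<eta>" by (simp add: algebra_simps)
  also have "\<dots> \<le> 1/2 * M + \<bar>t - a\<bar> * \<eta>"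
    using mult_right_mono[OF L(2), of M] by (simp add: M_def)
  finally have "norm (w c - w a) \<le> 1/2 * M + \<bar>t - a\<bar> * \<eta>" .
  moreover have "M \<le> norm (w a) + norm (w c - w a)"
    unfolding M_def using norm_triangle_sub by blast
  ultimately have "M \<le> 2 * (norm (w a) + \<bar>t - a\<bar> * \<eta>)" by argo
  then show ?thesis using c(2)[of t] by (simp add: M_def)
qed

text \<open>The Lipschitz bound holds on the whole space, so iterates cannot leave a domain, and
  \<open>L * \<delta> \<le> 1/2\<close> halves the distance of successive iterates. Convergence is
  uniform on compact subintervals, where the first step is bounded.\<close>

lemma Picard_existence:
  fixes g :: "real \<Rightarrow> 'a::euclidean_space \<Rightarrow> 'a"
  assumes "\<delta> > 0" and L: "0 \<le> L" "L * \<delta> \<le> 1/2"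
    and cont: "continuous_on ({-\<delta><..<\<delta>} \<times> UNIV) (\<lambda>(t, z). g t z)"
    and lip: "\<And>t z z'. t \<in> {-\<delta><..<\<delta>} \<Longrightarrow> norm (g t z - g t z') \<le> L * norm (z - z')"
  shows "\<exists>z. z 0 = z0 \<and> (\<forall>t\<in>{-\<delta><..<\<delta>}. (z has_vector_derivative g t (z t)) (at t))"
proof -
  let ?J = "{-\<delta><..<\<delta>}"
  \<comment> \<open>Integration of a continuous curve on the open interval, normalised to
    \<open>z0\<close> at time 0: one step of the iteration.\<close>
  have antiderivative: "\<exists>C. C 0 = z0 \<and> (\<forall>t\<in>?J. (C has_vector_derivative c t) (at t))"
    if c: "continuous_on ?J c" for c :: "real \<Rightarrow> 'a"
  proof -
    have "\<exists>F. \<forall>x::real. ereal (-\<delta>) < x \<longrightarrow> x < ereal \<delta> \<longrightarrow> (F has_vector_derivative c x) (at x)"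
      using c \<open>\<delta> > 0\<close>
      by (intro einterval_antiderivative) (auto simp: continuous_on_eq_continuous_at)
    then obtain F where F: "\<And>x. x \<in> ?J \<Longrightarrow> (F has_vector_derivative c x) (at x)" by auto
    have "((\<lambda>x. F x - F 0 + z0) has_vector_derivative c x) (at x)" if "x \<in> ?J" for x
      using F[OF that] by (auto intro!: derivative_eq_intros)
    then show ?thesis by (intro exI[of _ "\<lambda>x. F x - F 0 + z0"]) simp
  qed
  have "\<exists>W. \<forall>n. (W n 0 = z0 \<and> continuous_on ?J (W n)) \<and>
      (\<forall>t\<in>?J. (W (Suc n) has_vector_derivative g t (W n t)) (at t))"
  proof (rule dependent_nat_choice)
    show "\<exists>w. w 0 = z0 \<and> continuous_on ?J w" by (intro exI[of _ "\<lambda>t. z0"]) simp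
    fix w :: "real \<Rightarrow> 'a" and n :: nat
    assume w: "w 0 = z0 \<and> continuous_on ?J w"
    have "continuous_on ?J (\<lambda>t. (case (t, w t) of (t, z) \<Rightarrow> g t z))"
      using w by (intro continuous_on_compose2[OF cont]) (auto intro!: continuous_intros)
    then have "continuous_on ?J (\<lambda>t. g t (w t))" by simp
    from antiderivative[OF this] obtain C where C: "C 0 = z0" "\<And>t. t \<in> ?J \<Longrightarrow> (C has_vector_derivative g t (w t)) (at t)"
      by blast
    have "continuous_on ?J C"
      using C(2) by (meson continuous_at_imp_continuous_on has_vector_derivative_continuous)
    then show "\<exists>w'. (w' 0 = z0 \<and> continuous_on ?J w') \<and>
        (\<forall>t\<in>?J. (w' has_vector_derivative g t (w t)) (at t))"
      using C by blast
  qed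
  then obtain W where W0: "\<And>n. W n 0 = z0" and Wc: "\<And>n. continuous_on ?J (W n)"
    and W': "\<And>n t. t \<in> ?J \<Longrightarrow> (W (Suc n) has_vector_derivative g t (W n t)) (at t)"
    by blast
  \<comment> \<open>The limit is written as a telescoping series, so that the geometric bound feeds
    the Weierstrass test.\<close>
  define z where "z t = W 0 t + (\<Sum>i. W (Suc i) t - W i t)" for t
  have "(z has_vector_derivative g t (z t)) (at t)" if t: "t \<in> ?J" for t
  proof -
    define r where "r = (\<bar>t\<bar> + \<delta>) / 2"
    have r: "\<bar>t\<bar> < r" "r < \<delta>" "0 \<le> r" using t by (auto simp: r_def)
    let ?S = "{-r..r}"
    have SJ: "?S \<subseteq> ?J" using r by auto
    have "continuous_on ?S (\<lambda>t. norm (W (Suc 0) t - W 0 t))"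
      by (intro continuous_intros continuous_on_subset[OF Wc SJ])
    then have "bdd_above ((\<lambda>t. norm (W (Suc 0) t - W 0 t)) ` ?S)"
      by (intro bounded_imp_bdd_above compact_imp_bounded compact_continuous_image) auto
    then obtain M where M: "\<And>t. t \<in> ?S \<Longrightarrow> norm (W (Suc 0) t - W 0 t) \<le> M"
      unfolding bdd_above_def by blast
    have bd: "norm (W (Suc n) s - W n s) \<le> M * (1/2) ^ n" if "s \<in> ?S" for n s
      using that
    proof (induction n arbitrary: s)
      case 0
      then show ?case using M by simp
    next
      case (Suc n)
      have "norm ((W (Suc (Suc n)) s - W (Suc n) s) - (W (Suc (Suc n)) 0 - W (Suc n) 0))
          \<le> (L * (M * (1/2) ^ n)) * norm (s - 0)"
      proof (rule differentiable_bound[of ?S])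
        fix x assume x: "x \<in> ?S"
        have "((\<lambda>s. W (Suc (Suc n)) s - W (Suc n) s) has_vector_derivative g x (W (Suc n) x) - g x (W n x)) (at x)"
          using x SJ by (intro has_vector_derivative_diff W') auto
        then show "((\<lambda>s. W (Suc (Suc n)) s - W (Suc n) s) has_derivative
            (\<lambda>h. h *\<^sub>R (g x (W (Suc n) x) - g x (W n x)))) (at x within ?S)"
          unfolding has_vector_derivative_def by (rule has_derivative_at_withinI)
        have "norm (g x (W (Suc n) x) - g x (W n x)) \<le> L * norm (W (Suc n) x - W n x)"
          using lip x SJ by blast
        also have "\<dots> \<le> L * (M * (1/2) ^ n)" using Suc.IH[OF x] L by (intro mult_left_mono)
        finally show "onorm (\<lambda>h. h *\<^sub>R (g x (W (Suc n) x) - g x (W n x))) \<le> L * (M * (1/2) ^ n)"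
          by (rule onorm_scaleR_le)
      qed (use Suc.prems r in auto)
      then have "norm (W (Suc (Suc n)) s - W (Suc n) s) \<le> (L * (M * (1/2) ^ n)) * \<bar>s\<bar>"
        by (simp add: W0)
      also have "\<dots> = (L * \<bar>s\<bar>) * (M * (1/2) ^ n)" by simp
      also have "\<dots> \<le> 1/2 * (M * (1/2) ^ n)"
      proof (rule mult_right_mono)
        have "L * \<bar>s\<bar> \<le> L * \<delta>" using Suc.prems r L by (intro mult_left_mono) auto
        then show "L * \<bar>s\<bar> \<le> 1/2" using L by linarith
        show "0 \<le> M * (1/2) ^ n" using Suc.IH[OF Suc.prems] norm_ge_zero order_trans by blast
      qed
      finally show ?case by simp
    qed
    have "uniform_limit ?S (\<lambda>n x. \<Sum>i<n. W (Suc i) x - W i x) (\<lambda>x. \<Sum>i. W (Suc i) x - W i x) sequentially"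
      using bd by (rule Weierstrass_m_test) (auto intro!: summable_mult summable_geometric)
    moreover have "(\<Sum>i<n. W (Suc i) x - W i x) = W n x - W 0 x" for n x
      by (rule sum_lessThan_telescope[of "\<lambda>i. W i x"])
    ultimately have lim: "uniform_limit ?S (\<lambda>n x. W n x) z sequentially"
      unfolding uniform_limit_iff z_def
      by (simp add: dist_norm diff_diff_eq)
    \<comment> \<open>The derivatives converge uniformly by the Lipschitz bound, so the limit may be
      differentiated. The sequence is shifted by one because only \<open>W (Suc n)\<close> has a
      known derivative.\<close>
    have "\<exists>G. \<forall>x\<in>?S. (\<lambda>n. W (Suc n) x) \<longlonglongrightarrow> G x \<and>
        (G has_derivative (\<lambda>h. h *\<^sub>R g x (z x))) (at x within ?S)"
    proof (rule has_derivative_sequence[where f' = "\<lambda>n x h. h *\<^sub>R g x (W n x)"])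
      fix n x assume "x \<in> ?S"
      then have "x \<in> ?J" using SJ by blast
      from W'[OF this] show "(W (Suc n) has_derivative (\<lambda>h. h *\<^sub>R g x (W n x))) (at x within ?S)"
        unfolding has_vector_derivative_def by (rule has_derivative_at_withinI)
    next
      fix e :: real assume "e > 0"
      \<comment> \<open>\<open>L + 1\<close> because \<open>L\<close> may vanish.\<close>
      then have "e / (L + 1) > 0" using L by simp
      from uniform_limitD[OF lim this]
      show "\<forall>\<^sub>F n in sequentially. \<forall>x\<in>?S. \<forall>h. norm (h *\<^sub>R g x (W n x) - h *\<^sub>R g x (z x)) \<le> e * norm h"
      proof eventually_elim
        case (elim n)
        show ?case
        proof (intro ballI allI)
          fix x and h :: real assume x: "x \<in> ?S"
          have "norm (g x (W n x) - g x (z x)) \<le> L * norm (W n x - z x)"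
            using lip x SJ by blast
          also have "\<dots> \<le> L * (e / (L + 1))"
            using elim x L by (intro mult_left_mono) (auto simp: dist_norm less_imp_le)
          also have "\<dots> \<le> e" using L \<open>e > 0\<close> by (simp add: field_simps)
          finally show "norm (h *\<^sub>R g x (W n x) - h *\<^sub>R g x (z x)) \<le> e * norm h"
            using mult_right_mono[of "norm (g x (W n x) - g x (z x))" e "\<bar>h\<bar>"]
            by (simp add: mult.commute flip: scaleR_diff_right)
        qed
      qed
    next
      show "(\<lambda>n. W (Suc n) 0) \<longlonglongrightarrow> z0" by (simp add: W0)
    qed (use r in auto)
    then obtain G where G: "\<And>x. x \<in> ?S \<Longrightarrow> (\<lambda>n. W (Suc n) x) \<longlonglongrightarrow> G x"
      "\<And>x. x \<in> ?S \<Longrightarrow> (G has_vector_derivative g x (z x)) (at x within ?S)"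
      unfolding has_vector_derivative_def by blast
    have Gz: "G x = z x" if "x \<in> ?S" for x
      using LIMSEQ_unique[OF G(1)[OF that] LIMSEQ_Suc[OF tendsto_uniform_limitI[OF lim that]]] .
    have tS: "t \<in> ?S" using r by auto
    have "(z has_vector_derivative g t (z t)) (at t within ?S)"
      by (rule has_vector_derivative_transform[OF tS Gz[symmetric] G(2)[OF tS]])
    moreover have "at t within ?S = at t"
      by (rule at_within_interior) (use r in auto)
    ultimately show ?thesis by simp
  qed
  moreover have "z 0 = z0" by (simp add: z_def W0)
  ultimately show ?thesis by blast
qed

section \<open>Differentiable dependence on parameters\<close>

lemma norm_frechet_derivative_snd_le:
  fixes g :: "'a::real_normed_vector \<times> 'b::real_normed_vector \<Rightarrow> 'c::real_normed_vector"
  assumes "open W" "z \<in> W" "(g has_derivative D) (at (p, z))"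
    and lip: "\<And>z'. z' \<in> W \<Longrightarrow> norm (g (p, z') - g (p, z)) \<le> L * norm (z' - z)"
  shows "norm (D (0, v)) \<le> L * norm v"
proof -
  have "((\<lambda>s. (p, z + s *\<^sub>R v)) has_derivative (\<lambda>s. (0, s *\<^sub>R v))) (at 0)"
    by (auto intro!: derivative_eq_intros)
  moreover have "(g has_derivative D) (at (p, z + 0 *\<^sub>R v))" using assms(3) by simp
  ultimately have "((\<lambda>s. g (p, z + s *\<^sub>R v)) has_derivative (\<lambda>s. D (0, s *\<^sub>R v))) (at 0)"
    by (rule has_derivative_compose)
  moreover have "D (0, s *\<^sub>R v) = s *\<^sub>R D (0, v)" for s
    using linear_cmul[OF has_derivative_linear[OF assms(3)], of s "(0, v)"] by simp
  ultimately have "((\<lambda>s. g (p, z + s *\<^sub>R v)) has_vector_derivative D (0, v)) (at 0)"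
    by (simp add: has_vector_derivative_def)
  then have der: "((\<lambda>s. g (p, z + s *\<^sub>R v)) has_derivative (\<lambda>s. s *\<^sub>R D (0, v))) (at 0)"
    by (simp add: has_vector_derivative_def)
  \<comment> \<open>Only small positive \<open>s\<close> are used: there
    \<open>z + s *\<^sub>R v\<close> stays in \<open>W\<close>, and the difference quotient is at
    most \<open>L * norm v\<close>.\<close>
  have "((\<lambda>s. z + s *\<^sub>R v) \<longlongrightarrow> z + 0 *\<^sub>R v) (at_right 0)" by (intro tendsto_intros)
  then have W: "\<forall>\<^sub>F s in at_right 0. z + s *\<^sub>R v \<in> W"
    using topological_tendstoD[OF _ assms(1)] assms(2) by simp
  show ?thesis
  proof (rule field_le_epsilon)
    fix e :: real assume "e > 0"
    then obtain d where d: "d > 0"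
      "\<And>s. norm (s - 0) < d \<Longrightarrow>
        norm (g (p, z + s *\<^sub>R v) - g (p, z + 0 *\<^sub>R v) - (s - 0) *\<^sub>R D (0, v)) \<le> e * norm (s - 0)"
      using der unfolding has_derivative_at_alt by blast
    have "\<forall>\<^sub>F s in at_right 0. s \<in> {0<..<d}"
      using d(1) by (rule eventually_at_right_real)
    from eventually_happens[OF eventually_conj[OF W this]] obtain s
      where s: "z + s *\<^sub>R v \<in> W" "0 < s" "s < d" by auto
    have "s * norm (D (0, v)) = norm (s *\<^sub>R D (0, v))" using s by simp
    also have "\<dots> \<le> norm (g (p, z + s *\<^sub>R v) - g (p, z)) + norm (g (p, z + s *\<^sub>R v) - g (p, z) - s *\<^sub>R D (0, v))"
      by (metis norm_triangle_sub norm_minus_commute)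
    also have "\<dots> \<le> L * norm ((z + s *\<^sub>R v) - z) + e * s"
      using lip[OF s(1)] d(2)[of s] s by (intro add_mono) auto
    also have "\<dots> = s * (L * norm v + e)" using s by (simp add: algebra_simps)
    finally show "norm (D (0, v)) \<le> L * norm v + e" using s by simp
  qed
qed

text \<open>The family \<open>y\<close> is given, with no smoothness in the parameter assumed, so
  that the same locale also describes the variational equation. There \<open>W\<close> is the whole
  space, while for a nonlinear \<open>g\<close> the Lipschitz bound and the solutions are confined
  to \<open>W\<close>.\<close>

locale parametric_ode =
  fixes \<delta> L :: real and V :: "'p::euclidean_space set" and W :: "'a::euclidean_space set"
    and g :: "('p \<times> real) \<times> 'a \<Rightarrow> 'a" and y :: "'p \<times> real \<Rightarrow> 'a"
  assumes \<delta>: "\<delta> > 0" and L: "0 \<le> L" "L * \<delta> \<le> 1/2"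
    and open_V: "open V" and open_W: "open W"
    and in_W: "\<And>x t. x \<in> V \<Longrightarrow> t \<in> {-\<delta><..<\<delta>} \<Longrightarrow> y (x, t) \<in> W"
    and ode: "\<And>x t. x \<in> V \<Longrightarrow> t \<in> {-\<delta><..<\<delta>} \<Longrightarrow>
      ((\<lambda>s. y (x, s)) has_vector_derivative g ((x, t), y (x, t))) (at t)"
    and lip: "\<And>x t z z'. x \<in> V \<Longrightarrow> t \<in> {-\<delta><..<\<delta>} \<Longrightarrow> z \<in> W \<Longrightarrow> z' \<in> W \<Longrightarrow>
      norm (g ((x, t), z) - g ((x, t), z')) \<le> L * norm (z - z')"
begin

abbreviation "J \<equiv> {-\<delta><..<\<delta>}"

lemma closed_segment_subset_J: "t \<in> J \<Longrightarrow> closed_segment 0 t \<subseteq> J"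
  using \<delta> by (auto simp: closed_segment_eq_real_ivl split: if_splits)

lemma L_mult_le: "t \<in> J \<Longrightarrow> L * \<bar>t - 0\<bar> \<le> 1/2"
  using L mult_left_mono[of "\<bar>t\<bar>" \<delta> L] by force

lemma norm_le_J:
  assumes "t \<in> J" "0 \<le> \<eta>"
    and "\<And>s. s \<in> closed_segment 0 t \<Longrightarrow> (w has_vector_derivative w' s) (at s)"
    and "\<And>s. s \<in> closed_segment 0 t \<Longrightarrow> norm (w' s) \<le> L * norm (w s) + \<eta>"
  shows "norm (w t) \<le> 2 * (norm (w 0) + \<delta> * \<eta>)"
proof -
  have "norm (w t) \<le> 2 * (norm (w 0) + \<bar>t - 0\<bar> * \<eta>)"
    by (rule norm_le_of_derivative_bound[OF has_vector_derivative_at_within[OF assms(3)] assms(4) L(1) L_mult_le[OF assms(1)]])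
  also have "\<dots> \<le> 2 * (norm (w 0) + \<delta> * \<eta>)"
    using assms(1,2) mult_right_mono[of "\<bar>t\<bar>" \<delta> \<eta>] by force
  finally show ?thesis .
qed

lemma continuous_time: "x \<in> V \<Longrightarrow> continuous_on J (\<lambda>t. y (x, t))"
  using ode by (meson continuous_at_imp_continuous_on has_vector_derivative_continuous)

lemma graph_in: "x \<in> V \<Longrightarrow> t \<in> J \<Longrightarrow> ((x, t), y (x, t)) \<in> (V \<times> J) \<times> W"
  using in_W by simp

text \<open>Neighbouring solutions differ by at most twice the sum of their initial difference and
  an integrated defect, the defect being that of the solution at \<open>x0\<close> in the equation
  with parameter \<open>x\<close>. No derivative of \<open>g\<close> enters.\<close>

lemma continuous_on_solution:
  assumes g: "continuous_on ((V \<times> J) \<times> W) g" and y0: "continuous_on V (\<lambda>x. y (x, 0))"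
  shows "continuous_on (V \<times> J) y"
  unfolding continuous_on_iff
proof (safe)
  fix x0 t0 and e :: real assume x0: "x0 \<in> V" and t0: "t0 \<in> J" and e: "e > 0"
  define r where "r = (\<bar>t0\<bar> + \<delta>) / 2"
  have r: "\<bar>t0\<bar> < r" "r < \<delta>" "0 \<le> r" using t0 by (auto simp: r_def)
  let ?C = "{-r..r}"
  have CJ: "?C \<subseteq> J" using r by auto
  \<comment> \<open>With an initial difference below \<open>e/8\<close> the estimate gives
    \<open>2 * (e/8 + e/16) < e/2\<close>; the other \<open>e/2\<close> is spent on moving the
    time.\<close>
  define \<eta> where "\<eta> = e / (16 * \<delta>)"
  have \<eta>: "\<eta> > 0" "\<delta> * \<eta> = e / 16" using e \<delta> by (auto simp: \<eta>_def)
  have "continuous_on (V \<times> ?C) (\<lambda>(x, t). g ((x, t), y (x0, t)))"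
  proof -
    have "continuous_on (V \<times> ?C) (\<lambda>p. y (x0, snd p))"
      by (rule continuous_on_compose2[OF continuous_time[OF x0], where f = snd])
        (use CJ in \<open>auto intro: continuous_on_snd continuous_on_id\<close>)
    then have "continuous_on (V \<times> ?C) (\<lambda>p. (p, y (x0, snd p)))"
      by (intro continuous_on_Pair continuous_on_id)
    then have "continuous_on (V \<times> ?C) (\<lambda>p. g (p, y (x0, snd p)))"
      by (rule continuous_on_compose2[OF g]) (use CJ in_W[OF x0] in auto)
    then show ?thesis by (simp add: case_prod_unfold)
  qed
  \<comment> \<open>Tube lemma: compactness of \<open>?C\<close> gives one neighbourhood of
    \<open>x0\<close> for all times.\<close>
  then obtain X0 where X0: "x0 \<in> X0" "open X0" and X0_le: "\<forall>x\<in>X0 \<inter> V. \<forall>t\<in>?C.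
      dist ((\<lambda>(x, t). g ((x, t), y (x0, t))) (x, t)) ((\<lambda>(x, t). g ((x, t), y (x0, t))) (x0, t)) \<le> \<eta>"
    by (rule continuous_on_prod_compactE[OF _ compact_Icc x0 \<eta>(1)])
  have X0_le: "norm (g ((x, t), y (x0, t)) - g ((x0, t), y (x0, t))) \<le> \<eta>"
    if "x \<in> X0 \<inter> V" "t \<in> ?C" for x t
    using X0_le[rule_format, OF that] by (simp add: dist_norm)
  obtain d1 where d1: "d1 > 0" "ball x0 d1 \<subseteq> X0" using X0 openE by blast
  have "e/8 > 0" "e/2 > 0" using e by auto
  obtain d2 where d2: "d2 > 0" "\<And>x. x \<in> V \<Longrightarrow> dist x x0 < d2 \<Longrightarrow> dist (y (x, 0)) (y (x0, 0)) < e/8"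
    using y0[unfolded continuous_on_iff, rule_format, OF x0 \<open>e/8 > 0\<close>] by blast
  obtain d3 where d3: "d3 > 0" "\<And>t. t \<in> J \<Longrightarrow> dist t t0 < d3 \<Longrightarrow> dist (y (x0, t)) (y (x0, t0)) < e/2"
    using continuous_time[OF x0, unfolded continuous_on_iff, rule_format, OF t0 \<open>e/2 > 0\<close>] by blast
  define d where "d = Min {d1, d2, d3, r - \<bar>t0\<bar>}"
  have "d > 0" using d1 d2 d3 r by (simp add: d_def)
  moreover have "dist (y (x, t)) (y (x0, t0)) < e"
    if xt: "x \<in> V" "t \<in> J" "dist (x, t) (x0, t0) < d" for x t
  proof -
    have dx: "dist x x0 < d" and dt: "dist t t0 < d"
      using xt(3) dist_fst_le[of "(x,t)" "(x0,t0)"] dist_snd_le[of "(x,t)" "(x0,t0)"] by auto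
    have "\<bar>t\<bar> < r" using dt by (auto simp: d_def dist_real_def)
    then have seg: "closed_segment 0 t \<subseteq> ?C" by (auto simp: closed_segment_eq_real_ivl split: if_splits)
    have x: "x \<in> X0 \<inter> V" using dx d1 xt(1) by (auto simp: d_def dist_commute)
    have "norm (y (x, t) - y (x0, t)) \<le> 2 * (norm (y (x, 0) - y (x0, 0)) + \<delta> * \<eta>)"
    proof (rule norm_le_J[OF xt(2)])
      fix s assume "s \<in> closed_segment 0 t"
      then have s: "s \<in> ?C" "s \<in> J" using seg CJ by blast+
      show "((\<lambda>s. y (x, s) - y (x0, s)) has_vector_derivative
          g ((x, s), y (x, s)) - g ((x0, s), y (x0, s))) (at s)"
        by (intro has_vector_derivative_diff ode xt(1) x0 s)
      have "norm (g ((x, s), y (x, s)) - g ((x, s), y (x0, s))) \<le> L * norm (y (x, s) - y (x0, s))"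
        by (intro lip in_W xt(1) x0 s)
      moreover have "norm (g ((x, s), y (x0, s)) - g ((x0, s), y (x0, s))) \<le> \<eta>"
        by (rule X0_le[OF x s(1)])
      ultimately show "norm (g ((x, s), y (x, s)) - g ((x0, s), y (x0, s))) \<le> L * norm (y (x, s) - y (x0, s)) + \<eta>"
        by (rule norm_diff_triangle_le)
    qed (use \<eta> in simp)
    also have "\<dots> < 2 * (e/8 + e/16)"
      using d2(2)[OF xt(1)] dx unfolding \<eta>(2) by (simp add: d_def dist_norm)
    finally have "dist (y (x, t)) (y (x0, t)) < e/2" using e by (simp add: dist_norm)
    moreover have "dist (y (x0, t)) (y (x0, t0)) < e/2" using d3 xt(2) dt by (simp add: d_def)
    ultimately show ?thesis using dist_triangle[of "y (x, t)" "y (x0, t0)" "y (x0, t)"] by linarith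
  qed
  ultimately show "\<exists>d>0. \<forall>x'\<in>V \<times> J. dist x' (x0, t0) < d \<longrightarrow> dist (y x') (y (x0, t0)) < e"
    by auto
qed

text \<open>A Lipschitz constant bounds the partial derivative; this is why the variational equation
  inherits \<open>L\<close>.\<close>

lemma norm_frechet_derivative_g_le:
  assumes g: "C_k_on (Suc 0) ((V \<times> J) \<times> W) g" and "x \<in> V" "t \<in> J" "z \<in> W"
  shows "norm (frechet_derivative g (at ((x, t), z)) (0, v)) \<le> L * norm v"
  using assms
  by (intro norm_frechet_derivative_snd_le[OF open_W _ C_k_on_has_derivative[OF g]] lip) auto

text \<open>Right-hand side of the equation linearised along \<open>y\<close>: the parameter varies
  by \<open>u\<close>, time does not vary, and \<open>snd q\<close> is the unknown. The solution
  \<open>y\<close> enters as a known coefficient.\<close>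

definition variational :: "'p \<Rightarrow> ('p \<times> real) \<times> 'a \<Rightarrow> 'a" where
  "variational u q = frechet_derivative g (at (fst q, y (fst q))) ((u, 0), snd q)"

lemma variational_diff:
  assumes g: "C_k_on (Suc 0) ((V \<times> J) \<times> W) g" and "x \<in> V" "t \<in> J"
  shows "variational u ((x, t), z) - variational u ((x, t), z') =
    frechet_derivative g (at ((x, t), y (x, t))) (0, z - z')"
proof -
  have "linear (frechet_derivative g (at ((x, t), y (x, t))))"
    using C_k_on_has_derivative[OF g graph_in[OF assms(2,3)]] by (rule has_derivative_linear)
  from linear_diff[OF this, of "((u, 0), z)" "((u, 0), z')"] show ?thesis
    by (simp add: variational_def)
qed

lemma open_domain: "open (V \<times> J)" "open ((V \<times> J) \<times> W)"
  by (intro open_Times open_V open_W open_greaterThanLessThan)+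

text \<open>The order count that drives the induction: one derivative is taken from
  \<open>g\<close>, none from \<open>y\<close>.\<close>

lemma C_k_on_variational:
  assumes g: "C_k_on (Suc m) ((V \<times> J) \<times> W) g" and y: "C_k_on m (V \<times> J) y"
  shows "C_k_on m ((V \<times> J) \<times> UNIV) (variational u)"
  unfolding variational_def
proof (rule C_k_on_frechet_derivative[OF _ open_domain(2) g])
  let ?S = "(V \<times> J) \<times> (UNIV :: 'a set)"
  show S: "open ?S" by (intro open_Times open_domain(1) open_UNIV)
  have "C_k_on m ?S (\<lambda>q. y (fst q))"
    by (rule C_k_on_compose[OF S open_domain(1) _ y C_k_on_linear[OF bounded_linear_fst S]]) auto
  then show "C_k_on m ?S (\<lambda>q. (fst q, y (fst q)))"
    by (rule C_k_on_Pair[OF S C_k_on_linear[OF bounded_linear_fst S]])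
  show "C_k_on m ?S (\<lambda>q. ((u, 0), snd q))"
    by (rule C_k_on_Pair[OF S C_k_on_const[OF S] C_k_on_linear[OF bounded_linear_snd S]])
  show "(\<lambda>q. (fst q, y (fst q))) ` ?S \<subseteq> (V \<times> J) \<times> W"
    using in_W by auto
qed

text \<open>The variational equation is affine in the unknown with Lipschitz constant
  \<open>L\<close> on the whole space, so it is solvable on all of \<open>J\<close> without
  shrinking the interval.\<close>

lemma ex_variational_solution:
  assumes g: "C_k_on (Suc 0) ((V \<times> J) \<times> W) g" and y0: "C_k_on (Suc 0) V (\<lambda>x. y (x, 0))"
  shows "\<exists>Z. (\<forall>u. \<forall>x\<in>V. Z u (x, 0) = frechet_derivative (\<lambda>x. y (x, 0)) (at x) u) \<and>
    (\<forall>u. parametric_ode \<delta> L V UNIV (variational u) (Z u))"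
proof -
  have y: "C_k_on 0 (V \<times> J) y"
    using continuous_on_solution[OF C_k_on_imp_continuous[OF g] C_k_on_imp_continuous[OF y0]] by simp
  have lipv: "norm (variational u ((x, t), z) - variational u ((x, t), z')) \<le> L * norm (z - z')"
    if "x \<in> V" "t \<in> J" for u x t z z'
    unfolding variational_diff[OF g that]
    by (rule norm_frechet_derivative_g_le[OF g that in_W[OF that]])
  have "\<exists>z. z 0 = frechet_derivative (\<lambda>x. y (x, 0)) (at x) u \<and>
      (\<forall>t\<in>J. (z has_vector_derivative variational u ((x, t), z t)) (at t))" if x: "x \<in> V" for u x
  proof (rule Picard_existence[OF \<delta> L])
    have cont: "continuous_on ((V \<times> J) \<times> UNIV) (variational u)"
      using C_k_on_variational[OF g y] by simp
    show "continuous_on (J \<times> UNIV) (\<lambda>(t, z). variational u ((x, t), z))"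
      unfolding case_prod_unfold
      by (rule continuous_on_compose2[OF cont, where f = "\<lambda>q. ((x, fst q), snd q)"])
        (use x in \<open>auto intro!: continuous_on_Pair continuous_on_const continuous_on_fst continuous_on_snd continuous_on_id\<close>)
  qed (rule lipv[OF x])
  then have "\<forall>u x. \<exists>z. x \<in> V \<longrightarrow> z 0 = frechet_derivative (\<lambda>x. y (x, 0)) (at x) u \<and>
      (\<forall>t\<in>J. (z has_vector_derivative variational u ((x, t), z t)) (at t))"
    by blast
  then obtain z where z: "\<And>u x. x \<in> V \<Longrightarrow> z u x 0 = frechet_derivative (\<lambda>x. y (x, 0)) (at x) u"
    "\<And>u x t. x \<in> V \<Longrightarrow> t \<in> J \<Longrightarrow> (z u x has_vector_derivative variational u ((x, t), z u x t)) (at t)"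
    by metis
  have "parametric_ode \<delta> L V UNIV (variational u) (\<lambda>(x, t). z u x t)" for u
    by (rule parametric_ode.intro) (use \<delta> L open_V z(2) lipv in simp_all)
  then show ?thesis using z(1) by (intro exI[of _ "\<lambda>u (x, t). z u x t"]) simp
qed

text \<open>The increment of \<open>y\<close> minus \<open>Z u\<close> solves the linearised
  equation up to the Taylor remainder of \<open>g\<close>. This remainder is small relative to
  \<open>norm u\<close> once the increment itself is known to be bounded by a multiple of
  \<open>norm u\<close>.\<close>

lemma has_derivative_space:
  assumes g: "C_k_on (Suc 0) ((V \<times> J) \<times> W) g" and y0: "C_k_on (Suc 0) V (\<lambda>x. y (x, 0))"
    and Z0: "\<And>u x. x \<in> V \<Longrightarrow> Z u (x, 0) = frechet_derivative (\<lambda>x. y (x, 0)) (at x) u"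
    and Z: "\<And>u. parametric_ode \<delta> L V UNIV (variational u) (Z u)"
    and x: "x \<in> V" and t: "t \<in> J"
  shows "((\<lambda>x. y (x, t)) has_derivative (\<lambda>u. Z u (x, t))) (at x)"
proof -
  let ?C = "closed_segment 0 t"
  let ?D = "\<lambda>s. frechet_derivative g (at ((x, s), y (x, s)))"
  let ?E = "frechet_derivative (\<lambda>x. y (x, 0)) (at x)"
  have CJ: "?C \<subseteq> J" by (rule closed_segment_subset_J[OF t])
  have D: "bounded_linear (?D s)" if "s \<in> J" for s
    using C_k_on_has_derivative[OF g graph_in[OF x that]] by (rule has_derivative_bounded_linear)
  have D_snd: "norm (?D s (0, v)) \<le> L * norm v" if "s \<in> J" for s v
    by (rule norm_frechet_derivative_g_le[OF g x that in_W[OF x that]])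
  have D0: "((\<lambda>x. y (x, 0)) has_derivative ?E) (at x)"
    by (rule C_k_on_has_derivative[OF y0 x])
  have Z': "((\<lambda>s. Z u (x, s)) has_vector_derivative ?D s ((u, 0), Z u (x, s))) (at s)"
    if "s \<in> J" for u s
    using parametric_ode.ode[OF Z x that] by (simp add: variational_def)

  \<comment> \<open>Nothing relates the solutions \<open>Z u\<close> for different \<open>u\<close>
    beforehand. Linearity comes from uniqueness: the defect solves the homogeneous equation with
    initial value 0.\<close>
  have "linear (\<lambda>u. Z u (x, t))"
  proof (rule linearI)
    fix u v
    let ?w = "\<lambda>s. Z (u + v) (x, s) - (Z u (x, s) + Z v (x, s))"
    have "norm (?w t) \<le> 2 * (norm (?w 0) + \<delta> * 0)"
    proof (rule norm_le_J[OF t])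
      fix s assume "s \<in> ?C"
      then have s: "s \<in> J" using CJ by blast
      have "?D s ((u + v, 0), Z (u + v) (x, s)) - (?D s ((u, 0), Z u (x, s)) + ?D s ((v, 0), Z v (x, s)))
          = ?D s (0, ?w s)"
        using linear_diff[OF bounded_linear.linear[OF D[OF s]], of "((u + v, 0), Z (u + v) (x, s))"
            "((u, 0), Z u (x, s)) + ((v, 0), Z v (x, s))"]
          linear_add[OF bounded_linear.linear[OF D[OF s]], of "((u, 0), Z u (x, s))" "((v, 0), Z v (x, s))"]
        by (simp add: zero_prod_def)
      moreover have "(?w has_vector_derivative ?D s ((u + v, 0), Z (u + v) (x, s)) -
          (?D s ((u, 0), Z u (x, s)) + ?D s ((v, 0), Z v (x, s)))) (at s)"
        by (rule has_vector_derivative_diff[OF Z'[OF s] has_vector_derivative_add[OF Z'[OF s] Z'[OF s]]])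
      ultimately show "(?w has_vector_derivative ?D s (0, ?w s)) (at s)" by simp
      show "norm (?D s (0, ?w s)) \<le> L * norm (?w s) + 0" using D_snd[OF s] by simp
    qed simp
    also have "\<dots> = 0" using linear_add[OF has_derivative_linear[OF D0]] by (simp add: Z0[OF x])
    finally show "Z (u + v) (x, t) = Z u (x, t) + Z v (x, t)" by simp
  next
    fix c u
    let ?w = "\<lambda>s. Z (c *\<^sub>R u) (x, s) - c *\<^sub>R Z u (x, s)"
    have "norm (?w t) \<le> 2 * (norm (?w 0) + \<delta> * 0)"
    proof (rule norm_le_J[OF t])
      fix s assume "s \<in> ?C"
      then have s: "s \<in> J" using CJ by blast
      have "?D s ((c *\<^sub>R u, 0), Z (c *\<^sub>R u) (x, s)) - c *\<^sub>R ?D s ((u, 0), Z u (x, s)) = ?D s (0, ?w s)"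
        using linear_diff[OF bounded_linear.linear[OF D[OF s]], of "((c *\<^sub>R u, 0), Z (c *\<^sub>R u) (x, s))" "c *\<^sub>R ((u, 0), Z u (x, s))"]
          linear_cmul[OF bounded_linear.linear[OF D[OF s]], of c "((u, 0), Z u (x, s))"]
        by (simp add: zero_prod_def)
      moreover have "(?w has_vector_derivative ?D s ((c *\<^sub>R u, 0), Z (c *\<^sub>R u) (x, s)) -
          c *\<^sub>R ?D s ((u, 0), Z u (x, s))) (at s)"
        by (rule has_vector_derivative_diff[OF Z'[OF s]
              bounded_linear.has_vector_derivative[OF bounded_linear_scaleR_right Z'[OF s]]])
      ultimately show "(?w has_vector_derivative ?D s (0, ?w s)) (at s)" by simp
      show "norm (?D s (0, ?w s)) \<le> L * norm (?w s) + 0" using D_snd[OF s] by simp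
    qed simp
    also have "\<dots> = 0" using linear_cmul[OF has_derivative_linear[OF D0]] by (simp add: Z0[OF x])
    finally show "Z (c *\<^sub>R u) (x, t) = c *\<^sub>R Z u (x, t)" by simp
  qed
  then have bl: "bounded_linear (\<lambda>u. Z u (x, t))" by (rule linear_conv_bounded_linear[THEN iffD1])

  \<comment> \<open>The graph of the solution through \<open>x\<close> is compact, so the Taylor
    estimate and a bound on the derivative of \<open>g\<close> are uniform along it.\<close>
  let ?K = "(\<lambda>s. ((x, s), y (x, s))) ` ?C"
  have K: "compact ?K" "?K \<subseteq> (V \<times> J) \<times> W"
  proof -
    have "continuous_on ?C (\<lambda>s. ((x, s), y (x, s)))"
      by (intro continuous_on_Pair continuous_on_const continuous_on_id
          continuous_on_subset[OF continuous_time[OF x] CJ])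
    then show "compact ?K" by (intro compact_continuous_image compact_segment)
    show "?K \<subseteq> (V \<times> J) \<times> W" using graph_in[OF x] CJ by blast
  qed
  obtain M where M: "M \<ge> 0" "\<And>s v. s \<in> ?C \<Longrightarrow> norm (?D s v) \<le> M * norm v"
  proof -
    have "continuous_on ((V \<times> J) \<times> W) (\<lambda>q. frechet_derivative g (at q) b)" for b
      using g unfolding C_k_on.simps by blast
    then have "continuous_on ((V \<times> J) \<times> W) (\<lambda>q. \<Sum>b\<in>Basis. norm (frechet_derivative g (at q) b))"
      by (intro continuous_on_sum continuous_on_norm)
    then have "continuous_on ?K (\<lambda>q. \<Sum>b\<in>Basis. norm (frechet_derivative g (at q) b))"
      by (rule continuous_on_subset[OF _ K(2)])
    then have "bounded ((\<lambda>q. \<Sum>b\<in>Basis. norm (frechet_derivative g (at q) b)) ` ?K)"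
      by (intro compact_imp_bounded compact_continuous_image K(1))
    then obtain M where M: "\<And>s. s \<in> ?C \<Longrightarrow> norm (\<Sum>b\<in>Basis. norm (?D s b)) \<le> M"
      unfolding bounded_iff by blast
    have "norm (?D s v) \<le> M * norm v" if "s \<in> ?C" for s v
    proof -
      have "linear (?D s)" using D that CJ bounded_linear.linear by blast
      have "norm (?D s v) \<le> (\<Sum>b\<in>Basis. norm ((v \<bullet> b) *\<^sub>R ?D s b))"
        unfolding linear_Basis_expansion[OF \<open>linear (?D s)\<close>, of v] by (rule norm_sum)
      also have "\<dots> \<le> (\<Sum>b\<in>Basis. norm v * norm (?D s b))"
        by (intro sum_mono) (simp add: Basis_le_norm mult_right_mono)
      also have "\<dots> = norm v * (\<Sum>b\<in>Basis. norm (?D s b))" by (simp add: sum_distrib_left)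
      also have "\<dots> \<le> norm v * M" using M[OF that] by (intro mult_left_mono) auto
      finally show ?thesis by (simp add: mult.commute)
    qed
    moreover have "M \<ge> 0" using M[of 0] norm_ge_zero order_trans ends_in_segment(1) by blast
    ultimately show ?thesis using that by blast
  qed
  obtain M0 where M0: "M0 \<ge> 0" "\<And>u. norm (?E u) \<le> M0 * norm u"
    using bounded_linear.nonneg_bounded[OF has_derivative_bounded_linear[OF D0]]
    by (metis mult.commute)
  have D0_alt: "\<exists>d>0. \<forall>u. norm u < d \<longrightarrow> norm (y (x + u, 0) - y (x, 0) - ?E u) \<le> e * norm u"
    if "e > 0" for e
    using D0 that unfolding has_derivative_at_alt by (metis add_diff_cancel_left')

  have "\<exists>d>0. \<forall>u. norm u < d \<longrightarrow> norm (y (x + u, t) - y (x, t) - Z u (x, t)) \<le> e * norm u"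
    if e: "e > 0" for e
  proof -
    \<comment> \<open>Bound of the increment per unit of \<open>norm u\<close>:
      \<open>M0 + 1\<close> accounts for the initial increment and \<open>M + 1\<close> for the
      change of \<open>g\<close> with the parameter, each 1 being the Taylor error allowed by
      \<open>d3\<close> and \<open>d1\<close>.\<close>
    define C where "C = 2 * ((M0 + 1) + \<delta> * (M + 1))"
    have "0 \<le> \<delta> * (M + 1)" using M(1) \<delta> by simp
    then have C: "C > 0" using M0(1) add_pos_nonneg[of "M0 + 1" "\<delta> * (M + 1)"] by (simp add: C_def)
    \<comment> \<open>Chosen so that the remainder contributes \<open>e/4 * norm u\<close>. With
      another \<open>e/4\<close> from the initial value the doubled sum is
      \<open>e * norm u\<close>.\<close>
    define e' where "e' = e / (4 * \<delta> * (1 + C))"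
    have e': "e' > 0" using e \<delta> C by (auto simp: e'_def)
    obtain d1 where d1: "d1 > 0" "\<And>p q. p \<in> ?K \<Longrightarrow> norm q < d1 \<Longrightarrow>
        p + q \<in> (V \<times> J) \<times> W \<and> norm (g (p + q) - g p - frechet_derivative g (at p) q) \<le> 1 * norm q"
      using C_1_uniform_Taylor[OF open_domain(2) K g zero_less_one] by blast
    obtain d2 where d2: "d2 > 0" "\<And>p q. p \<in> ?K \<Longrightarrow> norm q < d2 \<Longrightarrow>
        p + q \<in> (V \<times> J) \<times> W \<and> norm (g (p + q) - g p - frechet_derivative g (at p) q) \<le> e' * norm q"
      using C_1_uniform_Taylor[OF open_domain(2) K g e'] by blast
    obtain d3 where d3: "d3 > 0" "\<And>u. norm u < d3 \<Longrightarrow> norm (y (x + u, 0) - y (x, 0) - ?E u) \<le> 1 * norm u"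
      using D0_alt[OF zero_less_one] by blast
    have "e/4 > 0" using e by simp
    obtain d4 where d4: "d4 > 0" "\<And>u. norm u < d4 \<Longrightarrow> norm (y (x + u, 0) - y (x, 0) - ?E u) \<le> e/4 * norm u"
      using D0_alt[OF \<open>e/4 > 0\<close>] by blast
    define d where "d = Min {d1, d2 / (1 + C), d3, d4}"
    have "d > 0" using d1 d2 d3 d4 C by (simp add: d_def)
    moreover have "norm (y (x + u, t) - y (x, t) - Z u (x, t)) \<le> e * norm u" if u: "norm u < d" for u
    proof -
      have ud: "norm u < d1" "norm u < d2 / (1 + C)" "norm u < d3" "norm u < d4"
        using u by (auto simp: d_def)
      \<comment> \<open>Membership in the domain is part of the uniform Taylor statement, used at
        the initial point of the graph.\<close>
      have xu: "x + u \<in> V"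
        using d1(2)[of "((x, 0), y (x, 0))" "((u, 0), 0)"] ud(1) by (auto simp: norm_Pair)
      let ?w = "\<lambda>s. y (x + u, s) - y (x, s)"
      have w': "(?w has_vector_derivative g ((x + u, s), y (x + u, s)) - g ((x, s), y (x, s))) (at s)"
        if "s \<in> J" for s
        by (rule has_vector_derivative_diff[OF ode[OF xu that] ode[OF x that]])
      have w_le: "norm (?w s) \<le> C * norm u" if "s \<in> ?C" for s
      proof -
        have "s \<in> J" using that CJ by blast
        have sub: "closed_segment 0 s \<subseteq> ?C" using that by (simp add: subset_closed_segment)
        have "norm (?w s) \<le> 2 * (norm (?w 0) + \<delta> * ((M + 1) * norm u))"
        proof (rule norm_le_J[OF \<open>s \<in> J\<close>])
          show "0 \<le> (M + 1) * norm u" using M by simp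
          fix r assume "r \<in> closed_segment 0 s"
          then have r: "r \<in> ?C" "r \<in> J" using sub CJ by blast+
          show "(?w has_vector_derivative g ((x + u, r), y (x + u, r)) - g ((x, r), y (x, r))) (at r)"
            by (rule w'[OF r(2)])
          let ?q = "((u, 0 :: real), 0 :: 'a)"
          have q: "norm ?q = norm u" by (simp add: norm_Pair)
          have rK: "((x, r), y (x, r)) \<in> ?K" using r(1) by blast
          have y_in: "y (x, r) \<in> W" by (rule in_W[OF x r(2)])
          have "norm (g ((x + u, r), y (x, r)) - g ((x, r), y (x, r)) - ?D r ?q) \<le> norm u"
            using d1(2)[OF rK, of ?q] ud(1) q by simp
          moreover have "norm (?D r ?q) \<le> M * norm u" using M(2)[OF r(1), of ?q] q by simp
          ultimately have "norm (g ((x + u, r), y (x, r)) - g ((x, r), y (x, r))) \<le> (M + 1) * norm u"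
            using norm_triangle_sub[of "g ((x + u, r), y (x, r)) - g ((x, r), y (x, r))" "?D r ?q"]
            by (simp add: algebra_simps)
          moreover have "norm (g ((x + u, r), y (x + u, r)) - g ((x + u, r), y (x, r))) \<le> L * norm (?w r)"
            by (rule lip[OF xu r(2) in_W[OF xu r(2)] y_in])
          ultimately show "norm (g ((x + u, r), y (x + u, r)) - g ((x, r), y (x, r))) \<le> L * norm (?w r) + (M + 1) * norm u"
            by (intro norm_diff_triangle_le)
        qed
        also have "norm (?w 0) \<le> (M0 + 1) * norm u"
          using d3(2)[OF ud(3)] M0(2)[of u] norm_triangle_sub[of "?w 0" "?E u"]
          by (simp add: algebra_simps)
        finally show ?thesis by (simp add: C_def algebra_simps)
      qed
      let ?v = "\<lambda>s. ?w s - Z u (x, s)"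
      have "norm (?v t) \<le> 2 * (norm (?v 0) + \<delta> * (e' * ((1 + C) * norm u)))"
      proof (rule norm_le_J[OF t])
        show "0 \<le> e' * ((1 + C) * norm u)" using e' C by simp
        fix s assume s: "s \<in> ?C"
        then have sJ: "s \<in> J" using CJ by blast
        \<comment> \<open>Taylor remainder for the actual increment \<open>((u, 0), ?w s)\<close>,
          whose norm is at most \<open>(1 + C) * norm u\<close>. What is left is linear in
          \<open>?v s\<close>.\<close>
        let ?R = "g ((x + u, s), y (x + u, s)) - g ((x, s), y (x, s)) - ?D s ((u, 0), ?w s)"
        have "?D s ((u, 0), ?w s) - ?D s ((u, 0), Z u (x, s)) = ?D s (0, ?v s)"
          using linear_diff[OF bounded_linear.linear[OF D[OF sJ]], of "((u, 0), ?w s)" "((u, 0), Z u (x, s))"]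
          by (simp add: zero_prod_def)
        then have eq: "g ((x + u, s), y (x + u, s)) - g ((x, s), y (x, s)) - ?D s ((u, 0), Z u (x, s)) =
            ?D s (0, ?v s) + ?R"
          by (simp add: algebra_simps)
        have "(?v has_vector_derivative g ((x + u, s), y (x + u, s)) - g ((x, s), y (x, s)) -
            ?D s ((u, 0), Z u (x, s))) (at s)"
          by (rule has_vector_derivative_diff[OF w'[OF sJ] Z'[OF sJ]])
        then show "(?v has_vector_derivative ?D s (0, ?v s) + ?R) (at s)" unfolding eq .
        have q: "norm ((u, 0 :: real), ?w s) \<le> (1 + C) * norm u"
          using norm_Pair_le[of "(u, 0 :: real)" "?w s"] w_le[OF s] by (simp add: norm_Pair algebra_simps)
        also have "\<dots> < d2" using ud(2) C by (simp add: field_simps)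
        finally have "norm ?R \<le> e' * norm ((u, 0 :: real), ?w s)"
          using d2(2)[of "((x, s), y (x, s))" "((u, 0), ?w s)"] s by simp
        also have "\<dots> \<le> e' * ((1 + C) * norm u)" using q e' by (intro mult_left_mono) auto
        finally show "norm (?D s (0, ?v s) + ?R) \<le> L * norm (?v s) + e' * ((1 + C) * norm u)"
          using D_snd[OF sJ] by (intro norm_triangle_mono)
      qed
      also have "\<delta> * (e' * ((1 + C) * norm u)) = e/4 * norm u"
      proof -
        have "c * (e / (4 * c * b) * (b * n)) = e/4 * n" if "c \<noteq> 0" "b \<noteq> 0" for b c n :: real
          using that by simp
        from this[of \<delta> "1 + C" "norm u"] show ?thesis using \<delta> C by (simp add: e'_def)
      qed
      also have "norm (?v 0) \<le> e/4 * norm u" using d4(2)[OF ud(4)] by (simp add: Z0[OF x])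
      finally show ?thesis by simp
    qed
    ultimately show ?thesis by blast
  qed
  then show ?thesis
    unfolding has_derivative_at_alt using bl by (metis add_diff_cancel_left' add.commute diff_add_cancel)
qed

text \<open>Total differentiability from partial derivatives needs joint continuity of only one of
  them. The time partial is \<open>g\<close> along the solution, whose continuity is known; the
  space partial is needed at the point alone.\<close>

lemma has_derivative_solution:
  assumes g: "C_k_on (Suc 0) ((V \<times> J) \<times> W) g" and y0: "C_k_on (Suc 0) V (\<lambda>x. y (x, 0))"
    and Z0: "\<And>u x. x \<in> V \<Longrightarrow> Z u (x, 0) = frechet_derivative (\<lambda>x. y (x, 0)) (at x) u"
    and Z: "\<And>u. parametric_ode \<delta> L V UNIV (variational u) (Z u)"
    and x: "x \<in> V" and t: "t \<in> J"
  shows "(y has_derivative (\<lambda>(u, s). Z u (x, t) + s *\<^sub>R g ((x, t), y (x, t)))) (at (x, t))"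
proof -
  let ?F = "\<lambda>x t. blinfun_scaleR_left (g ((x, t), y (x, t)))"
  have y: "continuous_on (V \<times> J) y"
    by (rule continuous_on_solution[OF C_k_on_imp_continuous[OF g] C_k_on_imp_continuous[OF y0]])
  have "continuous_on (V \<times> J) (\<lambda>p. (p, y p))"
    by (intro continuous_on_Pair continuous_on_id y)
  then have "continuous_on (V \<times> J) (\<lambda>p. g (p, y p))"
    by (rule continuous_on_compose2[OF C_k_on_imp_continuous[OF g]]) (use in_W in auto)
  then have "continuous_on (V \<times> J) (\<lambda>p. blinfun_scaleR_left (g (p, y p)))"
    by (rule bounded_linear.continuous_on[OF bounded_linear_blinfun_scaleR_left])
  then have cont: "continuous (at (x, t) within V \<times> J) (\<lambda>(x, t). ?F x t)"
    using x t by (simp add: continuous_on_eq_continuous_within case_prod_unfold)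
  have "((\<lambda>(x, t). y (x, t)) has_derivative (\<lambda>(u, s). Z u (x, t) + blinfun_apply (?F x t) s))
      (at (x, t) within V \<times> J)"
  proof (rule has_derivative_partialsI[OF _ _ cont t convex_real_interval(8)])
    show "((\<lambda>x. y (x, t)) has_derivative (\<lambda>u. Z u (x, t))) (at x within V)"
      by (rule has_derivative_at_withinI[OF has_derivative_space[OF g y0 Z0 Z x t]])
    fix x t assume "x \<in> V" "t \<in> J"
    then show "((\<lambda>t. y (x, t)) has_derivative blinfun_apply (?F x t)) (at t within J)"
      using ode[unfolded has_vector_derivative_def] by (simp add: has_derivative_at_withinI)
  qed
  then show ?thesis
    using x t at_within_open[OF _ open_domain(1), of "(x, t)"] by (simp add: case_prod_unfold)
qed

end

text \<open>The induction hypothesis must cover other equations than the given one: it is applied to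
  \<open>y\<close>, so that the variational equation has right-hand side of order \<open>m\<close>,
  and then to its solutions \<open>Z u\<close>. Hence \<open>g\<close>, \<open>y\<close> and
  \<open>W\<close> vary, while \<open>\<delta>\<close>, \<open>L\<close> and \<open>V\<close> stay
  fixed.\<close>

theorem C_k_on_parametric_ode:
  fixes g :: "('p::euclidean_space \<times> real) \<times> 'a::euclidean_space \<Rightarrow> 'a"
  assumes "parametric_ode \<delta> L V W g y" "C_k_on m ((V \<times> {-\<delta><..<\<delta>}) \<times> W) g" "C_k_on m V (\<lambda>x. y (x, 0))"
  shows "C_k_on m (V \<times> {-\<delta><..<\<delta>}) y"
  using assms
proof (induction m arbitrary: g y W)
  case 0
  then show ?case by (simp add: parametric_ode.continuous_on_solution)
next
  case (Suc m)
  interpret parametric_ode \<delta> L V W g y by (rule Suc.prems)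
  have Cm: "C_k_on m (V \<times> J) y"
    by (rule Suc.IH[OF Suc.prems(1) C_k_on_SucD[OF Suc.prems(2)] C_k_on_SucD[OF Suc.prems(3)]])
  have g1: "C_k_on (Suc 0) ((V \<times> J) \<times> W) g" and y1: "C_k_on (Suc 0) V (\<lambda>x. y (x, 0))"
    by (rule C_k_on_antimono[OF Suc.prems(2)] C_k_on_antimono[OF Suc.prems(3)], simp)+
  obtain Z where Z0: "\<And>u x. x \<in> V \<Longrightarrow> Z u (x, 0) = frechet_derivative (\<lambda>x. y (x, 0)) (at x) u"
    and Z: "\<And>u. parametric_ode \<delta> L V UNIV (variational u) (Z u)"
    using ex_variational_solution[OF g1 y1] by blast
  have CZ: "C_k_on m (V \<times> J) (Z u)" for u
  proof (rule Suc.IH[OF Z C_k_on_variational[OF Suc.prems(2) Cm]])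
    have "C_k_on m V (\<lambda>x. frechet_derivative (\<lambda>x. y (x, 0)) (at x) u)"
      using Suc.prems(3) by simp
    from C_k_on_cong[OF open_V _ this, of "\<lambda>x. Z u (x, 0)"]
    show "C_k_on m V (\<lambda>x. Z u (x, 0))" using Z0 by simp
  qed
  have Cg: "C_k_on m (V \<times> J) (\<lambda>p. g (p, y p))"
  proof (rule C_k_on_compose[OF open_domain(1) open_domain(2) _ C_k_on_SucD[OF Suc.prems(2)]])
    show "C_k_on m (V \<times> J) (\<lambda>p. (p, y p))"
      by (rule C_k_on_Pair[OF open_domain(1) C_k_on_linear[OF bounded_linear_ident open_domain(1)] Cm])
  qed (use in_W in auto)
  show ?case
  proof (rule C_k_on_SucI[where f' = "\<lambda>p v. Z (fst v) p + snd v *\<^sub>R g (p, y p)", OF _ open_domain(1)])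
    fix p assume "p \<in> V \<times> J"
    then show "(y has_derivative (\<lambda>v. Z (fst v) p + snd v *\<^sub>R g (p, y p))) (at p)"
      using has_derivative_solution[OF g1 y1 Z0 Z, of "fst p" "snd p"] by (auto simp: case_prod_unfold)
  next
    fix v show "C_k_on m (V \<times> J) (\<lambda>p. Z (fst v) p + snd v *\<^sub>R g (p, y p))"
      by (rule C_k_on_add[OF open_domain(1) CZ
            C_k_on_linear_compose[OF bounded_linear_scaleR_right open_domain(1) Cg]])
  qed
qed

section \<open>Local flows of smooth fields\<close>

lemma ball_Lipschitz:
  fixes f :: "'a::euclidean_space \<Rightarrow> 'b::real_normed_vector"
  assumes "open U" "p \<in> U" "C_k_on (Suc 0) U f"
  obtains r B where "r > 0" "B \<ge> 0" "cball p r \<subseteq> U"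
    "\<And>a b. a \<in> cball p r \<Longrightarrow> b \<in> cball p r \<Longrightarrow> norm (f b - f a) \<le> B * norm (b - a)"
proof -
  let ?D = "frechet_derivative f (at p)"
  obtain d where d: "d > 0" "ball p d \<subseteq> U"
    "\<And>a b. a \<in> ball p d \<Longrightarrow> b \<in> ball p d \<Longrightarrow> norm (f b - f a - ?D (b - a)) \<le> 1 * norm (b - a)"
    using C_1_strictly_differentiable[OF assms zero_less_one] by blast
  have "bounded_linear ?D"
    using C_k_on_has_derivative[OF assms(3,2)] by (rule has_derivative_bounded_linear)
  then obtain K where K: "K \<ge> 0" "\<And>v. norm (?D v) \<le> norm v * K"
    using bounded_linear.nonneg_bounded by blast
  have "norm (f b - f a) \<le> (1 + K) * norm (b - a)" if "a \<in> ball p d" "b \<in> ball p d" for a b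
    using d(3)[OF that] K(2)[of "b - a"] norm_triangle_sub[of "f b - f a" "?D (b - a)"]
    by (simp add: algebra_simps)
  then show ?thesis
    using d K that[of "d/2" "1 + K"] by (auto simp: subset_iff)
qed

text \<open>\<open>V\<close> holds the initial points and \<open>U\<close> the region that their
  orbits stay in. Negative times are included so that the time at which an orbit meets a surface can
  be a smooth function on both sides of it.\<close>

definition flow_box ::
  "('a::real_normed_vector \<Rightarrow> 'a) \<Rightarrow> 'a set \<Rightarrow> real \<Rightarrow> 'a set \<Rightarrow> ('a \<times> real \<Rightarrow> 'a) \<Rightarrow> bool" where
  "flow_box f U \<delta> V \<phi> \<longleftrightarrow> \<delta> > 0 \<and> open V \<and> smooth_on (V \<times> {-\<delta><..<\<delta>}) \<phi> \<and>
     (\<forall>x\<in>V. \<phi> (x, 0) = x) \<and>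
     (\<forall>x\<in>V. \<forall>t\<in>{-\<delta><..<\<delta>}. \<phi> (x, t) \<in> U \<and>
        ((\<lambda>s. \<phi> (x, s)) has_vector_derivative f (\<phi> (x, t))) (at t))"

text \<open>Composing \<open>f\<close> with the projection to a closed ball makes it globally
  Lipschitz and bounded, so existence holds in the whole space. For short times the orbits stay in
  the ball, where the projection is the identity.\<close>

theorem ex_flow_box:
  fixes f :: "'a::euclidean_space \<Rightarrow> 'a"
  assumes U: "open U" "p \<in> U" and f: "smooth_on U f"
  shows "\<exists>\<delta> V \<phi>. p \<in> V \<and> flow_box f U \<delta> V \<phi>"
proof -
  have Ck: "C_k_on m U f" for m using f by (simp add: smooth_on_def)
  obtain r B where r: "r > 0" "cball p r \<subseteq> U" and B: "B \<ge> 0"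
    "\<And>a b. a \<in> cball p r \<Longrightarrow> b \<in> cball p r \<Longrightarrow> norm (f b - f a) \<le> B * norm (b - a)"
    using ball_Lipschitz[OF U Ck] by metis
  define c where "c = closest_point (cball p r)"
  have ne: "cball p r \<noteq> {}" using r by simp
  have c: "c z \<in> cball p r" "norm (c z - c z') \<le> norm (z - z')" for z z'
    using closest_point_in_set[OF closed_cball ne, of z]
      closest_point_lipschitz[OF convex_cball closed_cball ne, of z z']
    by (simp_all add: c_def dist_norm)
  define M where "M = norm (f p) + B * r"
  have M: "norm (f (c z)) \<le> M" for z
  proof -
    have "norm (f (c z) - f p) \<le> B * norm (c z - p)" using c(1) r by (intro B) auto
    also have "\<dots> \<le> B * r" using c(1)[of z] B(1) by (intro mult_left_mono) (auto simp: dist_norm norm_minus_commute)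
    finally show ?thesis using norm_triangle_sub[of "f (c z)" "f p"] by (simp add: M_def)
  qed
  have M0: "M \<ge> 0" using M norm_ge_zero order_trans by blast
  \<comment> \<open>The first entry gives \<open>B * \<delta> \<le> 1/2\<close>. The second gives
    \<open>M * \<delta> \<le> r/2\<close>, which keeps orbits from the ball of radius
    \<open>r/2\<close> in that of radius \<open>r\<close>. The added 1 guards against division by
    zero.\<close>
  define \<delta> where "\<delta> = min (1 / (2 * (B + 1))) (r / (2 * (M + 1)))"
  have \<delta>: "\<delta> > 0" using r M0 B(1) by (simp add: \<delta>_def)
  have B\<delta>: "B * \<delta> \<le> 1/2"
  proof -
    have "B * \<delta> \<le> B * (1 / (2 * (B + 1)))" using B(1) by (intro mult_left_mono) (auto simp: \<delta>_def)
    also have "\<dots> \<le> 1/2" using B(1) by (simp add: field_simps)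
    finally show ?thesis .
  qed
  have M\<delta>: "M * \<delta> \<le> r/2"
  proof -
    have "M * \<delta> \<le> M * (r / (2 * (M + 1)))" using M0 by (intro mult_left_mono) (auto simp: \<delta>_def)
    also have "\<dots> \<le> r/2" using M0 r by (simp add: field_simps)
    finally show ?thesis .
  qed
  let ?J = "{-\<delta><..<\<delta>}"
  have "\<exists>z. z 0 = x \<and> (\<forall>t\<in>?J. (z has_vector_derivative f (c (z t))) (at t))" for x
  proof (rule Picard_existence[OF \<delta> B(1) B\<delta>])
    have lip: "norm (f (c z) - f (c z')) \<le> B * norm (z - z')" for z z'
      using B(2)[OF c(1) c(1), of z' z] mult_left_mono[OF c(2)[of z z'] B(1)] by (simp add: norm_minus_commute)
    then show "norm (f (c z) - f (c z')) \<le> B * norm (z - z')" for z z' .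
    have "continuous_on UNIV (\<lambda>z. f (c z))"
    proof (rule continuous_on_compose2[OF C_k_on_imp_continuous[OF Ck]])
      show "continuous_on UNIV c"
        unfolding c_def by (rule continuous_on_closest_point[OF convex_cball closed_cball ne])
    qed (use c(1) r in auto)
    then show "continuous_on (?J \<times> UNIV) (\<lambda>(t, z). f (c z))"
      unfolding case_prod_unfold by (rule continuous_on_compose2[where f = snd]) (auto intro: continuous_on_snd continuous_on_id)
  qed
  then obtain z where z0: "\<And>x. z x 0 = x"
    and z': "\<And>x t. t \<in> ?J \<Longrightarrow> (z x has_vector_derivative f (c (z x t))) (at t)" by metis
  let ?V = "ball p (r/2)" and ?W = "ball p r"
  have in_W: "z x t \<in> ?W" if x: "x \<in> ?V" and t: "t \<in> ?J" for x t
  proof -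
    have "norm (z x t - z x 0) \<le> M * norm (t - 0)"
    proof (rule differentiable_bound[of ?J])
      fix s assume "s \<in> ?J"
      from z'[OF this] show "(z x has_derivative (\<lambda>h. h *\<^sub>R f (c (z x s)))) (at s within ?J)"
        unfolding has_vector_derivative_def by (rule has_derivative_at_withinI)
      show "onorm (\<lambda>h. h *\<^sub>R f (c (z x s))) \<le> M" by (rule onorm_scaleR_le[OF M])
    qed (use t \<delta> in auto)
    also have "\<dots> \<le> M * \<delta>" using t M0 by (intro mult_left_mono) auto
    finally have "norm (z x t - x) \<le> r/2" using M\<delta> z0 by simp
    moreover have "norm (x - p) < r/2" using x by (simp add: dist_norm norm_minus_commute)
    ultimately have "norm (z x t - p) < r" using norm_triangle_ineq[of "z x t - x" "x - p"] by simp
    then show ?thesis by (simp add: dist_norm norm_minus_commute)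
  qed
  have z_ode: "(z x has_vector_derivative f (z x t)) (at t)" if "x \<in> ?V" "t \<in> ?J" for x t
  proof -
    have "z x t \<in> cball p r" using in_W[OF that] by auto
    then have "c (z x t) = z x t" unfolding c_def by (rule closest_point_self)
    then show ?thesis using z'[OF that(2), of x] by simp
  qed
  define \<phi> where "\<phi> = (\<lambda>(x, t). z x t)"
  have ode: "parametric_ode \<delta> B ?V ?W (\<lambda>q. f (snd q)) \<phi>"
  proof (rule parametric_ode.intro[OF \<delta> B(1) B\<delta> open_ball open_ball])
    show "norm (f (snd ((x, t), a)) - f (snd ((x, t), b))) \<le> B * norm (a - b)" if "a \<in> ?W" "b \<in> ?W" for x :: 'a and t :: real and a b
      using B(2)[of b a] that by (simp add: less_imp_le)
  qed (use in_W z_ode in \<open>simp_all add: \<phi>_def\<close>)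
  have "C_k_on m (?V \<times> ?J) \<phi>" for m
  proof (rule C_k_on_parametric_ode[OF ode])
    let ?S = "(?V \<times> ?J) \<times> ?W"
    have S: "open ?S" by (intro open_Times open_ball open_greaterThanLessThan)
    show "C_k_on m ?S (\<lambda>q. f (snd q))"
      by (rule C_k_on_compose[OF S U(1) _ Ck C_k_on_linear[OF bounded_linear_snd S]])
        (use r ball_subset_cball[of p r] in auto)
    have "C_k_on m ?V (\<lambda>x. x)" by (rule C_k_on_linear[OF bounded_linear_ident open_ball])
    then show "C_k_on m ?V (\<lambda>x. \<phi> (x, 0))" by (simp add: \<phi>_def z0)
  qed
  then have "smooth_on (?V \<times> ?J) \<phi>" by (simp add: smooth_on_def)
  moreover have "\<phi> (x, t) \<in> U" if "x \<in> ?V" "t \<in> ?J" for x t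
    using in_W[OF that] r(2) ball_subset_cball[of p r] by (auto simp: \<phi>_def)
  ultimately have "flow_box f U \<delta> ?V \<phi>"
    unfolding flow_box_def using \<delta> z_ode z0 by (simp add: \<phi>_def)
  then show ?thesis using r(1) by (intro exI[of _ \<delta>] exI[of _ ?V] exI[of _ \<phi>]) simp
qed

section \<open>Trajectories and hitting times\<close>

lemma trajectory_subset:
  "trajectory Y \<gamma> I \<Longrightarrow> I' \<subseteq> I \<Longrightarrow> (\<And>t. t \<in> I' \<Longrightarrow> \<gamma>' t = \<gamma> t) \<Longrightarrow> trajectory Y \<gamma>' I'"
  unfolding trajectory_def
proof safe
  fix t assume *: "\<forall>t\<in>I. (\<gamma> has_vector_derivative Y (\<gamma> t)) (at t within I)" "I' \<subseteq> I" "t \<in> I'"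
    and eq: "\<And>t. t \<in> I' \<Longrightarrow> \<gamma>' t = \<gamma> t"
  then have "(\<gamma> has_vector_derivative Y (\<gamma> t)) (at t within I')"
    using has_vector_derivative_within_subset by blast
  from has_vector_derivative_transform[OF \<open>t \<in> I'\<close> eq this]
  show "(\<gamma>' has_vector_derivative Y (\<gamma>' t)) (at t within I')"
    by (simp add: eq[OF \<open>t \<in> I'\<close>])
qed

lemma trajectory_continuous: "trajectory Y \<gamma> I \<Longrightarrow> continuous_on I \<gamma>"
  unfolding trajectory_def
  by (meson continuous_on_eq_continuous_within has_vector_derivative_continuous)

lemma continuous_on_eventually_in:
  fixes \<gamma> :: "real \<Rightarrow> 'a::metric_space"
  assumes "continuous_on I \<gamma>" "t \<in> I" "open S" "\<gamma> t \<in> S"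
  obtains d where "d > 0" "\<And>s. s \<in> I \<Longrightarrow> \<bar>s - t\<bar> < d \<Longrightarrow> \<gamma> s \<in> S"
proof -
  obtain e where e: "e > 0" "ball (\<gamma> t) e \<subseteq> S" using assms(3,4) by (rule openE)
  obtain d where d: "d > 0" "\<And>s. s \<in> I \<Longrightarrow> dist s t < d \<Longrightarrow> dist (\<gamma> s) (\<gamma> t) < e"
    using assms(1)[unfolded continuous_on_iff, rule_format, OF assms(2) e(1)] by blast
  show ?thesis
  proof (rule that[OF d(1)])
    fix s assume "s \<in> I" "\<bar>s - t\<bar> < d"
    then have "\<gamma> s \<in> ball (\<gamma> t) e" using d(2)[of s] by (simp add: dist_real_def dist_commute)
    then show "\<gamma> s \<in> S" using e by blast
  qed
qed

lemma flow_box_shift: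
  assumes box: "flow_box f U \<delta> V \<phi>" and x: "x \<in> V" and t: "t - a \<in> {-\<delta><..<\<delta>}"
  shows "((\<lambda>s. \<phi> (x, s - a)) has_vector_derivative f (\<phi> (x, t - a))) (at t)"
proof -
  have "((\<lambda>s. s - a) has_vector_derivative 1) (at t)" by (auto intro!: derivative_eq_intros)
  moreover have "((\<lambda>s. \<phi> (x, s)) has_vector_derivative f (\<phi> (x, t - a))) (at (t - a))"
    using box x t unfolding flow_box_def by blast
  ultimately have "((\<lambda>s. \<phi> (x, s)) \<circ> (\<lambda>s. s - a) has_vector_derivative 1 *\<^sub>R f (\<phi> (x, t - a))) (at t)"
    by (rule vector_diff_chain_at)
  then show ?thesis by (simp add: o_def)
qed

lemma flow_box_trajectory:
  assumes "flow_box f U \<delta> V \<phi>" "x \<in> V" "\<And>t. t \<in> I \<Longrightarrow> t - a \<in> {-\<delta><..<\<delta>}"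
  shows "trajectory f (\<lambda>s. \<phi> (x, s - a)) I"
  unfolding trajectory_def
  using has_vector_derivative_at_within[OF flow_box_shift[OF assms(1,2) assms(3)]] by blast

text \<open>The derivative of \<open>h\<close> along the orbit is positive, so within a box an orbit
  meets a level set of \<open>h\<close> at most once.\<close>

lemma flow_box_strict_mono:
  fixes h :: "'a::euclidean_space \<Rightarrow> real"
  assumes box: "flow_box f U \<delta> V \<phi>" and x: "x \<in> V" and h: "smooth_on UNIV h"
    and pos: "\<And>z. z \<in> U \<Longrightarrow> frechet_derivative h (at z) (f z) > 0"
    and rt: "r \<in> {-\<delta><..<\<delta>}" "t \<in> {-\<delta><..<\<delta>}" "r < t"
  shows "h (\<phi> (x, r)) < h (\<phi> (x, t))"
proof (rule DERIV_pos_imp_increasing[OF rt(3)])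
  fix s assume "r \<le> s" "s \<le> t"
  then have s: "s \<in> {-\<delta><..<\<delta>}" using rt by auto
  have *: "\<phi> (x, s) \<in> U" "((\<lambda>s. \<phi> (x, s)) has_vector_derivative f (\<phi> (x, s))) (at s)"
    using box x s unfolding flow_box_def by blast+
  have "(h \<circ> (\<lambda>s. \<phi> (x, s)) has_vector_derivative frechet_derivative h (at (\<phi> (x, s))) (f (\<phi> (x, s)))) (at s)"
    by (rule vector_derivative_diff_chain_within[OF *(2) has_derivative_at_withinI[OF smooth_on_has_derivative[OF h UNIV_I]]])
  then have "((\<lambda>s. h (\<phi> (x, s))) has_real_derivative frechet_derivative h (at (\<phi> (x, s))) (f (\<phi> (x, s)))) (at s)"
    by (simp add: o_def has_real_derivative_iff_has_vector_derivative)
  then show "\<exists>y. ((\<lambda>s. h (\<phi> (x, s))) has_real_derivative y) (at s) \<and> y > 0"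
    using pos[OF *(1)] by blast
qed

section \<open>Hitting times\<close>

lemma const_of_zero_derivative:
  fixes w :: "real \<Rightarrow> 'a::real_normed_vector"
  assumes "\<And>s. s \<in> {-\<delta><..<\<delta>} \<Longrightarrow> (w has_vector_derivative 0) (at s)" "t \<in> {-\<delta><..<\<delta>}"
  shows "w t = w 0"
proof -
  have "\<exists>c. \<forall>s\<in>{-\<delta><..<\<delta>}. w s = c"
  proof (rule has_derivative_zero_constant)
    fix s assume "s \<in> {-\<delta><..<\<delta>}"
    from assms(1)[OF this] show "(w has_derivative (\<lambda>h. 0)) (at s within {-\<delta><..<\<delta>})"
      by (simp add: has_vector_derivative_def has_derivative_at_withinI)
  qed simp
  moreover have "0 \<in> {-\<delta><..<\<delta>}" using assms(2) by auto
  ultimately show ?thesis using assms(2) by metis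
qed

text \<open>The hitting time solves \<open>d\<tau>/ds = 1 / (dh(\<phi>(x,\<tau>)) f(\<phi>(x,\<tau>)))\<close>, along which \<open>h(\<phi>(x,\<tau>))\<close>
  grows at unit rate; this replaces the implicit function theorem by smoothness of flows.\<close>

lemma smooth_hitting_time:
  fixes f :: "'a::euclidean_space \<Rightarrow> 'a" and h :: "'a \<Rightarrow> real"
  assumes U: "open U" and f: "smooth_on U f" and h: "smooth_on UNIV h"
    and box: "flow_box f U \<delta> V \<phi>" and pV: "p \<in> V"
    and hp: "h p = 0" "frechet_derivative h (at p) (f p) \<noteq> 0"
  shows "\<exists>V' T. open V' \<and> p \<in> V' \<and> V' \<subseteq> V \<and> smooth_on V' T \<and> T p = 0 \<and>
    (\<forall>x\<in>V'. T x \<in> {-\<delta><..<\<delta>} \<and> h (\<phi> (x, T x)) = 0)"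
proof -
  have \<delta>: "\<delta> > 0" and V: "open V" "p \<in> V" and \<phi>: "smooth_on (V \<times> {-\<delta><..<\<delta>}) \<phi>"
    and \<phi>0: "\<And>x. x \<in> V \<Longrightarrow> \<phi> (x, 0) = x"
    and \<phi>_in: "\<And>x t. x \<in> V \<Longrightarrow> t \<in> {-\<delta><..<\<delta>} \<Longrightarrow> \<phi> (x, t) \<in> U"
    and \<phi>': "\<And>x t. x \<in> V \<Longrightarrow> t \<in> {-\<delta><..<\<delta>} \<Longrightarrow> ((\<lambda>s. \<phi> (x, s)) has_vector_derivative f (\<phi> (x, t))) (at t)"
    using box pV unfolding flow_box_def by blast+
  let ?J = "{-\<delta><..<\<delta>}"
  define G where "G q = frechet_derivative h (at (\<phi> q)) (f (\<phi> q))" for q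
  have VJ: "open (V \<times> ?J)" by (intro open_Times V(1) open_greaterThanLessThan)
  have f\<phi>: "smooth_on (V \<times> ?J) (\<lambda>q. f (\<phi> q))"
    by (rule smooth_on_compose[OF VJ U _ f \<phi>]) (use \<phi>_in in auto)
  have G: "smooth_on (V \<times> ?J) G"
    unfolding G_def by (rule smooth_on_frechet_derivative[OF VJ open_UNIV h \<phi> _ f\<phi>]) simp
  define \<Omega> where "\<Omega> = (V \<times> ?J) \<inter> G -` (- {0})"
  have \<Omega>: "open \<Omega>" unfolding \<Omega>_def
    by (intro continuous_open_preimage[OF smooth_on_imp_continuous[OF G] VJ]) auto
  have p\<Omega>: "(p, 0) \<in> \<Omega>" using V(2) \<delta> hp(2) \<phi>0 by (simp add: \<Omega>_def G_def)
  have F: "smooth_on \<Omega> (\<lambda>q. (0 :: 'a, inverse (G q)))"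
    using smooth_on_subset[OF G, of \<Omega>]
    by (intro smooth_on_Pair[OF \<Omega>] smooth_on_const[OF \<Omega>] smooth_on_inverse[OF \<Omega>]) (auto simp: \<Omega>_def)
  \<comment> \<open>The field on space and time has zero space component: the initial point of the
    orbit is carried along as a constant, so its role as a parameter is covered by an ordinary flow
    box.\<close>
  obtain \<delta>' V1 \<psi> where "(p, 0) \<in> V1" "flow_box (\<lambda>q. (0, inverse (G q))) \<Omega> \<delta>' V1 \<psi>"
    using ex_flow_box[OF \<Omega> p\<Omega> F] by blast
  then have \<delta>': "\<delta>' > 0" and V1: "open V1" "(p, 0) \<in> V1"
    and \<psi>: "smooth_on (V1 \<times> {-\<delta>'<..<\<delta>'}) \<psi>"
    and \<psi>0: "\<And>x. x \<in> V1 \<Longrightarrow> \<psi> (x, 0) = x"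
    and \<psi>_in: "\<And>x t. x \<in> V1 \<Longrightarrow> t \<in> {-\<delta>'<..<\<delta>'} \<Longrightarrow> \<psi> (x, t) \<in> \<Omega>"
    and \<psi>': "\<And>x t. x \<in> V1 \<Longrightarrow> t \<in> {-\<delta>'<..<\<delta>'} \<Longrightarrow>
      ((\<lambda>s. \<psi> (x, s)) has_vector_derivative (0, inverse (G (\<psi> (x, t))))) (at t)"
    unfolding flow_box_def by blast+
  let ?J' = "{-\<delta>'<..<\<delta>'}"
  have fst_\<psi>: "fst (\<psi> ((x, 0), s)) = x" if "(x, 0) \<in> V1" "s \<in> ?J'" for x s
  proof -
    have "fst (\<psi> ((x, 0), s)) = fst (\<psi> ((x, 0), 0))"
    proof (rule const_of_zero_derivative[OF _ that(2)])
      fix s assume "s \<in> ?J'"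
      from bounded_linear.has_vector_derivative[OF bounded_linear_fst \<psi>'[OF that(1) this]]
      show "((\<lambda>s. fst (\<psi> ((x, 0), s))) has_vector_derivative 0) (at s)" by simp
    qed
    then show ?thesis using \<psi>0[OF that(1)] by simp
  qed
  have unit_rate: "h (\<phi> (\<psi> ((x, 0), s))) = h x + s" if x: "x \<in> V" "(x, 0) \<in> V1" and s: "s \<in> ?J'" for x s
  proof -
    let ?\<tau> = "\<lambda>s. snd (\<psi> ((x, 0), s))"
    have \<psi>_eq: "\<psi> ((x, 0), s) = (x, ?\<tau> s)" if "s \<in> ?J'" for s
      using fst_\<psi>[OF x(2) that] by (metis prod.collapse)
    have "h (\<phi> (x, ?\<tau> s)) - s = h (\<phi> (x, ?\<tau> 0)) - 0"
    proof (rule const_of_zero_derivative[OF _ s, where w = "\<lambda>s. h (\<phi> (x, ?\<tau> s)) - s"])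
      fix s assume s: "s \<in> ?J'"
      have in_\<Omega>: "(x, ?\<tau> s) \<in> \<Omega>" using \<psi>_in[OF x(2) s] \<psi>_eq[OF s] by simp
      then have \<tau>J: "?\<tau> s \<in> ?J" and G0: "G (x, ?\<tau> s) \<noteq> 0" by (auto simp: \<Omega>_def)
      from bounded_linear.has_vector_derivative[OF bounded_linear_snd \<psi>'[OF x(2) s]]
      have "(?\<tau> has_vector_derivative inverse (G (x, ?\<tau> s))) (at s)" using \<psi>_eq[OF s] by simp
      from vector_diff_chain_at[OF this \<phi>'[OF x(1) \<tau>J]]
      have d\<phi>: "((\<lambda>s. \<phi> (x, ?\<tau> s)) has_vector_derivative inverse (G (x, ?\<tau> s)) *\<^sub>R f (\<phi> (x, ?\<tau> s))) (at s)"
        by (simp add: o_def)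
      have Dh: "(h has_derivative frechet_derivative h (at (\<phi> (x, ?\<tau> s)))) (at (\<phi> (x, ?\<tau> s)))"
        by (rule smooth_on_has_derivative[OF h UNIV_I])
      have "((h \<circ> (\<lambda>s. \<phi> (x, ?\<tau> s))) has_vector_derivative
          frechet_derivative h (at (\<phi> (x, ?\<tau> s))) (inverse (G (x, ?\<tau> s)) *\<^sub>R f (\<phi> (x, ?\<tau> s)))) (at s)"
        by (rule vector_derivative_diff_chain_within[OF d\<phi> has_derivative_at_withinI[OF Dh]])
      moreover have "frechet_derivative h (at (\<phi> (x, ?\<tau> s))) (inverse (G (x, ?\<tau> s)) *\<^sub>R f (\<phi> (x, ?\<tau> s))) = 1"
        using linear_cmul[OF has_derivative_linear[OF Dh]] G0 by (simp add: G_def)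
      ultimately have "((\<lambda>s. h (\<phi> (x, ?\<tau> s))) has_vector_derivative 1) (at s)" by (simp add: o_def)
      from has_vector_derivative_diff[OF this has_vector_derivative_id]
      show "((\<lambda>s. h (\<phi> (x, ?\<tau> s)) - s) has_vector_derivative 0) (at s)" by simp
    qed
    then show ?thesis using \<psi>0[OF x(2)] \<phi>0[OF x(1)] \<psi>_eq[OF s] by simp
  qed
  define V' where "V' = V \<inter> (\<lambda>x. (x, 0)) -` V1 \<inter> h -` {-\<delta>'<..<\<delta>'}"
  have "open ((\<lambda>x::'a. (x, 0::real)) -` V1)"
    by (intro open_vimage V1(1) continuous_on_Pair continuous_on_id continuous_on_const)
  moreover have "open (h -` {-\<delta>'<..<\<delta>'})"
    by (intro open_vimage smooth_on_imp_continuous[OF h] open_greaterThanLessThan)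
  ultimately have V': "open V'" unfolding V'_def using V(1) by (intro open_Int)
  \<comment> \<open>Starting from the value \<open>h x\<close> and growing at unit rate, level 0 is
    reached at parameter \<open>- h x\<close>.\<close>
  define T where "T x = snd (\<psi> ((x, 0), - h x))" for x
  have hJ: "- h x \<in> ?J'" if "x \<in> V'" for x using that by (auto simp: V'_def)
  have T\<psi>: "\<psi> ((x, 0), - h x) = (x, T x)" if "x \<in> V'" for x
    using fst_\<psi>[OF _ hJ[OF that]] that unfolding T_def V'_def by (metis IntD1 IntD2 prod.collapse vimageD)
  have "smooth_on V' (\<lambda>x. \<psi> ((x, 0), - h x))"
  proof (rule smooth_on_compose[OF V' _ _ \<psi>])
    show "open (V1 \<times> ?J')" by (intro open_Times V1(1) open_greaterThanLessThan)
    show "smooth_on V' (\<lambda>x. ((x, 0), - h x))"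
      by (intro smooth_on_Pair[OF V'] smooth_on_const[OF V'] smooth_on_uminus[OF V']
          smooth_on_subset[OF h subset_UNIV] smooth_on_linear[OF bounded_linear_ident V'])
  qed (auto simp: V'_def)
  then have "smooth_on V' T"
    unfolding T_def by (rule smooth_on_linear_compose[OF bounded_linear_snd V'])
  moreover have "p \<in> V'" using V(2) V1(2) \<delta>' hp(1) by (simp add: V'_def)
  moreover have "T p = 0" using \<psi>0[OF V1(2)] hp(1) by (simp add: T_def)
  moreover have "T x \<in> ?J" if "x \<in> V'" for x
    using \<psi>_in[of "(x, 0)" "- h x"] hJ[OF that] T\<psi>[OF that] that by (auto simp: \<Omega>_def V'_def)
  moreover have "h (\<phi> (x, T x)) = 0" if "x \<in> V'" for x
    using unit_rate[of x "- h x"] hJ[OF that] T\<psi>[OF that] that by (auto simp: V'_def)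
  moreover have "V' \<subseteq> V" by (auto simp: V'_def)
  ultimately show ?thesis using V' by blast
qed

section \<open>Uniqueness of trajectories\<close>

lemma trajectory_locally_unique:
  fixes f :: "'a::euclidean_space \<Rightarrow> 'a"
  assumes U: "open U" "\<gamma>\<^sub>1 t \<in> U" and f: "smooth_on U f"
    and tr: "trajectory f \<gamma>\<^sub>1 {t..b}" "trajectory f \<gamma>\<^sub>2 {t..b}" and "t < b" and eq: "\<gamma>\<^sub>1 t = \<gamma>\<^sub>2 t"
  obtains e where "e > 0" "t + e \<le> b" "\<And>s. s \<in> {t..t+e} \<Longrightarrow> \<gamma>\<^sub>1 s = \<gamma>\<^sub>2 s"
proof -
  obtain r B where r: "r > 0" "cball (\<gamma>\<^sub>1 t) r \<subseteq> U" and B: "B \<ge> 0"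
    "\<And>a b. a \<in> cball (\<gamma>\<^sub>1 t) r \<Longrightarrow> b \<in> cball (\<gamma>\<^sub>1 t) r \<Longrightarrow> norm (f b - f a) \<le> B * norm (b - a)"
    using ball_Lipschitz[OF U smooth_on_C_k[OF f]] by metis
  have tb: "t \<in> {t..b}" using \<open>t < b\<close> by simp
  obtain d1 where d1: "d1 > 0" "\<And>s. s \<in> {t..b} \<Longrightarrow> \<bar>s - t\<bar> < d1 \<Longrightarrow> \<gamma>\<^sub>1 s \<in> ball (\<gamma>\<^sub>1 t) r"
    using continuous_on_eventually_in[OF trajectory_continuous[OF tr(1)] tb open_ball] r(1) by (metis centre_in_ball)
  obtain d2 where d2: "d2 > 0" "\<And>s. s \<in> {t..b} \<Longrightarrow> \<bar>s - t\<bar> < d2 \<Longrightarrow> \<gamma>\<^sub>2 s \<in> ball (\<gamma>\<^sub>1 t) r"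
    using continuous_on_eventually_in[OF trajectory_continuous[OF tr(2)] tb open_ball] r(1) eq by (metis centre_in_ball)
  \<comment> \<open>The last entry gives \<open>B * e \<le> 1/2\<close>; the others keep both curves
    in the ball where \<open>f\<close> is \<open>B\<close>-Lipschitz, and the times in the
    interval.\<close>
  define e where "e = Min {d1/2, d2/2, b - t, 1 / (2 * (B + 1))}"
  have e: "e > 0" "e < d1" "e < d2" "e \<le> b - t" "e \<le> 1 / (2 * (B + 1))"
    using d1(1) d2(1) \<open>t < b\<close> B(1) by (auto simp: e_def min_def)
  show ?thesis
  proof (rule that[OF e(1)])
    show "t + e \<le> b" using e by simp
    fix s assume s: "s \<in> {t..t+e}"
    have "norm (\<gamma>\<^sub>1 s - \<gamma>\<^sub>2 s) \<le> 2 * (norm (\<gamma>\<^sub>1 t - \<gamma>\<^sub>2 t) + \<bar>s - t\<bar> * 0)"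
    proof (rule norm_le_of_derivative_bound[OF _ _ B(1)])
      have ts: "closed_segment t s = {t..s}" using s by (simp add: closed_segment_eq_real_ivl)
      fix u assume "u \<in> closed_segment t s"
      then have u: "t \<le> u" "u \<le> s" using ts by auto
      have "(\<gamma>\<^sub>1 has_vector_derivative f (\<gamma>\<^sub>1 u)) (at u within {t..s})"
        "(\<gamma>\<^sub>2 has_vector_derivative f (\<gamma>\<^sub>2 u)) (at u within {t..s})"
        using tr u s e unfolding trajectory_def
        by (auto intro!: has_vector_derivative_within_subset[of _ _ _ "{t..b}" "{t..s}"])
      from has_vector_derivative_diff[OF this]
      show "((\<lambda>s. \<gamma>\<^sub>1 s - \<gamma>\<^sub>2 s) has_vector_derivative f (\<gamma>\<^sub>1 u) - f (\<gamma>\<^sub>2 u)) (at u within closed_segment t s)"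
        unfolding ts .
      have "u \<in> {t..b}" "\<bar>u - t\<bar> < d1" "\<bar>u - t\<bar> < d2" using u s e by auto
      then have "\<gamma>\<^sub>1 u \<in> ball (\<gamma>\<^sub>1 t) r" "\<gamma>\<^sub>2 u \<in> ball (\<gamma>\<^sub>1 t) r" using d1(2) d2(2) by auto
      then show "norm (f (\<gamma>\<^sub>1 u) - f (\<gamma>\<^sub>2 u)) \<le> B * norm (\<gamma>\<^sub>1 u - \<gamma>\<^sub>2 u) + 0"
        using B(2)[of "\<gamma>\<^sub>2 u" "\<gamma>\<^sub>1 u"] by simp
    next
      have "B * \<bar>s - t\<bar> \<le> B * (1 / (2 * (B + 1)))" using s e B(1) by (intro mult_left_mono) auto
      also have "\<dots> \<le> 1/2" using B(1) by (simp add: field_simps)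
      finally show "B * \<bar>s - t\<bar> \<le> 1/2" .
    qed
    then show "\<gamma>\<^sub>1 s = \<gamma>\<^sub>2 s" using eq by simp
  qed
qed

text \<open>Continuity argument at the supremum of the times up to which the curves agree. The step
  may use agreement on all of \<open>{a..t}\<close>: on the switching set, the past of the curves
  decides how they continue.\<close>

lemma eq_on_interval_continuation:
  fixes \<gamma>\<^sub>1 \<gamma>\<^sub>2 :: "real \<Rightarrow> 'a::real_normed_vector"
  assumes "continuous_on {a..b} \<gamma>\<^sub>1" "continuous_on {a..b} \<gamma>\<^sub>2" "\<gamma>\<^sub>1 a = \<gamma>\<^sub>2 a"
    and step: "\<And>t. a \<le> t \<Longrightarrow> t < b \<Longrightarrow> (\<And>s. s \<in> {a..t} \<Longrightarrow> \<gamma>\<^sub>1 s = \<gamma>\<^sub>2 s) \<Longrightarrow>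
      \<exists>e>0. \<forall>s\<in>{t..t+e} \<inter> {a..b}. \<gamma>\<^sub>1 s = \<gamma>\<^sub>2 s"
    and t: "t \<in> {a..b}"
  shows "\<gamma>\<^sub>1 t = \<gamma>\<^sub>2 t"
proof -
  define S where "S = {t \<in> {a..b}. \<forall>s\<in>{a..t}. \<gamma>\<^sub>1 s = \<gamma>\<^sub>2 s}"
  define c where "c = Sup S"
  have aS: "a \<in> S" using assms(3) t by (auto simp: S_def)
  have bdd: "bdd_above S" by (rule bdd_aboveI[of _ b]) (simp add: S_def)
  have ac: "a \<le> c" unfolding c_def by (rule cSup_upper[OF aS bdd])
  have cb: "c \<le> b" unfolding c_def by (rule cSup_least) (use aS in \<open>auto simp: S_def\<close>)
  have before: "\<gamma>\<^sub>1 s = \<gamma>\<^sub>2 s" if s: "a \<le> s" "s < c" for s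
  proof -
    obtain u where "u \<in> S" "s < u"
      using s(2) less_cSup_iff[OF _ bdd, of s] aS unfolding c_def by blast
    then show ?thesis using s(1) by (auto simp: S_def)
  qed
  have at_c: "\<gamma>\<^sub>1 c = \<gamma>\<^sub>2 c"
  proof (cases "a = c")
    case False
    \<comment> \<open>Agreement is a closed condition, so it passes to the supremum.\<close>
    have "closed ({a..b} \<inter> (\<lambda>s. \<gamma>\<^sub>1 s - \<gamma>\<^sub>2 s) -` {0})"
      by (intro continuous_closed_preimage continuous_on_diff assms(1,2)) auto
    moreover have "{a..<c} \<subseteq> {a..b} \<inter> (\<lambda>s. \<gamma>\<^sub>1 s - \<gamma>\<^sub>2 s) -` {0}"
      using before cb by auto
    ultimately have "closure {a..<c} \<subseteq> {a..b} \<inter> (\<lambda>s. \<gamma>\<^sub>1 s - \<gamma>\<^sub>2 s) -` {0}"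
      by (intro closure_minimal)
    moreover have "c \<in> closure {a..<c}" using False ac by simp
    ultimately show ?thesis by auto
  qed (use assms(3) in simp)
  have upto: "\<gamma>\<^sub>1 s = \<gamma>\<^sub>2 s" if "s \<in> {a..c}" for s
    using before at_c that by (cases "s = c") auto
  have "c = b"
  proof (rule ccontr)
    assume "c \<noteq> b"
    then have "c < b" using cb by simp
    from step[OF ac this upto] obtain e where e: "e > 0" "\<And>s. s \<in> {c..c+e} \<inter> {a..b} \<Longrightarrow> \<gamma>\<^sub>1 s = \<gamma>\<^sub>2 s"
      by blast
    have "\<gamma>\<^sub>1 s = \<gamma>\<^sub>2 s" if "s \<in> {a..min (c + e) b}" for s
      using upto[of s] e(2)[of s] that by (cases "s \<le> c") auto
    then have "min (c + e) b \<in> S" using ac cb e(1) by (auto simp: S_def)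
    then have "min (c + e) b \<le> c" unfolding c_def by (rule cSup_upper[OF _ bdd])
    then show False using e(1) \<open>c < b\<close> by auto
  qed
  then show ?thesis using upto t by auto
qed

lemma trajectory_unique:
  fixes f :: "'a::euclidean_space \<Rightarrow> 'a"
  assumes U: "open U" "\<gamma>\<^sub>1 ` {a..b} \<subseteq> U" and f: "smooth_on U f"
    and tr: "trajectory f \<gamma>\<^sub>1 {a..b}" "trajectory f \<gamma>\<^sub>2 {a..b}" and eq: "\<gamma>\<^sub>1 a = \<gamma>\<^sub>2 a" and t: "t \<in> {a..b}"
  shows "\<gamma>\<^sub>1 t = \<gamma>\<^sub>2 t"
proof (rule eq_on_interval_continuation[OF trajectory_continuous[OF tr(1)] trajectory_continuous[OF tr(2)] eq _ t])
  fix t assume t: "a \<le> t" "t < b" and same: "\<And>s. s \<in> {a..t} \<Longrightarrow> \<gamma>\<^sub>1 s = \<gamma>\<^sub>2 s"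
  have "\<gamma>\<^sub>1 t \<in> U" using U(2) t by auto
  moreover have "trajectory f \<gamma>\<^sub>1 {t..b}" "trajectory f \<gamma>\<^sub>2 {t..b}"
    by (rule trajectory_subset[OF tr(1)] trajectory_subset[OF tr(2)]; use t in auto)+
  ultimately obtain e where "e > 0" "\<And>s. s \<in> {t..t+e} \<Longrightarrow> \<gamma>\<^sub>1 s = \<gamma>\<^sub>2 s"
    using trajectory_locally_unique[OF U(1) _ f _ _ t(2)] same[of t] t(1) by (metis atLeastAtMost_iff order_refl)
  then show "\<exists>e>0. \<forall>s\<in>{t..t+e} \<inter> {a..b}. \<gamma>\<^sub>1 s = \<gamma>\<^sub>2 s" by blast
qed

section \<open>Piecewise smooth fields\<close>

lemma has_vector_derivative_Un:
  "(f has_vector_derivative f') (at x within S) \<Longrightarrow> (f has_vector_derivative f') (at x within T) \<Longrightarrow>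
    (f has_vector_derivative f') (at x within S \<union> T)"
  unfolding has_vector_derivative_def has_derivative_within
  by (simp add: at_within_union filterlim_sup)

locale piecewise_smooth =
  fixes N k :: nat and h :: "nat \<Rightarrow> real^'n \<Rightarrow> real"
    and A :: "nat \<Rightarrow> (real^'n) set" and X :: "nat \<Rightarrow> real^'n \<Rightarrow> real^'n"
  assumes field: "piecewise_smooth_field N h k A X"
begin

abbreviation "\<Sigma> \<equiv> switching_set N h"
abbreviation "sol \<equiv> solution N h k A X"

lemma h_smooth: "i \<in> {1..N} \<Longrightarrow> smooth_on UNIV (h i)"
  and A_bij: "bij_betw A {1..k} (components (UNIV - \<Sigma>))"
  using field by (auto simp: piecewise_smooth_field_def)

lemma ex_X_smooth:
  assumes "j \<in> {1..k}"
  obtains U where "open U" "closure (A j) \<subseteq> U" "smooth_on U (X j)"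
  using field assms unfolding piecewise_smooth_field_def by blast

lemma closed_\<Sigma>: "closed \<Sigma>"
proof -
  have "closed {x. h i x = 0}" if "i \<in> {1..N}" for i
    using continuous_closed_preimage[OF smooth_on_imp_continuous[OF h_smooth[OF that]] closed_UNIV, of "{0}"]
    by (simp add: vimage_def)
  then show ?thesis unfolding switching_set_def by (intro closed_UN) auto
qed

lemma A_component: "j \<in> {1..k} \<Longrightarrow> A j \<in> components (UNIV - \<Sigma>)"
  using A_bij bij_betwE by blast

lemma open_A: "j \<in> {1..k} \<Longrightarrow> open (A j)"
  using open_components[OF _ A_component] closed_\<Sigma> by (simp add: open_Diff)

lemma A_disjoint_\<Sigma>: "j \<in> {1..k} \<Longrightarrow> x \<in> A j \<Longrightarrow> x \<notin> \<Sigma>"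
  using in_components_subset[OF A_component] by blast

lemma A_unique: "j \<in> {1..k} \<Longrightarrow> j' \<in> {1..k} \<Longrightarrow> x \<in> A j \<Longrightarrow> x \<in> A j' \<Longrightarrow> j = j'"
  using components_nonoverlap[OF A_component A_component] A_bij
  by (metis bij_betw_imp_inj_on disjoint_iff inj_onD)

lemma ex_A:
  assumes "x \<notin> \<Sigma>" obtains j where "j \<in> {1..k}" "x \<in> A j"
proof -
  have "x \<in> \<Union>(components (UNIV - \<Sigma>))" using assms by simp
  then show ?thesis using A_bij that unfolding bij_betw_def by blast
qed

lemma connected_subset_A:
  "j \<in> {1..k} \<Longrightarrow> connected C \<Longrightarrow> C \<inter> \<Sigma> = {} \<Longrightarrow> x \<in> C \<Longrightarrow> x \<in> A j \<Longrightarrow> C \<subseteq> A j"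
  using components_maximal[OF A_component, of j C] by blast

lemma smooth_A:
  assumes "j \<in> {1..k}" shows "smooth_on (A j) (X j)"
proof -
  obtain U where "closure (A j) \<subseteq> U" "smooth_on U (X j)" using ex_X_smooth[OF assms] .
  then show ?thesis using smooth_on_subset closure_subset by (metis subset_trans)
qed

text \<open>The pointwise part of \<open>solution\<close>, isolated because it depends only on the
  curve near \<open>t\<close>.\<close>

definition sol_at :: "(real \<Rightarrow> real^'n) \<Rightarrow> real set \<Rightarrow> real \<Rightarrow> bool" where
  "sol_at \<gamma> I t \<longleftrightarrow> (\<forall>j\<in>{1..k}. \<gamma> t \<in> A j \<longrightarrow> (\<gamma> has_vector_derivative X j (\<gamma> t)) (at t within I)) \<and>
     (\<gamma> t \<in> \<Sigma> \<longrightarrow> crossing_point N h k A X (\<gamma> t) \<and>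
        (\<exists>a\<in>{1..k}. \<exists>b\<in>{1..k}. \<exists>\<epsilon>>0.
           a \<noteq> b \<and> \<gamma> t \<in> closure (A a) \<inter> closure (A b) \<and>
           \<gamma> ` (I \<inter> {t-\<epsilon>..<t}) \<subseteq> A a \<and> trajectory (X a) \<gamma> (I \<inter> {t-\<epsilon>..t}) \<and>
           \<gamma> ` (I \<inter> {t<..t+\<epsilon>}) \<subseteq> A b \<and> trajectory (X b) \<gamma> (I \<inter> {t..t+\<epsilon>})))"

lemma sol_iff: "sol \<gamma> I \<longleftrightarrow> continuous_on I \<gamma> \<and> (\<forall>t\<in>I. sol_at \<gamma> I t)"
  unfolding solution_def sol_at_def by blast

lemma sol_has_vector_derivative:
  "sol \<gamma> I \<Longrightarrow> t \<in> I \<Longrightarrow> j \<in> {1..k} \<Longrightarrow> \<gamma> t \<in> A j \<Longrightarrow>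
    (\<gamma> has_vector_derivative X j (\<gamma> t)) (at t within I)"
  unfolding solution_def by blast

text \<open>Lets a curve be checked piece by piece: curve and interval may be altered away from
  \<open>t\<close>. The window is closed, like the intervals \<open>{t-\<epsilon>..t}\<close> of the
  definition, so \<open>min \<epsilon> d\<close> is a valid new \<open>\<epsilon>\<close>.\<close>

lemma sol_at_local:
  assumes s: "sol_at \<gamma> I t" and d: "d > 0" and t: "t \<in> I'"
    and I': "\<And>s. s \<in> I' \<Longrightarrow> \<bar>s - t\<bar> \<le> d \<Longrightarrow> s \<in> I" and eq: "\<And>s. s \<in> I' \<Longrightarrow> \<bar>s - t\<bar> \<le> d \<Longrightarrow> \<gamma>' s = \<gamma> s"
  shows "sol_at \<gamma>' I' t"
proof -
  have eqt: "\<gamma>' t = \<gamma> t" using eq[OF t] d by simp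
  have deriv: "(\<gamma>' has_vector_derivative v) (at t within I')"
    if "(\<gamma> has_vector_derivative v) (at t within I)" for v
  proof -
    have "(\<gamma> has_vector_derivative v) (at t within I' \<inter> ball t d)"
      using I' by (intro has_vector_derivative_within_subset[OF that]) (auto simp: dist_real_def)
    then have "(\<gamma>' has_vector_derivative v) (at t within I' \<inter> ball t d)"
      using t d eq by (intro has_vector_derivative_transform[of t "I' \<inter> ball t d" \<gamma>' \<gamma>]) (auto simp: dist_real_def)
    moreover have "at t within I' \<inter> ball t d = at t within I'"
      using d by (intro at_within_nhd[of t "ball t d"]) auto
    ultimately show ?thesis by simp
  qed
  have tr: "trajectory (X a) \<gamma>' (I' \<inter> {t-min \<epsilon> d..t})" "trajectory (X b) \<gamma>' (I' \<inter> {t..t+min \<epsilon> d})"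
    if "trajectory (X a) \<gamma> (I \<inter> {t-\<epsilon>..t})" "trajectory (X b) \<gamma> (I \<inter> {t..t+\<epsilon>})" for a b \<epsilon>
    by (rule trajectory_subset[OF that(1)] trajectory_subset[OF that(2)]; use I' eq in auto)+
  have im: "\<gamma>' ` (I' \<inter> {t-min \<epsilon> d..<t}) \<subseteq> A a" "\<gamma>' ` (I' \<inter> {t<..t+min \<epsilon> d}) \<subseteq> A b"
    if "\<gamma> ` (I \<inter> {t-\<epsilon>..<t}) \<subseteq> A a" "\<gamma> ` (I \<inter> {t<..t+\<epsilon>}) \<subseteq> A b" for a b \<epsilon>
    using that I' eq by (auto simp: image_subset_iff)
  show ?thesis unfolding sol_at_def eqt
  proof (intro conjI ballI impI)
    fix j assume "j \<in> {1..k}" "\<gamma> t \<in> A j"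
    then show "(\<gamma>' has_vector_derivative X j (\<gamma> t)) (at t within I')"
      using s by (intro deriv) (auto simp: sol_at_def)
  next
    assume \<Sigma>: "\<gamma> t \<in> \<Sigma>"
    then show "crossing_point N h k A X (\<gamma> t)" using s by (simp add: sol_at_def)
    obtain a b \<epsilon> where *: "a \<in> {1..k}" "b \<in> {1..k}" "\<epsilon> > 0" "a \<noteq> b" "\<gamma> t \<in> closure (A a) \<inter> closure (A b)"
      and a: "\<gamma> ` (I \<inter> {t-\<epsilon>..<t}) \<subseteq> A a" "trajectory (X a) \<gamma> (I \<inter> {t-\<epsilon>..t})"
      and b: "\<gamma> ` (I \<inter> {t<..t+\<epsilon>}) \<subseteq> A b" "trajectory (X b) \<gamma> (I \<inter> {t..t+\<epsilon>})"
      using s \<Sigma> unfolding sol_at_def by blast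
    have "min \<epsilon> d > 0 \<and> \<gamma>' ` (I' \<inter> {t-min \<epsilon> d..<t}) \<subseteq> A a \<and> trajectory (X a) \<gamma>' (I' \<inter> {t-min \<epsilon> d..t}) \<and>
        \<gamma>' ` (I' \<inter> {t<..t+min \<epsilon> d}) \<subseteq> A b \<and> trajectory (X b) \<gamma>' (I' \<inter> {t..t+min \<epsilon> d})"
      using *(3) d tr[OF a(2) b(2)] im[OF a(1) b(1)] by simp
    then show "\<exists>a\<in>{1..k}. \<exists>b\<in>{1..k}. \<exists>\<epsilon>>0. a \<noteq> b \<and> \<gamma> t \<in> closure (A a) \<inter> closure (A b) \<and>
        \<gamma>' ` (I' \<inter> {t-\<epsilon>..<t}) \<subseteq> A a \<and> trajectory (X a) \<gamma>' (I' \<inter> {t-\<epsilon>..t}) \<and>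
        \<gamma>' ` (I' \<inter> {t<..t+\<epsilon>}) \<subseteq> A b \<and> trajectory (X b) \<gamma>' (I' \<inter> {t..t+\<epsilon>})"
      using * by blast
  qed
qed

lemma sol_subset: "sol \<gamma> I \<Longrightarrow> I' \<subseteq> I \<Longrightarrow> sol \<gamma> I'"
  unfolding sol_iff
  by (metis continuous_on_subset sol_at_local subsetD zero_less_one)

text \<open>Off the switching set only the two one-sided derivatives have to agree at the gluing
  time, and both are the value of the same component field. On it, incoming and outgoing components
  would have to be matched as well.\<close>

lemma sol_concat:
  assumes s1: "sol \<gamma>\<^sub>1 {s..t}" and s2: "sol \<gamma>\<^sub>2 {t..u}" and st: "s \<le> t" "t \<le> u"
    and eq: "\<gamma>\<^sub>1 t = \<gamma>\<^sub>2 t" and nt: "\<gamma>\<^sub>1 t \<notin> \<Sigma>"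
  shows "sol (\<lambda>r. if r \<le> t then \<gamma>\<^sub>1 r else \<gamma>\<^sub>2 r) {s..u}" (is "sol ?\<gamma> _")
  unfolding sol_iff
proof (intro conjI ballI)
  have "continuous_on ({s..t} \<union> {t..u}) ?\<gamma>"
    using s1 s2 eq by (intro continuous_on_cases) (auto simp: sol_iff)
  then show "continuous_on {s..u} ?\<gamma>" using st by (simp add: ivl_disj_un_two_touch)
next
  fix r assume r: "r \<in> {s..u}"
  consider "r < t" | "r = t" | "r > t" by linarith
  then show "sol_at ?\<gamma> {s..u} r"
  proof cases
    case 1
    then have "sol_at \<gamma>\<^sub>1 {s..t} r" "t - r > 0" using r s1 by (auto simp: sol_iff)
    then show ?thesis by (rule sol_at_local) (use r 1 in auto)
  next
    case 3
    \<comment> \<open>Half the distance, so that the window stays clear of \<open>t\<close>, where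
      the glued curve is given by \<open>\<gamma>\<^sub>1\<close>.\<close>
    then have "sol_at \<gamma>\<^sub>2 {t..u} r" "(r - t) / 2 > 0" using r s2 by (auto simp: sol_iff)
    then show ?thesis by (rule sol_at_local) (use r 3 in \<open>auto simp: abs_if split: if_splits\<close>)
  next
    case 2
    have "(?\<gamma> has_vector_derivative X j (?\<gamma> t)) (at t within {s..u})" if j: "j \<in> {1..k}" "?\<gamma> t \<in> A j" for j
    proof -
      have "(\<gamma>\<^sub>1 has_vector_derivative X j (?\<gamma> t)) (at t within {s..t})"
        "(\<gamma>\<^sub>2 has_vector_derivative X j (?\<gamma> t)) (at t within {t..u})"
        using sol_has_vector_derivative[OF s1 _ j(1), of t] sol_has_vector_derivative[OF s2 _ j(1), of t] j(2) st eq
        by simp_all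
      then have "(?\<gamma> has_vector_derivative X j (?\<gamma> t)) (at t within {s..t})"
        "(?\<gamma> has_vector_derivative X j (?\<gamma> t)) (at t within {t..u})"
        using st eq
        by (auto elim!: has_vector_derivative_transform[rotated 2])
      then have "(?\<gamma> has_vector_derivative X j (?\<gamma> t)) (at t within {s..t} \<union> {t..u})"
        by (rule has_vector_derivative_Un)
      then show ?thesis using st by (simp add: ivl_disj_un_two_touch)
    qed
    then show ?thesis using 2 nt by (simp add: sol_at_def)
  qed
qed

lemma sol_trajectory:
  assumes "sol \<gamma> I" "j \<in> {1..k}" "I' \<subseteq> I" "\<gamma> ` I' \<subseteq> A j"
  shows "trajectory (X j) \<gamma> I'"
  unfolding trajectory_def
proof
  fix t assume t: "t \<in> I'"
  then have "(\<gamma> has_vector_derivative X j (\<gamma> t)) (at t within I)"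
    using assms(3,4) by (intro sol_has_vector_derivative[OF assms(1) _ assms(2)]) auto
  then show "(\<gamma> has_vector_derivative X j (\<gamma> t)) (at t within I')"
    by (rule has_vector_derivative_within_subset[OF _ assms(3)])
qed

lemma sol_at_trajectory:
  assumes j: "j \<in> {1..k}" and tr: "trajectory (X j) \<gamma> I" and t: "t \<in> I" "\<gamma> t \<in> A j"
  shows "sol_at \<gamma> I t"
  unfolding sol_at_def
proof (intro conjI ballI impI)
  fix i assume "i \<in> {1..k}" "\<gamma> t \<in> A i"
  then have "i = j" using A_unique[OF _ j _ t(2)] by blast
  then show "(\<gamma> has_vector_derivative X i (\<gamma> t)) (at t within I)"
    using tr t(1) by (simp add: trajectory_def)
qed (use A_disjoint_\<Sigma>[OF j t(2)] in simp_all)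

text \<open>On the switching set both curves come from the same component, since they agreed before.
  A crossing point is adjacent to just two components, so they also leave into the same one, whose
  field is smooth beyond its closure. At an initial point on the set there would be no earlier time
  to compare; \<open>na\<close> excludes this.\<close>

lemma sol_unique:
  assumes s1: "sol \<gamma>\<^sub>1 {a..b}" and s2: "sol \<gamma>\<^sub>2 {a..b}" and eq: "\<gamma>\<^sub>1 a = \<gamma>\<^sub>2 a" and na: "\<gamma>\<^sub>1 a \<notin> \<Sigma>"
    and t: "t \<in> {a..b}"
  shows "\<gamma>\<^sub>1 t = \<gamma>\<^sub>2 t"
proof -
  have c: "continuous_on {a..b} \<gamma>\<^sub>1" "continuous_on {a..b} \<gamma>\<^sub>2" using s1 s2 by (auto simp: sol_iff)
  show ?thesis
  proof (rule eq_on_interval_continuation[OF c eq _ t])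
    fix t assume at: "a \<le> t" and tb: "t < b" and same: "\<And>s. s \<in> {a..t} \<Longrightarrow> \<gamma>\<^sub>1 s = \<gamma>\<^sub>2 s"
    have tI: "t \<in> {a..b}" using at tb by simp
    have eqt: "\<gamma>\<^sub>1 t = \<gamma>\<^sub>2 t" using same at by simp
    have "\<exists>j\<in>{1..k}. \<exists>e>0. t + e \<le> b \<and> \<gamma>\<^sub>1 t \<in> closure (A j) \<and>
        trajectory (X j) \<gamma>\<^sub>1 {t..t+e} \<and> trajectory (X j) \<gamma>\<^sub>2 {t..t+e}"
    proof (cases "\<gamma>\<^sub>1 t \<in> \<Sigma>")
      case False
      then obtain j where j: "j \<in> {1..k}" "\<gamma>\<^sub>1 t \<in> A j" by (rule ex_A)
      obtain d1 where d1: "d1 > 0" "\<And>s. s \<in> {a..b} \<Longrightarrow> \<bar>s - t\<bar> < d1 \<Longrightarrow> \<gamma>\<^sub>1 s \<in> A j"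
        using continuous_on_eventually_in[OF c(1) tI open_A[OF j(1)] j(2)] by blast
      have "\<gamma>\<^sub>2 t \<in> A j" using j eqt by simp
      from continuous_on_eventually_in[OF c(2) tI open_A[OF j(1)] this]
      obtain d2 where d2: "d2 > 0" "\<And>s. s \<in> {a..b} \<Longrightarrow> \<bar>s - t\<bar> < d2 \<Longrightarrow> \<gamma>\<^sub>2 s \<in> A j"
        by blast
      define e where "e = Min {d1/2, d2/2, b - t}"
      have e: "e > 0" "e < d1" "e < d2" "t + e \<le> b" using d1(1) d2(1) tb by (auto simp: e_def min_def)
      have "trajectory (X j) \<gamma>\<^sub>1 {t..t+e}" "trajectory (X j) \<gamma>\<^sub>2 {t..t+e}"
        by (rule sol_trajectory[OF s1 j(1)] sol_trajectory[OF s2 j(1)]; use e at d1(2) d2(2) in auto)+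
      moreover have "\<gamma>\<^sub>1 t \<in> closure (A j)" using j closure_subset by blast
      ultimately show ?thesis using e j(1) by blast
    next
      case True
      then have "t \<noteq> a" using na by auto
      then have "a < t" using at by simp
      obtain a1 b1 e1 where 1: "a1 \<in> {1..k}" "b1 \<in> {1..k}" "e1 > 0" "a1 \<noteq> b1"
        "\<gamma>\<^sub>1 t \<in> closure (A a1) \<inter> closure (A b1)" "\<gamma>\<^sub>1 ` ({a..b} \<inter> {t-e1..<t}) \<subseteq> A a1"
        "trajectory (X b1) \<gamma>\<^sub>1 ({a..b} \<inter> {t..t+e1})"
        using s1 tI True unfolding sol_iff sol_at_def by blast
      have "\<gamma>\<^sub>2 t \<in> \<Sigma>" using True eqt by simp
      then obtain a2 b2 e2 where 2: "a2 \<in> {1..k}" "b2 \<in> {1..k}" "e2 > 0" "a2 \<noteq> b2"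
        "\<gamma>\<^sub>2 t \<in> closure (A a2) \<inter> closure (A b2)" "\<gamma>\<^sub>2 ` ({a..b} \<inter> {t-e2..<t}) \<subseteq> A a2"
        "trajectory (X b2) \<gamma>\<^sub>2 ({a..b} \<inter> {t..t+e2})"
        using s2 tI unfolding sol_iff sol_at_def by blast
      \<comment> \<open>A time before \<open>t\<close> at which both curves are already in their
        incoming components.\<close>
      define s where "s = Max {a, t - e1, t - e2}"
      have s: "a \<le> s" "s < t" "t - e1 \<le> s" "t - e2 \<le> s" using \<open>a < t\<close> 1(3) 2(3) by (auto simp: s_def)
      have "\<gamma>\<^sub>1 s \<in> A a1" using 1(6) s tb by (auto simp: image_subset_iff)
      moreover have "\<gamma>\<^sub>2 s \<in> A a2" using 2(6) s tb by (auto simp: image_subset_iff)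
      ultimately have "a1 = a2" using same[of s] s A_unique[OF 1(1) 2(1)] by simp
      obtain c d where cd: "{j\<in>{1..k}. \<gamma>\<^sub>1 t \<in> closure (A j)} = {c, d}"
      proof -
        have "crossing_point N h k A X (\<gamma>\<^sub>1 t)" using s1 tI True unfolding solution_def by blast
        then show ?thesis unfolding crossing_point_def using that by blast
      qed
      have "{a1, b1, b2} \<subseteq> {c, d}" unfolding cd[symmetric] using 1(1,2,5) 2(2,5) eqt by simp
      then have "b1 = b2" using 1(4) 2(4) \<open>a1 = a2\<close> by auto
      define e where "e = Min {e1, e2, b - t}"
      have e: "e > 0" "e \<le> e1" "e \<le> e2" "t + e \<le> b" using 1(3) 2(3) tb by (auto simp: e_def)
      have "trajectory (X b1) \<gamma>\<^sub>1 {t..t+e}" "trajectory (X b1) \<gamma>\<^sub>2 {t..t+e}"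
        by (rule trajectory_subset[OF 1(7)] trajectory_subset[OF 2(7)[folded \<open>b1 = b2\<close>]]; use e at in auto)+
      then show ?thesis using e 1(2,5) by blast
    qed
    then obtain j e where j: "j \<in> {1..k}" "e > 0" "t + e \<le> b" "\<gamma>\<^sub>1 t \<in> closure (A j)"
      "trajectory (X j) \<gamma>\<^sub>1 {t..t+e}" "trajectory (X j) \<gamma>\<^sub>2 {t..t+e}" by blast
    \<comment> \<open>\<open>\<gamma>\<^sub>1 t\<close> may be on the boundary of
      \<open>A j\<close>, hence the neighbourhood of the closure.\<close>
    obtain U where U: "open U" "closure (A j) \<subseteq> U" "smooth_on U (X j)" using ex_X_smooth[OF j(1)] .
    have "\<gamma>\<^sub>1 t \<in> U" "t < t + e" using U j by auto
    then obtain e' where "e' > 0" "\<And>s. s \<in> {t..t+e'} \<Longrightarrow> \<gamma>\<^sub>1 s = \<gamma>\<^sub>2 s"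
      using trajectory_locally_unique[OF U(1) _ U(3) j(5,6) _ eqt] by blast
    then show "\<exists>e>0. \<forall>s\<in>{t..t+e} \<inter> {a..b}. \<gamma>\<^sub>1 s = \<gamma>\<^sub>2 s" by blast
  qed
qed

text \<open>Smooth dependence of the endpoint on the initial point near \<open>\<gamma> s\<close>.
  \<open>W\<close> avoids \<open>\<Sigma>\<close> so that arcs can be glued and uniqueness applies.
  The equation \<open>\<Phi> (\<gamma> s) = \<gamma> t\<close> is recorded because the last clause
  does not say that its curve from \<open>\<gamma> s\<close> is \<open>\<gamma>\<close>.\<close>

definition smooth_arc :: "(real \<Rightarrow> real^'n) \<Rightarrow> real \<Rightarrow> real \<Rightarrow> bool" where
  "smooth_arc \<gamma> s t \<longleftrightarrow> (\<exists>W \<Phi>. open W \<and> \<gamma> s \<in> W \<and> W \<inter> \<Sigma> = {} \<and> smooth_on W \<Phi> \<and> \<Phi> (\<gamma> s) = \<gamma> t \<and>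
     (\<forall>q\<in>W. \<exists>\<eta>. sol \<eta> {s..t} \<and> \<eta> s = q \<and> \<eta> t = \<Phi> q))"

lemma smooth_arc_trans:
  assumes "smooth_arc \<gamma> s t" "smooth_arc \<gamma> t u" "s \<le> t" "t \<le> u"
  shows "smooth_arc \<gamma> s u"
proof -
  obtain W \<Phi> where W: "open W" "\<gamma> s \<in> W" "W \<inter> \<Sigma> = {}" "smooth_on W \<Phi>" "\<Phi> (\<gamma> s) = \<gamma> t"
    "\<And>q. q \<in> W \<Longrightarrow> \<exists>\<eta>. sol \<eta> {s..t} \<and> \<eta> s = q \<and> \<eta> t = \<Phi> q"
    using assms(1) unfolding smooth_arc_def by blast
  obtain V \<Psi> where V: "open V" "\<gamma> t \<in> V" "V \<inter> \<Sigma> = {}" "smooth_on V \<Psi>" "\<Psi> (\<gamma> t) = \<gamma> u"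
    "\<And>q. q \<in> V \<Longrightarrow> \<exists>\<eta>. sol \<eta> {t..u} \<and> \<eta> t = q \<and> \<eta> u = \<Psi> q"
    using assms(2) unfolding smooth_arc_def by blast
  let ?W = "W \<inter> \<Phi> -` V"
  have W': "open ?W"
    by (intro continuous_open_preimage smooth_on_imp_continuous W V)
  have "smooth_on ?W (\<lambda>q. \<Psi> (\<Phi> q))"
    by (rule smooth_on_compose[OF W' V(1) _ V(4) smooth_on_subset[OF W(4)]]) auto
  moreover have "\<exists>\<eta>. sol \<eta> {s..u} \<and> \<eta> s = q \<and> \<eta> u = \<Psi> (\<Phi> q)" if q: "q \<in> ?W" for q
  proof -
    obtain \<eta>1 where 1: "sol \<eta>1 {s..t}" "\<eta>1 s = q" "\<eta>1 t = \<Phi> q" using W(6) q by blast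
    obtain \<eta>2 where 2: "sol \<eta>2 {t..u}" "\<eta>2 t = \<Phi> q" "\<eta>2 u = \<Psi> (\<Phi> q)" using V(6) q by blast
    have "\<eta>1 t \<notin> \<Sigma>" using 1 q V(3) by auto
    from sol_concat[OF 1(1) 2(1) assms(3,4) _ this]
    have "sol (\<lambda>r. if r \<le> t then \<eta>1 r else \<eta>2 r) {s..u}" using 1 2 by simp
    then show ?thesis
      using 1 2 assms(3,4) by (intro exI[of _ "\<lambda>r. if r \<le> t then \<eta>1 r else \<eta>2 r"]) auto
  qed
  ultimately show ?thesis
    unfolding smooth_arc_def using W' W V by (intro exI[of _ ?W] exI[of _ "\<lambda>q. \<Psi> (\<Phi> q)"]) auto
qed

text \<open>Short arcs lie in one flow box; \<open>Bolzano\<close> chains them along the compact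
  interval with the help of \<open>smooth_arc_trans\<close>.\<close>

lemma smooth_arc_within_component:
  assumes s: "sol \<gamma> {s..u}" and j: "j \<in> {1..k}" and su: "s \<le> u" and in_A: "\<gamma> ` {s..u} \<subseteq> A j"
  shows "smooth_arc \<gamma> s u"
proof -
  have "s \<le> s \<and> u \<le> u \<longrightarrow> smooth_arc \<gamma> s u"
    using su
  proof (induction rule: Bolzano[where P = "\<lambda>a b. s \<le> a \<and> b \<le> u \<longrightarrow> smooth_arc \<gamma> a b"])
    case (trans a b c)
    then show ?case using smooth_arc_trans[of \<gamma> a b c] by auto
  next
    case (local t)
    then have tI: "t \<in> {s..u}" by simp
    then have "\<gamma> t \<in> A j" using in_A by blast
    from ex_flow_box[OF open_A[OF j] this smooth_A[OF j]]
    obtain \<delta> V \<phi> where tV: "\<gamma> t \<in> V" and box: "flow_box (X j) (A j) \<delta> V \<phi>" by blast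
    have \<delta>: "\<delta> > 0" and V: "open V" and \<phi>: "smooth_on (V \<times> {-\<delta><..<\<delta>}) \<phi>"
      and \<phi>0: "\<And>x. x \<in> V \<Longrightarrow> \<phi> (x, 0) = x"
      and \<phi>_in: "\<And>x t. x \<in> V \<Longrightarrow> t \<in> {-\<delta><..<\<delta>} \<Longrightarrow> \<phi> (x, t) \<in> A j"
      using box unfolding flow_box_def by blast+
    have "continuous_on {s..u} \<gamma>" using s by (simp add: sol_iff)
    from continuous_on_eventually_in[OF this tI V tV] obtain d
      where d: "d > 0" "\<And>r. r \<in> {s..u} \<Longrightarrow> \<bar>r - t\<bar> < d \<Longrightarrow> \<gamma> r \<in> V" by blast
    have "smooth_arc \<gamma> a b" if ab: "a \<le> t" "t \<le> b" "b - a < min d \<delta>" "s \<le> a" "b \<le> u" for a b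
    proof -
      have solution: "sol (\<lambda>r. \<phi> (q, r - a)) {a..b}" if q: "q \<in> V" for q
      proof -
        have in_J: "r - a \<in> {-\<delta><..<\<delta>}" if "r \<in> {a..b}" for r using that ab by auto
        have tr: "trajectory (X j) (\<lambda>r. \<phi> (q, r - a)) {a..b}"
          by (rule flow_box_trajectory[OF box q in_J])
        moreover have "sol_at (\<lambda>r. \<phi> (q, r - a)) {a..b} r" if r: "r \<in> {a..b}" for r
          by (rule sol_at_trajectory[OF j tr r \<phi>_in[OF q in_J[OF r]]])
        moreover have "continuous_on {a..b} (\<lambda>r. \<phi> (q, r - a))"
          by (rule trajectory_continuous[OF tr])
        ultimately show ?thesis unfolding sol_iff by blast
      qed
      have aV: "\<gamma> a \<in> V" using d(2)[of a] ab by auto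
      have V\<Sigma>: "V \<inter> \<Sigma> = {}" using A_disjoint_\<Sigma>[OF j] \<phi>_in[of _ 0] \<phi>0 \<delta> by fastforce
      have "smooth_on V (\<lambda>q. \<phi> (q, b - a))"
        by (rule smooth_on_compose[OF V open_Times[OF V open_greaterThanLessThan] _ \<phi>
              smooth_on_Pair[OF V smooth_on_linear[OF bounded_linear_ident V] smooth_on_const[OF V]]])
          (use ab in auto)
      \<comment> \<open>The box orbit from \<open>\<gamma> a\<close> is the given curve, by
        uniqueness.\<close>
      moreover have "\<phi> (\<gamma> a, b - a) = \<gamma> b"
      proof (rule sol_unique[OF solution[OF aV] sol_subset[OF s], of b])
        show "\<phi> (\<gamma> a, a - a) = \<gamma> a" using \<phi>0[OF aV] by simp
        then show "\<phi> (\<gamma> a, a - a) \<notin> \<Sigma>" using aV V\<Sigma> by auto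
      qed (use ab in auto)
      moreover have "\<exists>\<eta>. sol \<eta> {a..b} \<and> \<eta> a = q \<and> \<eta> b = \<phi> (q, b - a)" if q: "q \<in> V" for q
        using solution[OF q] \<phi>0[OF q] by (intro exI[of _ "\<lambda>r. \<phi> (q, r - a)"]) simp
      ultimately show ?thesis
        unfolding smooth_arc_def using V aV V\<Sigma> by (intro exI[of _ V] exI[of _ "\<lambda>q. \<phi> (q, b - a)"]) simp
    qed
    then show ?case using d(1) \<delta> by (intro exI[of _ "min d \<delta>"]) simp
  qed
  then show ?thesis by simp
qed

end

section \<open>Charts at crossing points\<close>

lemma frechet_derivative_eq_gradient:
  fixes h :: "real^'n \<Rightarrow> real"
  assumes "smooth_on UNIV h"
  obtains v where "GDERIV h x :> v" "\<And>w. frechet_derivative h (at x) w = w \<bullet> v"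
proof -
  let ?D = "frechet_derivative h (at x)"
  have D: "(h has_derivative ?D) (at x)" by (rule smooth_on_has_derivative[OF assms UNIV_I])
  define v where "v = (\<Sum>b\<in>Basis. ?D b *\<^sub>R b)"
  have "?D w = w \<bullet> v" for w
    using linear_Basis_expansion[OF has_derivative_linear[OF D], of w]
    by (simp add: v_def inner_sum_right mult.commute)
  moreover from this have "?D = (\<lambda>w. w \<bullet> v)" by (rule ext)
  ultimately show ?thesis using that D by (simp add: gderiv_def)
qed

context piecewise_smooth
begin

text \<open>Near a crossing point, with \<open>H = \<plusminus>h\<^sub>i\<close> signed so that both components cross in the
  direction of increasing \<open>H\<close>.\<close>

definition crossing_chart ::
  "nat \<Rightarrow> nat \<Rightarrow> (real^'n \<Rightarrow> real) \<Rightarrow> (real^'n) set \<Rightarrow> bool" where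
  "crossing_chart a b H B \<longleftrightarrow> a \<in> {1..k} \<and> b \<in> {1..k} \<and> a \<noteq> b \<and> smooth_on UNIV H \<and> open B \<and>
     smooth_on B (X a) \<and> smooth_on B (X b) \<and>
     (\<forall>z\<in>B. frechet_derivative H (at z) (X a z) > 0 \<and> frechet_derivative H (at z) (X b z) > 0) \<and>
     (\<forall>z\<in>B. z \<in> \<Sigma> \<longleftrightarrow> H z = 0) \<and>
     (\<forall>z\<in>B. H z = 0 \<longrightarrow> z \<in> closure (A a) \<longrightarrow> z \<in> closure (A b) \<longrightarrow> crossing_point N h k A X z)"

text \<open>The strict inequalities persist near \<open>p\<close>, and the finitely many other
  surfaces and closures can be kept away. That a nearby point of the surface touches both
  \<open>A a\<close> and \<open>A b\<close> is not shown here; the chart keeps it as a premise, to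
  be supplied by an orbit that runs from one to the other.\<close>

lemma ex_crossing_chart:
  assumes cp: "crossing_point N h k A X p"
    and ab: "a \<in> {1..k}" "b \<in> {1..k}" "a \<noteq> b" "p \<in> closure (A a)" "p \<in> closure (A b)"
  obtains H B where "p \<in> B" "H p = 0" "crossing_chart a b H B"
proof -
  obtain i v c d where i: "{i'\<in>{1..N}. h i' p = 0} = {i}" and v: "GDERIV (h i) p :> v" "v \<noteq> 0"
    and cd: "{j\<in>{1..k}. p \<in> closure (A j)} = {c, d}" "c \<noteq> d"
    and prod: "(X c p \<bullet> v) * (X d p \<bullet> v) > 0"
    using cp unfolding crossing_point_def by blast
  have ab_eq: "{a, b} = {c, d}"
  proof -
    have "{a, b} \<subseteq> {c, d}" unfolding cd(1)[symmetric] using ab by simp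
    then show ?thesis using ab(3) cd(2) by auto
  qed
  then have prod: "(X a p \<bullet> v) * (X b p \<bullet> v) > 0"
    using prod ab(3) by (auto simp: doubleton_eq_iff mult.commute)
  have iN: "i \<in> {1..N}" "h i p = 0" using i by auto
  note hi = h_smooth[OF iN(1)]
  \<comment> \<open>The common sign of both fields relative to the gradient; multiplying by it makes
    \<open>H\<close> increase along both.\<close>
  define \<sigma> where "\<sigma> = sgn (X a p \<bullet> v)"
  have \<sigma>: "\<sigma> * (X a p \<bullet> v) > 0" "\<sigma> * (X b p \<bullet> v) > 0" "\<sigma> \<noteq> 0"
    using prod by (auto simp: \<sigma>_def sgn_if zero_less_mult_iff)
  define H where "H x = \<sigma> * h i x" for x
  have H: "smooth_on UNIV H"
    unfolding H_def by (rule smooth_on_linear_compose[OF bounded_linear_mult_right open_UNIV hi])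
  have DH: "frechet_derivative H (at x) = (\<lambda>w. \<sigma> * frechet_derivative (h i) (at x) w)" for x
    using has_derivative_mult_right[OF smooth_on_has_derivative[OF hi UNIV_I, of x], of \<sigma>]
    unfolding H_def by (rule frechet_derivative_at[symmetric])
  obtain Ua Ub where Ua: "open Ua" "closure (A a) \<subseteq> Ua" "smooth_on Ua (X a)"
    and Ub: "open Ub" "closure (A b) \<subseteq> Ub" "smooth_on Ub (X b)"
    using ex_X_smooth[OF ab(1)] ex_X_smooth[OF ab(2)] by metis
  have pos_open: "open (U \<inter> (\<lambda>z. frechet_derivative H (at z) (Y z)) -` {0<..})"
    if "open U" "smooth_on U Y" for U and Y :: "real^'n \<Rightarrow> real^'n"
    by (intro continuous_open_preimage[OF smooth_on_imp_continuous that(1)] open_greaterThan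
        smooth_on_frechet_derivative[OF that(1) open_UNIV H _ _ that(2)]
        smooth_on_linear[OF bounded_linear_ident that(1)]) auto
  \<comment> \<open>Open conditions in turn: \<open>X a\<close> and \<open>X b\<close> smooth and
    increasing \<open>H\<close>, no other surface, no third component.\<close>
  define B where "B = (Ua \<inter> (\<lambda>z. frechet_derivative H (at z) (X a z)) -` {0<..}) \<inter>
    (Ub \<inter> (\<lambda>z. frechet_derivative H (at z) (X b z)) -` {0<..}) \<inter>
    (\<Inter>i'\<in>{1..N} - {i}. - {x. h i' x = 0}) \<inter> (\<Inter>j\<in>{1..k} - {a, b}. - closure (A j))"
  have "open (- {x. h i' x = 0})" if "i' \<in> {1..N}" for i'
    using continuous_closed_preimage[OF smooth_on_imp_continuous[OF h_smooth[OF that]] closed_UNIV, of "{0}"]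
    by (simp add: vimage_def open_Compl)
  then have B: "open B"
    unfolding B_def by (intro open_Int pos_open Ua Ub open_INT) auto
  have "frechet_derivative (h i) (at p) w = w \<bullet> v" for w
    using frechet_derivative_at[OF v(1)[unfolded gderiv_def]] by metis
  then have "frechet_derivative H (at p) (X a p) > 0" "frechet_derivative H (at p) (X b p) > 0"
    using \<sigma> by (simp_all add: DH)
  moreover have "p \<in> - {x. h i' x = 0}" if "i' \<in> {1..N} - {i}" for i' using i that by blast
  moreover have "p \<in> - closure (A j)" if "j \<in> {1..k} - {a, b}" for j using cd(1) ab_eq that by blast
  ultimately have pB: "p \<in> B" using Ua(2) Ub(2) ab(4,5) by (auto simp: B_def)
  have \<Sigma>_iff: "z \<in> \<Sigma> \<longleftrightarrow> H z = 0" if "z \<in> B" for z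
  proof -
    have "z \<in> \<Sigma> \<longleftrightarrow> (\<exists>i'\<in>{1..N}. h i' z = 0)" by (auto simp: switching_set_def)
    also have "\<dots> \<longleftrightarrow> h i z = 0" using that iN(1) by (auto simp: B_def)
    finally show ?thesis using \<sigma>(3) by (simp add: H_def)
  qed
  have crossing: "crossing_point N h k A X z"
    if z: "z \<in> B" "H z = 0" "z \<in> closure (A a)" "z \<in> closure (A b)" for z
  proof -
    obtain v where v: "GDERIV (h i) z :> v" "\<And>w. frechet_derivative (h i) (at z) w = w \<bullet> v"
      using frechet_derivative_eq_gradient[OF hi] by blast
    have "h i z = 0" using z(2) \<sigma>(3) by (simp add: H_def)
    then have "{i'\<in>{1..N}. h i' z = 0} = {i}" using z(1) iN(1) by (auto simp: B_def)
    moreover have "{j\<in>{1..k}. z \<in> closure (A j)} = {a, b}"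
      using z ab(1,2) by (auto simp: B_def)
    moreover have pos: "\<sigma> * (X a z \<bullet> v) > 0" "\<sigma> * (X b z \<bullet> v) > 0"
      using z(1) by (auto simp: B_def DH v(2))
    moreover have "v \<noteq> 0" using pos by auto
    moreover have "(X a z \<bullet> v) * (X b z \<bullet> v) > 0"
      using pos by (auto simp: zero_less_mult_iff)
    ultimately show ?thesis
      unfolding crossing_point_def using v(1) ab(3) by blast
  qed
  have "crossing_chart a b H B"
    unfolding crossing_chart_def
  proof (intro conjI ballI impI)
    show "smooth_on B (X a)" "smooth_on B (X b)"
      by (rule smooth_on_subset[OF Ua(3)] smooth_on_subset[OF Ub(3)]; auto simp: B_def)+
  qed (use ab H B \<Sigma>_iff crossing in \<open>auto simp: B_def\<close>)
  moreover have "H p = 0" using iN by (simp add: H_def)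
  ultimately show ?thesis using pB that by blast
qed

text \<open>\<open>H\<close> increases strictly along both pieces and vanishes at the junction, so
  the surface is met only there. A connected set off \<open>\<Sigma>\<close> stays in one component,
  which \<open>q\<close> fixes for the first piece and the end point for the second.\<close>

lemma sol_through_crossing:
  assumes chart: "crossing_chart a b H B"
    and boxa: "flow_box (X a) B \<delta>a Va \<phi>a" and boxb: "flow_box (X b) B \<delta>b Vb \<phi>b"
    and q: "q \<in> Va" "q \<in> A a" and \<tau>: "0 < \<tau>" "\<tau> < u - s" and \<delta>: "u - s < \<delta>a" "u - s < \<delta>b"
    and hit: "H (\<phi>a (q, \<tau>)) = 0" and z: "\<phi>a (q, \<tau>) \<in> Vb"
    and end_in: "\<phi>b (\<phi>a (q, \<tau>), u - s - \<tau>) \<in> A b"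
  defines "\<eta> \<equiv> \<lambda>r. if r \<le> s + \<tau> then \<phi>a (q, r - s) else \<phi>b (\<phi>a (q, \<tau>), r - (s + \<tau>))"
  shows "sol \<eta> {s..u}"
proof -
  let ?z = "\<phi>a (q, \<tau>)" and ?\<theta> = "s + \<tau>"
  have ab: "a \<in> {1..k}" "b \<in> {1..k}" "a \<noteq> b" and H: "smooth_on UNIV H"
    and pos: "\<And>z. z \<in> B \<Longrightarrow> frechet_derivative H (at z) (X a z) > 0"
      "\<And>z. z \<in> B \<Longrightarrow> frechet_derivative H (at z) (X b z) > 0"
    and \<Sigma>_iff: "\<And>z. z \<in> B \<Longrightarrow> z \<in> \<Sigma> \<longleftrightarrow> H z = 0"
    and crossing: "\<And>z. z \<in> B \<Longrightarrow> H z = 0 \<Longrightarrow> z \<in> closure (A a) \<Longrightarrow> z \<in> closure (A b) \<Longrightarrow>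
      crossing_point N h k A X z"
    using chart unfolding crossing_chart_def by blast+
  have Ja: "r - s \<in> {-\<delta>a<..<\<delta>a}" if "r \<in> {s..?\<theta>}" for r using that \<tau> \<delta> by auto
  have Jb: "r - ?\<theta> \<in> {-\<delta>b<..<\<delta>b}" if "r \<in> {?\<theta>..u}" for r using that \<tau> \<delta> by auto
  have \<phi>0: "\<phi>a (q, 0) = q" "\<phi>b (?z, 0) = ?z"
    using boxa boxb q(1) z unfolding flow_box_def by blast+
  have in_B: "\<phi>a (q, r) \<in> B" if "r \<in> {-\<delta>a<..<\<delta>a}" for r
    using boxa q(1) that unfolding flow_box_def by blast
  have in_Bb: "\<phi>b (?z, r) \<in> B" if "r \<in> {-\<delta>b<..<\<delta>b}" for r
    using boxb z that unfolding flow_box_def by blast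
  have \<eta>b: "\<eta> r = \<phi>b (?z, r - ?\<theta>)" if "?\<theta> \<le> r" for r
    using that \<phi>0(2) by (auto simp: \<eta>_def)
  have \<eta>a: "\<eta> r = \<phi>a (q, r - s)" if "r \<le> ?\<theta>" for r
    using that by (simp add: \<eta>_def)
  have tra: "trajectory (X a) \<eta> {s..?\<theta>}"
    by (rule trajectory_subset[OF flow_box_trajectory[OF boxa q(1) Ja] order_refl]) (simp_all add: \<eta>a)
  have trb: "trajectory (X b) \<eta> {?\<theta>..u}"
    by (rule trajectory_subset[OF flow_box_trajectory[OF boxb z Jb] order_refl]) (simp_all add: \<eta>b)
  have cont: "continuous_on {s..?\<theta>} \<eta>" "continuous_on {?\<theta>..u} \<eta>"
    by (rule trajectory_continuous[OF tra] trajectory_continuous[OF trb])+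
  have before: "\<eta> ` {s..<?\<theta>} \<subseteq> A a"
  proof (rule connected_subset_A[OF ab(1)])
    show "connected (\<eta> ` {s..<?\<theta>})"
      by (intro connected_continuous_image continuous_on_subset[OF cont(1)]) auto
    have "\<eta> r \<notin> \<Sigma>" if "r \<in> {s..<?\<theta>}" for r
    proof -
      have J: "r - s \<in> {-\<delta>a<..<\<delta>a}" "\<tau> \<in> {-\<delta>a<..<\<delta>a}" using Ja[of r] that \<tau> \<delta> by auto
      have "H (\<phi>a (q, r - s)) < 0"
        using flow_box_strict_mono[OF boxa q(1) H pos(1) J] that hit by simp
      then show ?thesis using \<Sigma>_iff[OF in_B[OF J(1)]] that by (simp add: \<eta>a)
    qed
    then show "\<eta> ` {s..<?\<theta>} \<inter> \<Sigma> = {}" by auto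
    show "\<eta> s \<in> \<eta> ` {s..<?\<theta>}" using \<tau> by simp
    show "\<eta> s \<in> A a" using q(2) \<phi>0(1) \<tau> by (simp add: \<eta>a)
  qed
  have after: "\<eta> ` {?\<theta><..u} \<subseteq> A b"
  proof (rule connected_subset_A[OF ab(2)])
    show "connected (\<eta> ` {?\<theta><..u})"
      by (intro connected_continuous_image continuous_on_subset[OF cont(2)]) auto
    have "\<eta> r \<notin> \<Sigma>" if "r \<in> {?\<theta><..u}" for r
    proof -
      have J: "0 \<in> {-\<delta>b<..<\<delta>b}" "r - ?\<theta> \<in> {-\<delta>b<..<\<delta>b}" using Jb[of r] that \<tau> \<delta> by auto
      have "H (\<phi>b (?z, r - ?\<theta>)) > 0"
        using flow_box_strict_mono[OF boxb z H pos(2) J] that hit \<phi>0(2) by simp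
      then show ?thesis using \<Sigma>_iff[OF in_Bb[OF J(2)]] that by (simp add: \<eta>b)
    qed
    then show "\<eta> ` {?\<theta><..u} \<inter> \<Sigma> = {}" by auto
    show "\<eta> u \<in> \<eta> ` {?\<theta><..u}" using \<tau> by simp
    show "\<eta> u \<in> A b" using end_in \<tau> by (simp add: \<eta>b algebra_simps)
  qed
  have \<eta>\<theta>: "\<eta> ?\<theta> = ?z" by (simp add: \<eta>_def)
  \<comment> \<open>The junction is a limit of each piece, hence in both closures; with the chart
    this makes it a crossing point.\<close>
  have "closure {s..<?\<theta>} = {s..?\<theta>}" "closure {?\<theta><..u} = {?\<theta>..u}" using \<tau> by simp_all
  then have "\<eta> ` {s..?\<theta>} \<subseteq> closure (A a)" "\<eta> ` {?\<theta>..u} \<subseteq> closure (A b)"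
    using image_closure_subset[of "{s..<?\<theta>}" \<eta> "closure (A a)"] image_closure_subset[of "{?\<theta><..u}" \<eta> "closure (A b)"]
      cont before after closure_subset by (metis closed_closure subset_trans)+
  moreover have "?\<theta> \<in> {s..?\<theta>}" "?\<theta> \<in> {?\<theta>..u}" using \<tau> by simp_all
  ultimately have "\<eta> ?\<theta> \<in> closure (A a)" "\<eta> ?\<theta> \<in> closure (A b)" by blast+
  then have z_closure: "?z \<in> closure (A a)" "?z \<in> closure (A b)" unfolding \<eta>\<theta> .
  show ?thesis unfolding sol_iff
  proof (intro conjI ballI)
    have "continuous_on ({s..?\<theta>} \<union> {?\<theta>..u}) \<eta>"
      by (intro continuous_on_closed_Un cont) auto
    then show "continuous_on {s..u} \<eta>" using \<tau> by (simp add: ivl_disj_un_two_touch)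
  next
    fix r assume r: "r \<in> {s..u}"
    consider "r < ?\<theta>" | "r = ?\<theta>" | "r > ?\<theta>" by linarith
    then show "sol_at \<eta> {s..u} r"
    proof cases
      case 1
      then have rI: "r \<in> {s..<?\<theta>}" using r by simp
      then have "\<eta> r \<in> A a" using before by blast
      then have "sol_at \<eta> {s..?\<theta>} r"
        using sol_at_trajectory[OF ab(1) tra] rI by simp
      moreover have "?\<theta> - r > 0" using 1 by simp
      ultimately show ?thesis by (rule sol_at_local) (use r in auto)
    next
      case 3
      then have rI: "r \<in> {?\<theta><..u}" using r by simp
      then have "\<eta> r \<in> A b" using after by blast
      then have "sol_at \<eta> {?\<theta>..u} r"
        using sol_at_trajectory[OF ab(2) trb] rI by simp
      moreover have "r - ?\<theta> > 0" using 3 by simp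
      ultimately show ?thesis by (rule sol_at_local) (use r in auto)
    next
      case 2
      have zB: "?z \<in> B" using in_B \<tau> \<delta> by simp
      have z\<Sigma>: "?z \<in> \<Sigma>" using \<Sigma>_iff[OF zB] hit by simp
      \<comment> \<open>Window size 1 is arbitrary, since intersecting with \<open>{s..u}\<close>
        cuts the window down to the two pieces.\<close>
      have sub: "{s..u} \<inter> {?\<theta>-1..<?\<theta>} \<subseteq> {s..<?\<theta>}" "{s..u} \<inter> {?\<theta><..?\<theta>+1} \<subseteq> {?\<theta><..u}"
        "{s..u} \<inter> {?\<theta>-1..?\<theta>} \<subseteq> {s..?\<theta>}" "{s..u} \<inter> {?\<theta>..?\<theta>+1} \<subseteq> {?\<theta>..u}" by auto
      have "\<eta> ` ({s..u} \<inter> {?\<theta>-1..<?\<theta>}) \<subseteq> A a" "\<eta> ` ({s..u} \<inter> {?\<theta><..?\<theta>+1}) \<subseteq> A b"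
        using image_mono[OF sub(1), of \<eta>] image_mono[OF sub(2), of \<eta>] before after by (meson subset_trans)+
      moreover have "trajectory (X a) \<eta> ({s..u} \<inter> {?\<theta>-1..?\<theta>})" "trajectory (X b) \<eta> ({s..u} \<inter> {?\<theta>..?\<theta>+1})"
        using trajectory_subset[OF tra sub(3)] trajectory_subset[OF trb sub(4)] by simp_all
      moreover have "(1::real) > 0" by simp
      moreover have "?z \<in> closure (A a) \<inter> closure (A b)" using z_closure by simp
      ultimately show ?thesis unfolding 2 sol_at_def \<eta>\<theta>
        using z\<Sigma> A_disjoint_\<Sigma>[of _ ?z] crossing[OF zB hit z_closure] ab by blast
    qed
  qed
qed

end

section \<open>The time map\<close>

context piecewise_smooth
begin

text \<open>The formula with the hitting time is valid under open conditions. To see that they hold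
  at \<open>\<gamma> s\<close>, it is checked that the hitting time there is \<open>t - s\<close>
  and that both box orbits follow \<open>\<gamma>\<close>.\<close>

lemma smooth_arc_across:
  assumes chart: "crossing_chart a b H B" and p: "\<gamma> t \<in> B" "H (\<gamma> t) = 0"
    and cont: "continuous_on {0..T} \<gamma>" and tT: "0 < t" "t < T"
    and \<epsilon>0: "\<epsilon>0 > 0" "\<gamma> ` ({0..T} \<inter> {t-\<epsilon>0..<t}) \<subseteq> A a" "trajectory (X a) \<gamma> ({0..T} \<inter> {t-\<epsilon>0..t})"
      "\<gamma> ` ({0..T} \<inter> {t<..t+\<epsilon>0}) \<subseteq> A b" "trajectory (X b) \<gamma> ({0..T} \<inter> {t..t+\<epsilon>0})"
  shows "\<exists>\<epsilon>>0. \<forall>s u. 0 \<le> s \<and> t - \<epsilon> < s \<and> s < t \<and> t < u \<and> u < t + \<epsilon> \<and> u \<le> T \<longrightarrow> smooth_arc \<gamma> s u"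
proof -
  have ab: "a \<in> {1..k}" "b \<in> {1..k}" "a \<noteq> b" and H: "smooth_on UNIV H" and B: "open B"
    and X: "smooth_on B (X a)" "smooth_on B (X b)"
    and pos: "\<And>z. z \<in> B \<Longrightarrow> frechet_derivative H (at z) (X a z) > 0"
    using chart unfolding crossing_chart_def by blast+
  obtain \<delta>a Va \<phi>a where Va: "\<gamma> t \<in> Va" and boxa: "flow_box (X a) B \<delta>a Va \<phi>a"
    using ex_flow_box[OF B p(1) X(1)] by blast
  obtain \<delta>b Vb \<phi>b where Vb: "\<gamma> t \<in> Vb" and boxb: "flow_box (X b) B \<delta>b Vb \<phi>b"
    using ex_flow_box[OF B p(1) X(2)] by blast
  have "frechet_derivative H (at (\<gamma> t)) (X a (\<gamma> t)) \<noteq> 0" using pos[OF p(1)] by simp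
  from smooth_hitting_time[OF B X(1) H boxa Va p(2) this]
  obtain V' \<tau> where V': "open V'" "\<gamma> t \<in> V'" "V' \<subseteq> Va" and \<tau>: "smooth_on V' \<tau>"
    and \<tau>J: "\<And>x. x \<in> V' \<Longrightarrow> \<tau> x \<in> {-\<delta>a<..<\<delta>a}" and hit: "\<And>x. x \<in> V' \<Longrightarrow> H (\<phi>a (x, \<tau> x)) = 0"
    by blast
  have \<delta>: "\<delta>a > 0" "\<delta>b > 0" and open_Va: "open Va" and open_Vb: "open Vb"
    and \<phi>: "smooth_on (Va \<times> {-\<delta>a<..<\<delta>a}) \<phi>a" "smooth_on (Vb \<times> {-\<delta>b<..<\<delta>b}) \<phi>b"
    and \<phi>a0: "\<And>x. x \<in> Va \<Longrightarrow> \<phi>a (x, 0) = x" and \<phi>b0: "\<And>x. x \<in> Vb \<Longrightarrow> \<phi>b (x, 0) = x"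
    and \<phi>a_in: "\<And>x r. x \<in> Va \<Longrightarrow> r \<in> {-\<delta>a<..<\<delta>a} \<Longrightarrow> \<phi>a (x, r) \<in> B"
    and \<phi>b_in: "\<And>x r. x \<in> Vb \<Longrightarrow> r \<in> {-\<delta>b<..<\<delta>b} \<Longrightarrow> \<phi>b (x, r) \<in> B"
    using boxa boxb unfolding flow_box_def by blast+
  have "t \<in> {0..T}" using tT by simp
  from continuous_on_eventually_in[OF cont this V'(1,2)] obtain d
    where d: "d > 0" "\<And>s. s \<in> {0..T} \<Longrightarrow> \<bar>s - t\<bar> < d \<Longrightarrow> \<gamma> s \<in> V'" by blast
  \<comment> \<open>The halves give \<open>u - s < 2 * \<epsilon> \<le> \<delta>a\<close>, and
    likewise for \<open>\<delta>b\<close>.\<close>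
  define \<epsilon> where "\<epsilon> = Min {\<epsilon>0, d, \<delta>a/2, \<delta>b/2}"
  have \<epsilon>: "\<epsilon> > 0" "\<epsilon> \<le> \<epsilon>0" "\<epsilon> \<le> d" "\<epsilon> \<le> \<delta>a/2" "\<epsilon> \<le> \<delta>b/2"
    using \<epsilon>0(1) d(1) \<delta> by (auto simp: \<epsilon>_def)
  have "smooth_arc \<gamma> s u" if su: "0 \<le> s" "t - \<epsilon> < s" "s < t" "t < u" "u < t + \<epsilon>" "u \<le> T" for s u
  proof -
    have q0: "\<gamma> s \<in> V'" using su \<epsilon> tT by (intro d(2)) auto
    have q0A: "\<gamma> s \<in> A a" using \<epsilon>0(2) su \<epsilon> tT by (auto simp: image_subset_iff)
    have q0Va: "\<gamma> s \<in> Va" using q0 V'(3) by blast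
    have uA: "\<gamma> u \<in> A b" using \<epsilon>0(4) su \<epsilon> tT by (auto simp: image_subset_iff)
    have Ja: "r - s \<in> {-\<delta>a<..<\<delta>a}" if "r \<in> {s..t}" for r using that su \<epsilon> by auto
    have Jb: "r - t \<in> {-\<delta>b<..<\<delta>b}" if "r \<in> {t..u}" for r using that su \<epsilon> by auto
    have \<phi>a_t: "\<phi>a (\<gamma> s, t - s) = \<gamma> t"
    proof (rule trajectory_unique[OF B _ X(1) flow_box_trajectory[OF boxa q0Va Ja], where \<gamma>\<^sub>2 = \<gamma> and t = t])
      show "trajectory (X a) \<gamma> {s..t}"
        by (rule trajectory_subset[OF \<epsilon>0(3)]) (use su \<epsilon> tT in auto)
    qed (use \<phi>a_in[OF q0Va Ja] \<phi>a0[OF q0Va] su in auto)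
    have \<phi>b_u: "\<phi>b (\<gamma> t, u - t) = \<gamma> u"
    proof (rule trajectory_unique[OF B _ X(2) flow_box_trajectory[OF boxb Vb Jb], where \<gamma>\<^sub>2 = \<gamma> and t = u])
      show "trajectory (X b) \<gamma> {t..u}"
        by (rule trajectory_subset[OF \<epsilon>0(5)]) (use su \<epsilon> tT in auto)
    qed (use \<phi>b_in[OF Vb Jb] \<phi>b0[OF Vb] su in auto)
    \<comment> \<open>\<open>H\<close> is strictly monotone along the orbit of
      \<open>\<gamma> s\<close> and vanishes at both times.\<close>
    have \<tau>_eq: "\<tau> (\<gamma> s) = t - s"
    proof (rule linorder_cases)
      have J: "\<tau> (\<gamma> s) \<in> {-\<delta>a<..<\<delta>a}" "t - s \<in> {-\<delta>a<..<\<delta>a}" using \<tau>J[OF q0] Ja[of t] su by auto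
      show "\<tau> (\<gamma> s) < t - s \<Longrightarrow> ?thesis"
        using flow_box_strict_mono[OF boxa q0Va H pos J] hit[OF q0] \<phi>a_t p(2) by simp
      show "t - s < \<tau> (\<gamma> s) \<Longrightarrow> ?thesis"
        using flow_box_strict_mono[OF boxa q0Va H pos J(2,1)] hit[OF q0] \<phi>a_t p(2) by simp
    qed
    define z where "z q = \<phi>a (q, \<tau> q)" for q
    define \<Phi> where "\<Phi> q = \<phi>b (z q, u - s - \<tau> q)" for q
    \<comment> \<open>Three stages, as each map is known to be continuous only on the preceding set:
      a hitting time strictly inside the interval, then a hitting point in the second box, then an
      endpoint in \<open>A b\<close>.\<close>
    define W1 where "W1 = V' \<inter> \<tau> -` {0<..<u-s} \<inter> A a"
    define W2 where "W2 = W1 \<inter> z -` Vb"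
    define W where "W = W2 \<inter> \<Phi> -` A b"
    have W1: "open W1" unfolding W1_def
      by (intro open_Int[OF _ open_A[OF ab(1)]] continuous_open_preimage[OF smooth_on_imp_continuous[OF \<tau>] V'(1)] open_greaterThanLessThan)
    have \<tau>1: "smooth_on W1 \<tau>" by (rule smooth_on_subset[OF \<tau>]) (auto simp: W1_def)
    have z: "smooth_on W1 z" unfolding z_def
      by (rule smooth_on_compose[OF W1 open_Times[OF open_Va open_greaterThanLessThan] _ \<phi>(1)
            smooth_on_Pair[OF W1 smooth_on_linear[OF bounded_linear_ident W1] \<tau>1]])
        (use V'(3) \<tau>J in \<open>auto simp: W1_def\<close>)
    have W2: "open W2" unfolding W2_def
      by (rule continuous_open_preimage[OF smooth_on_imp_continuous[OF z] W1 open_Vb])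
    have "W2 \<subseteq> W1" by (auto simp: W2_def)
    have "smooth_on W2 (\<lambda>q. (u - s) + (- \<tau> q))"
      by (rule smooth_on_add[OF W2 smooth_on_const[OF W2] smooth_on_uminus[OF W2 smooth_on_subset[OF \<tau>1 \<open>W2 \<subseteq> W1\<close>]]])
    then have "smooth_on W2 (\<lambda>q. (z q, u - s - \<tau> q))"
      using smooth_on_Pair[OF W2 smooth_on_subset[OF z \<open>W2 \<subseteq> W1\<close>]] by simp
    from smooth_on_compose[OF W2 open_Times[OF open_Vb open_greaterThanLessThan] _ \<phi>(2) this]
    have \<Phi>: "smooth_on W2 \<Phi>" unfolding \<Phi>_def
      using su \<epsilon> by (auto simp: W2_def W1_def image_subset_iff)
    have W: "open W" unfolding W_def
      by (rule continuous_open_preimage[OF smooth_on_imp_continuous[OF \<Phi>] W2 open_A[OF ab(2)]])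
    have zs: "z (\<gamma> s) = \<gamma> t" using \<tau>_eq \<phi>a_t by (simp add: z_def)
    have \<Phi>s: "\<Phi> (\<gamma> s) = \<gamma> u" using \<tau>_eq zs \<phi>b_u by (simp add: \<Phi>_def)
    have "\<gamma> s \<in> W" using q0 q0A \<tau>_eq zs \<Phi>s Vb uA su by (simp add: W_def W2_def W1_def)
    moreover have "W \<inter> \<Sigma> = {}" using A_disjoint_\<Sigma>[OF ab(1)] by (auto simp: W_def W2_def W1_def)
    moreover have "smooth_on W \<Phi>" by (rule smooth_on_subset[OF \<Phi>]) (auto simp: W_def)
    moreover have "\<exists>\<eta>. sol \<eta> {s..u} \<and> \<eta> s = q \<and> \<eta> u = \<Phi> q" if q: "q \<in> W" for q
    proof -
      have qV: "q \<in> V'" "q \<in> Va" "q \<in> A a" "0 < \<tau> q" "\<tau> q < u - s" "\<phi>a (q, \<tau> q) \<in> Vb"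
        "\<phi>b (\<phi>a (q, \<tau> q), u - s - \<tau> q) \<in> A b"
        using q V'(3) by (auto simp: W_def W2_def W1_def z_def \<Phi>_def)
      have \<delta>': "u - s < \<delta>a" "u - s < \<delta>b" using su \<epsilon> by auto
      let ?\<eta> = "\<lambda>r. if r \<le> s + \<tau> q then \<phi>a (q, r - s) else \<phi>b (\<phi>a (q, \<tau> q), r - (s + \<tau> q))"
      have "sol ?\<eta> {s..u}"
        by (rule sol_through_crossing[OF chart boxa boxb qV(2,3,4,5) \<delta>' hit[OF qV(1)] qV(6,7)])
      moreover have "?\<eta> s = q" using qV(4) \<phi>a0[OF qV(2)] by simp
      moreover have "?\<eta> u = \<Phi> q" using qV(5) by (simp add: \<Phi>_def z_def diff_diff_eq)
      ultimately show ?thesis by (intro exI[of _ ?\<eta>] conjI)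
    qed
    ultimately show ?thesis
      unfolding smooth_arc_def using W \<Phi>s by (intro exI[of _ W] exI[of _ \<Phi>]) simp
  qed
  then show ?thesis using \<epsilon>(1) by blast
qed

text \<open>The first conclusion, that crossing times are isolated, is what later allows a
  subdivision at times off \<open>\<Sigma>\<close>.\<close>

lemma smooth_arc_locally:
  assumes s: "sol \<gamma> {0..T}" and ends: "\<gamma> 0 \<notin> \<Sigma>" "\<gamma> T \<notin> \<Sigma>" and t: "t \<in> {0..T}"
  shows "\<exists>\<epsilon>>0. (\<forall>s\<in>{0..T}. \<bar>s - t\<bar> < \<epsilon> \<longrightarrow> s \<noteq> t \<longrightarrow> \<gamma> s \<notin> \<Sigma>) \<and>
    (\<forall>s u. 0 \<le> s \<and> t - \<epsilon> < s \<and> s \<le> u \<and> u < t + \<epsilon> \<and> u \<le> T \<and> \<gamma> s \<notin> \<Sigma> \<and> \<gamma> u \<notin> \<Sigma> \<longrightarrow> smooth_arc \<gamma> s u)"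
proof (cases "\<gamma> t \<in> \<Sigma>")
  case False
  then obtain j where j: "j \<in> {1..k}" "\<gamma> t \<in> A j" by (rule ex_A)
  have "continuous_on {0..T} \<gamma>" using s by (simp add: sol_iff)
  from continuous_on_eventually_in[OF this t open_A[OF j(1)] j(2)] obtain d
    where d: "d > 0" "\<And>s. s \<in> {0..T} \<Longrightarrow> \<bar>s - t\<bar> < d \<Longrightarrow> \<gamma> s \<in> A j" by blast
  have "smooth_arc \<gamma> s u" if "0 \<le> s" "t - d < s" "s \<le> u" "u < t + d" "u \<le> T" for s u
  proof (rule smooth_arc_within_component[OF sol_subset[OF assms(1)] j(1) that(3)])
    show "\<gamma> ` {s..u} \<subseteq> A j" using that by (auto intro!: d(2))
  qed (use that in auto)
  moreover have "\<gamma> s \<notin> \<Sigma>" if "s \<in> {0..T}" "\<bar>s - t\<bar> < d" for s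
    using d(2)[OF that] A_disjoint_\<Sigma>[OF j(1)] by blast
  ultimately show ?thesis using d(1) by blast
next
  case True
  then have t': "0 < t" "t < T" using t ends by (auto simp: order_le_less)
  have cp: "crossing_point N h k A X (\<gamma> t)" using s t True unfolding solution_def by blast
  obtain a b \<epsilon>0 where ab: "a \<in> {1..k}" "b \<in> {1..k}" "a \<noteq> b" "\<gamma> t \<in> closure (A a) \<inter> closure (A b)"
    and \<epsilon>0: "\<epsilon>0 > 0" "\<gamma> ` ({0..T} \<inter> {t-\<epsilon>0..<t}) \<subseteq> A a" "trajectory (X a) \<gamma> ({0..T} \<inter> {t-\<epsilon>0..t})"
      "\<gamma> ` ({0..T} \<inter> {t<..t+\<epsilon>0}) \<subseteq> A b" "trajectory (X b) \<gamma> ({0..T} \<inter> {t..t+\<epsilon>0})"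
    using s t True unfolding solution_def by blast
  obtain H B where chart: "\<gamma> t \<in> B" "H (\<gamma> t) = 0" "crossing_chart a b H B"
    using ex_crossing_chart[OF cp ab(1,2,3)] ab(4) by blast
  have "continuous_on {0..T} \<gamma>" using s by (simp add: sol_iff)
  from smooth_arc_across[OF chart(3,1,2) this t' \<epsilon>0] obtain \<epsilon>1 where \<epsilon>1: "\<epsilon>1 > 0"
    "\<And>s u. 0 \<le> s \<Longrightarrow> t - \<epsilon>1 < s \<Longrightarrow> s < t \<Longrightarrow> t < u \<Longrightarrow> u < t + \<epsilon>1 \<Longrightarrow> u \<le> T \<Longrightarrow> smooth_arc \<gamma> s u"
    by blast
  define \<epsilon> where "\<epsilon> = min \<epsilon>0 \<epsilon>1"
  have \<epsilon>: "\<epsilon> > 0" "\<epsilon> \<le> \<epsilon>0" "\<epsilon> \<le> \<epsilon>1" using \<epsilon>0(1) \<epsilon>1(1) by (auto simp: \<epsilon>_def)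
  have in_a: "\<gamma> r \<in> A a" if "r \<in> {0..T}" "t - \<epsilon> < r" "r < t" for r
    using \<epsilon>0(2) that \<epsilon> by (auto simp: image_subset_iff)
  have in_b: "\<gamma> r \<in> A b" if "r \<in> {0..T}" "t < r" "r < t + \<epsilon>" for r
    using \<epsilon>0(4) that \<epsilon> by (auto simp: image_subset_iff)
  have "\<gamma> r \<notin> \<Sigma>" if "r \<in> {0..T}" "\<bar>r - t\<bar> < \<epsilon>" "r \<noteq> t" for r
    using in_a[OF that(1)] in_b[OF that(1)] that(2,3) A_disjoint_\<Sigma>[OF ab(1)] A_disjoint_\<Sigma>[OF ab(2)]
    by (cases "r < t") auto
  moreover have "smooth_arc \<gamma> r u"
    if ru: "0 \<le> r" "t - \<epsilon> < r" "r \<le> u" "u < t + \<epsilon>" "u \<le> T" "\<gamma> r \<notin> \<Sigma>" "\<gamma> u \<notin> \<Sigma>" for r u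
  proof -
    have "r \<noteq> t" "u \<noteq> t" using ru True by auto
    then consider "u < t" | "t < r" | "r < t" "t < u" by linarith
    then show ?thesis
    proof cases
      case 1
      have "\<gamma> ` {r..u} \<subseteq> A a" using 1 ru t' by (auto intro!: in_a)
      then show ?thesis using smooth_arc_within_component[OF sol_subset[OF s] ab(1) ru(3)] ru by simp
    next
      case 2
      have "\<gamma> ` {r..u} \<subseteq> A b" using 2 ru t' by (auto intro!: in_b)
      then show ?thesis using smooth_arc_within_component[OF sol_subset[OF s] ab(2) ru(3)] ru by simp
    next
      case 3
      then show ?thesis using \<epsilon>1(2)[of r u] ru \<epsilon> by simp
    qed
  qed
  ultimately show ?thesis using \<epsilon>(1) by blast
qed

text \<open>Arcs cannot be chained through arbitrary subdivision points, since these may be crossing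
  times. The predicate \<open>Q\<close> therefore speaks of all times off \<open>\<Sigma>\<close> up
  to \<open>u\<close>, and \<open>Bolzano\<close> is applied to the passage from \<open>Q a\<close>
  to \<open>Q b\<close>.\<close>

lemma smooth_arc_sol:
  assumes s: "sol \<gamma> {0..T}" and T: "0 \<le> T" and ends: "\<gamma> 0 \<notin> \<Sigma>" "\<gamma> T \<notin> \<Sigma>"
  shows "smooth_arc \<gamma> 0 T"
proof -
  define Q where "Q u \<longleftrightarrow> (\<forall>u'\<in>{0..u}. \<gamma> u' \<notin> \<Sigma> \<longrightarrow> smooth_arc \<gamma> 0 u')" for u
  have "0 \<le> (0::real) \<and> T \<le> T \<longrightarrow> Q 0 \<longrightarrow> Q T"
    using T
  proof (induction rule: Bolzano[where P = "\<lambda>a b. 0 \<le> a \<and> b \<le> T \<longrightarrow> Q a \<longrightarrow> Q b"])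
    case (trans a b c)
    then show ?case by auto
  next
    case (local t)
    then have t: "t \<in> {0..T}" by simp
    obtain \<epsilon> where \<epsilon>: "\<epsilon> > 0" "\<And>s. s \<in> {0..T} \<Longrightarrow> \<bar>s - t\<bar> < \<epsilon> \<Longrightarrow> s \<noteq> t \<Longrightarrow> \<gamma> s \<notin> \<Sigma>"
      "\<And>s u. 0 \<le> s \<Longrightarrow> t - \<epsilon> < s \<Longrightarrow> s \<le> u \<Longrightarrow> u < t + \<epsilon> \<Longrightarrow> u \<le> T \<Longrightarrow> \<gamma> s \<notin> \<Sigma> \<Longrightarrow> \<gamma> u \<notin> \<Sigma> \<Longrightarrow> smooth_arc \<gamma> s u"
      using smooth_arc_locally[OF s ends t] by blast
    have "Q b" if ab: "a \<le> t" "t \<le> b" "b - a < \<epsilon>" "0 \<le> a" "b \<le> T" and Qa: "Q a" for a b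
      unfolding Q_def
    proof (intro ballI impI)
      fix u assume u: "u \<in> {0..b}" "\<gamma> u \<notin> \<Sigma>"
      show "smooth_arc \<gamma> 0 u"
      proof (cases "u \<le> a")
        case True
        then show ?thesis using Qa u unfolding Q_def by simp
      next
        case False
        \<comment> \<open>A cutting time off \<open>\<Sigma>\<close>, not after \<open>a\<close>. If
          \<open>a\<close> is itself a crossing time, it equals \<open>t\<close>, and a slightly
          earlier time is off \<open>\<Sigma>\<close>.\<close>
        obtain r where r: "0 \<le> r" "t - \<epsilon> < r" "r \<le> a" "\<gamma> r \<notin> \<Sigma>"
        proof (cases "\<gamma> a \<in> \<Sigma>")
          case True
          then have "a = t" using \<epsilon>(2)[of a] ab by auto
          moreover have "0 < t" using ends(1) True t ab(4) \<open>a = t\<close> by (metis order_le_less)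
          ultimately show ?thesis
            using that[of "max 0 (t - \<epsilon>/2)"] \<epsilon>(1) \<epsilon>(2)[of "max 0 (t - \<epsilon>/2)"] t by auto
        next
          case False
          then show ?thesis using that[of a] ab by auto
        qed
        have "smooth_arc \<gamma> 0 r" using Qa r unfolding Q_def by simp
        moreover have "smooth_arc \<gamma> r u" using \<epsilon>(3)[of r u] r u ab False by auto
        ultimately show ?thesis using smooth_arc_trans r(1,3) False by (metis linear order_trans)
      qed
    qed
    then show ?case using \<epsilon>(1) by blast
  qed
  moreover have "Q 0"
  proof -
    obtain j where j: "j \<in> {1..k}" "\<gamma> 0 \<in> A j" using ex_A[OF ends(1)] by blast
    have "smooth_arc \<gamma> 0 0"
      by (rule smooth_arc_within_component[OF sol_subset[OF s] j(1)]) (use T j(2) in auto)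
    then show ?thesis by (simp add: Q_def)
  qed
  ultimately show ?thesis using T ends(2) by (simp add: Q_def)
qed

text \<open>Uniqueness makes the description by \<open>THE\<close> in \<open>flow\<close> denote the
  endpoint.\<close>

lemma flow_eq:
  assumes "sol \<gamma> {0..T}" "\<gamma> 0 \<notin> \<Sigma>" "0 \<le> T"
  shows "flow N h k A X T (\<gamma> 0) = \<gamma> T"
  unfolding flow_def
proof (rule the_equality)
  show "\<exists>\<eta>. sol \<eta> (closed_segment 0 T) \<and> \<eta> 0 = \<gamma> 0 \<and> \<eta> T = \<gamma> T"
    using assms by (auto simp: closed_segment_eq_real_ivl)
  fix y assume "\<exists>\<eta>. sol \<eta> (closed_segment 0 T) \<and> \<eta> 0 = \<gamma> 0 \<and> \<eta> T = y"
  then obtain \<eta> where "sol \<eta> {0..T}" "\<eta> 0 = \<gamma> 0" "\<eta> T = y"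
    using assms(3) by (auto simp: closed_segment_eq_real_ivl)
  then show "y = \<gamma> T" using sol_unique[OF _ assms(1), of \<eta> T] assms(2,3) by simp
qed

end

section \<open>Time reversal\<close>

lemma has_vector_derivative_reflect:
  assumes "(\<gamma> has_vector_derivative v) (at (T - t) within S)" "\<And>r. r \<in> I \<Longrightarrow> T - r \<in> S"
  shows "((\<lambda>t. \<gamma> (T - t)) has_vector_derivative - v) (at t within I)"
proof -
  have "((\<lambda>t. T - t) has_vector_derivative -1) (at t within I)" by (auto intro!: derivative_eq_intros)
  moreover have "(\<gamma> has_vector_derivative v) (at (T - t) within (\<lambda>t. T - t) ` I)"
    by (rule has_vector_derivative_within_subset[OF assms(1)]) (use assms(2) in auto)
  ultimately have "(\<gamma> \<circ> (\<lambda>t. T - t) has_vector_derivative -1 *\<^sub>R v) (at t within I)"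
    by (rule vector_diff_chain_within)
  then show ?thesis by (simp add: o_def)
qed

lemma trajectory_reflect:
  "trajectory Y \<gamma> S \<Longrightarrow> (\<And>r. r \<in> I \<Longrightarrow> T - r \<in> S) \<Longrightarrow> trajectory (\<lambda>y. - Y y) (\<lambda>t. \<gamma> (T - t)) I"
  unfolding trajectory_def using has_vector_derivative_reflect by blast

text \<open>Both normal components change sign, so their product does not.\<close>

lemma crossing_point_reverse:
  assumes "crossing_point N h k A X p" shows "crossing_point N h k A (\<lambda>j y. - X j y) p"
proof -
  obtain i v a b where "{i'\<in>{1..N}. h i' p = 0} = {i}" "GDERIV (h i) p :> v" "v \<noteq> 0"
    "{j\<in>{1..k}. p \<in> closure (A j)} = {a, b}" "a \<noteq> b" "(X a p \<bullet> v) * (X b p \<bullet> v) > 0"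
    using assms unfolding crossing_point_def by blast
  moreover from this(6) have "(- X a p \<bullet> v) * (- X b p \<bullet> v) > 0" by simp
  ultimately show ?thesis unfolding crossing_point_def by blast
qed

text \<open>The curve run backwards enters a crossing through the former outgoing component, so
  \<open>a\<close> and \<open>b\<close> change roles.\<close>

lemma solution_reverse:
  assumes s: "solution N h k A X \<gamma> {0..T}"
  shows "solution N h k A (\<lambda>j y. - X j y) (\<lambda>t. \<gamma> (T - t)) {0..T}"
  unfolding solution_def
proof (intro conjI ballI impI)
  have "continuous_on {0..T} \<gamma>" using s by (simp add: solution_def)
  then show "continuous_on {0..T} (\<lambda>t. \<gamma> (T - t))"
    by (rule continuous_on_compose2) (auto intro!: continuous_intros)
next
  fix t j assume "t \<in> {0..T}" "j \<in> {1..k}" "\<gamma> (T - t) \<in> A j"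
  then have "(\<gamma> has_vector_derivative X j (\<gamma> (T - t))) (at (T - t) within {0..T})"
    using s unfolding solution_def by auto
  then show "((\<lambda>t. \<gamma> (T - t)) has_vector_derivative - X j (\<gamma> (T - t))) (at t within {0..T})"
    by (rule has_vector_derivative_reflect) auto
next
  fix t assume t: "t \<in> {0..T}" "\<gamma> (T - t) \<in> switching_set N h"
  then have t': "T - t \<in> {0..T}" by simp
  have cp: "crossing_point N h k A X (\<gamma> (T - t))"
    and ex: "\<exists>a\<in>{1..k}. \<exists>b\<in>{1..k}. \<exists>\<epsilon>>0. a \<noteq> b \<and> \<gamma> (T - t) \<in> closure (A a) \<inter> closure (A b) \<and>
      \<gamma> ` ({0..T} \<inter> {T-t-\<epsilon>..<T-t}) \<subseteq> A a \<and> trajectory (X a) \<gamma> ({0..T} \<inter> {T-t-\<epsilon>..T-t}) \<and>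
      \<gamma> ` ({0..T} \<inter> {T-t<..T-t+\<epsilon>}) \<subseteq> A b \<and> trajectory (X b) \<gamma> ({0..T} \<inter> {T-t..T-t+\<epsilon>})"
  proof -
    note at_t = s[unfolded solution_def, THEN conjunct2, THEN conjunct2, rule_format, OF t' t(2)]
    from at_t show "crossing_point N h k A X (\<gamma> (T - t))" by (rule conjunct1)
    from at_t show "\<exists>a\<in>{1..k}. \<exists>b\<in>{1..k}. \<exists>\<epsilon>>0. a \<noteq> b \<and> \<gamma> (T - t) \<in> closure (A a) \<inter> closure (A b) \<and>
      \<gamma> ` ({0..T} \<inter> {T-t-\<epsilon>..<T-t}) \<subseteq> A a \<and> trajectory (X a) \<gamma> ({0..T} \<inter> {T-t-\<epsilon>..T-t}) \<and>
      \<gamma> ` ({0..T} \<inter> {T-t<..T-t+\<epsilon>}) \<subseteq> A b \<and> trajectory (X b) \<gamma> ({0..T} \<inter> {T-t..T-t+\<epsilon>})"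
      by (rule conjunct2)
  qed
  from cp show "crossing_point N h k A (\<lambda>j y. - X j y) (\<gamma> (T - t))" by (rule crossing_point_reverse)
  obtain a b \<epsilon> where ab: "a \<in> {1..k}" "b \<in> {1..k}" "\<epsilon> > 0" "a \<noteq> b" "\<gamma> (T - t) \<in> closure (A a) \<inter> closure (A b)"
    and a: "\<gamma> ` ({0..T} \<inter> {T-t-\<epsilon>..<T-t}) \<subseteq> A a" "trajectory (X a) \<gamma> ({0..T} \<inter> {T-t-\<epsilon>..T-t})"
    and b: "\<gamma> ` ({0..T} \<inter> {T-t<..T-t+\<epsilon>}) \<subseteq> A b" "trajectory (X b) \<gamma> ({0..T} \<inter> {T-t..T-t+\<epsilon>})"
    using ex by blast
  have im: "(\<lambda>t. \<gamma> (T - t)) ` ({0..T} \<inter> {t-\<epsilon>..<t}) \<subseteq> A b" "(\<lambda>t. \<gamma> (T - t)) ` ({0..T} \<inter> {t<..t+\<epsilon>}) \<subseteq> A a"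
    using a(1) b(1) by (auto simp: image_subset_iff)
  have tr: "trajectory (\<lambda>y. - X b y) (\<lambda>t. \<gamma> (T - t)) ({0..T} \<inter> {t-\<epsilon>..t})"
    by (rule trajectory_reflect[OF b(2)]) auto
  have tr': "trajectory (\<lambda>y. - X a y) (\<lambda>t. \<gamma> (T - t)) ({0..T} \<inter> {t..t+\<epsilon>})"
    by (rule trajectory_reflect[OF a(2)]) auto
  show "\<exists>a\<in>{1..k}. \<exists>b\<in>{1..k}. \<exists>\<epsilon>>0. a \<noteq> b \<and> \<gamma> (T - t) \<in> closure (A a) \<inter> closure (A b) \<and>
      (\<lambda>t. \<gamma> (T - t)) ` ({0..T} \<inter> {t-\<epsilon>..<t}) \<subseteq> A a \<and>
      trajectory (\<lambda>y. - X a y) (\<lambda>t. \<gamma> (T - t)) ({0..T} \<inter> {t-\<epsilon>..t}) \<and>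
      (\<lambda>t. \<gamma> (T - t)) ` ({0..T} \<inter> {t<..t+\<epsilon>}) \<subseteq> A b \<and>
      trajectory (\<lambda>y. - X b y) (\<lambda>t. \<gamma> (T - t)) ({0..T} \<inter> {t..t+\<epsilon>})"
    by (intro bexI[of _ b] bexI[of _ a] exI[of _ \<epsilon>] conjI im tr tr' ab(1,2,3) ab(4)[symmetric]
        ab(5)[unfolded Int_commute[of "closure (A a)"]])
qed

lemma piecewise_smooth_field_reverse:
  assumes "piecewise_smooth_field N h k A X"
  shows "piecewise_smooth_field N h k A (\<lambda>j y. - X j y)"
proof -
  have "\<exists>U. open U \<and> closure (A j) \<subseteq> U \<and> smooth_on U (\<lambda>y. - X j y)" if "j \<in> {1..k}" for j
    using assms that smooth_on_uminus unfolding piecewise_smooth_field_def by metis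
  then show ?thesis using assms unfolding piecewise_smooth_field_def by blast
qed

theorem proposition3:
  fixes h :: "nat \<Rightarrow> real^'n \<Rightarrow> real"
    and A :: "nat \<Rightarrow> (real^'n) set"
    and X :: "nat \<Rightarrow> real^'n \<Rightarrow> real^'n"
    and N k :: nat and T :: real and x :: "real^'n"
  assumes "CARD('n) \<ge> 2"
    and "piecewise_smooth_field N h k A X"
    and "x \<notin> switching_set N h"
    and "T > 0"
    and "x \<in> flow_domain N h k A X T"
    and "\<forall>t\<in>{0..T}. flow N h k A X t x \<in> switching_set N h \<longrightarrow>
           crossing_point N h k A X (flow N h k A X t x)"
    and "flow N h k A X T x \<notin> switching_set N h"
  shows "\<exists>U. x \<in> U \<and> U \<subseteq> flow_domain N h k A X T \<and>
           smooth_diffeo U (time_map N h k A X T ` U) (time_map N h k A X T)"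
proof -
  let ?R = "\<lambda>j y. - X j y"
  interpret piecewise_smooth N k h A X by (rule piecewise_smooth.intro) (rule assms(2))
  interpret rev: piecewise_smooth N k h A ?R
    by (rule piecewise_smooth.intro) (rule piecewise_smooth_field_reverse[OF assms(2)])
  have seg: "closed_segment 0 T = {0..T}" using assms(4) by (simp add: closed_segment_eq_real_ivl)
  have T: "0 \<le> T" using assms(4) by simp
  obtain \<gamma> where \<gamma>: "sol \<gamma> {0..T}" "\<gamma> 0 = x"
    using assms(5) by (auto simp: flow_domain_def seg)
  have \<gamma>T: "\<gamma> T \<notin> \<Sigma>" using flow_eq[OF \<gamma>(1) _ T] \<gamma>(2) assms(3,7) by simp
  have "smooth_arc \<gamma> 0 T" using smooth_arc_sol[OF \<gamma>(1) T] \<gamma>(2) \<gamma>T assms(3) by simp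
  then obtain W \<Phi> where W: "open W" "x \<in> W" "W \<inter> \<Sigma> = {}" and \<Phi>: "smooth_on W \<Phi>" "\<Phi> x = \<gamma> T"
    and W_sol: "\<And>q. q \<in> W \<Longrightarrow> \<exists>\<eta>. sol \<eta> {0..T} \<and> \<eta> 0 = q \<and> \<eta> T = \<Phi> q"
    unfolding smooth_arc_def \<gamma>(2) by blast
  have "rev.smooth_arc (\<lambda>t. \<gamma> (T - t)) 0 T"
    using rev.smooth_arc_sol[OF solution_reverse[OF \<gamma>(1)] T] \<gamma>(2) \<gamma>T assms(3) by simp
  then obtain V \<Psi> where V: "open V" "\<gamma> T \<in> V" "V \<inter> \<Sigma> = {}" and \<Psi>: "smooth_on V \<Psi>"
    and V_sol: "\<And>q. q \<in> V \<Longrightarrow> \<exists>\<eta>. rev.sol \<eta> {0..T} \<and> \<eta> 0 = q \<and> \<eta> T = \<Psi> q"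
    unfolding rev.smooth_arc_def by auto
  \<comment> \<open>The orbit of \<open>q\<close> run backwards solves the reversed field from
    \<open>\<Phi> q\<close>, a point of \<open>V\<close> and hence off \<open>\<Sigma>\<close>.
    Uniqueness identifies it with the orbit that ends at \<open>\<Psi> (\<Phi> q)\<close>.\<close>
  have \<Psi>\<Phi>: "\<Psi> (\<Phi> q) = q" if q: "q \<in> W" "\<Phi> q \<in> V" for q
  proof -
    obtain \<eta> where \<eta>: "sol \<eta> {0..T}" "\<eta> 0 = q" "\<eta> T = \<Phi> q" using W_sol[OF q(1)] by blast
    obtain \<eta>' where \<eta>': "rev.sol \<eta>' {0..T}" "\<eta>' 0 = \<Phi> q" "\<eta>' T = \<Psi> (\<Phi> q)" using V_sol[OF q(2)] by blast
    have "\<eta>' T = \<eta> (T - T)"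
      by (rule rev.sol_unique[OF \<eta>'(1) solution_reverse[OF \<eta>(1)]]) (use \<eta> \<eta>' q V(3) T in auto)
    then show ?thesis using \<eta> \<eta>' by simp
  qed
  have \<Phi>\<Psi>: "\<Phi> (\<Psi> q) = q" if q: "q \<in> V" "\<Psi> q \<in> W" for q
  proof -
    obtain \<eta> where \<eta>: "rev.sol \<eta> {0..T}" "\<eta> 0 = q" "\<eta> T = \<Psi> q" using V_sol[OF q(1)] by blast
    obtain \<eta>' where \<eta>': "sol \<eta>' {0..T}" "\<eta>' 0 = \<Psi> q" "\<eta>' T = \<Phi> (\<Psi> q)" using W_sol[OF q(2)] by blast
    \<comment> \<open>Reversing twice restores \<open>X\<close>.\<close>
    have "sol (\<lambda>t. \<eta> (T - t)) {0..T}" using solution_reverse[OF \<eta>(1)] by simp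
    from sol_unique[OF \<eta>'(1) this, of T] have "\<eta>' T = \<eta> (T - T)" using \<eta> \<eta>' q W(3) T by auto
    then show ?thesis using \<eta> \<eta>' by simp
  qed
  let ?\<Phi> = "time_map N h k A X T"
  \<comment> \<open>Restricting to points that \<open>\<Phi>\<close> sends into \<open>V\<close>
    makes \<open>\<Psi>\<close> a left inverse on all of \<open>U\<close>.\<close>
  define U where "U = W \<inter> \<Phi> -` V"
  have U: "open U" unfolding U_def
    by (rule continuous_open_preimage[OF smooth_on_imp_continuous[OF \<Phi>(1)] W(1) V(1)])
  have tm: "?\<Phi> q = \<Phi> q" if q: "q \<in> U" for q
  proof -
    obtain \<eta> where \<eta>: "sol \<eta> {0..T}" "\<eta> 0 = q" "\<eta> T = \<Phi> q" using W_sol q by (auto simp: U_def)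
    then show ?thesis using flow_eq[OF \<eta>(1) _ T] q W(3) by (auto simp: time_map_def U_def)
  qed
  have inj: "inj_on ?\<Phi> U"
    using \<Psi>\<Phi> tm by (intro inj_on_inverseI[of _ \<Psi>]) (simp add: U_def)
  \<comment> \<open>Written as a preimage under \<open>\<Psi>\<close>, the image is open by
    continuity alone.\<close>
  have image: "?\<Phi> ` U = V \<inter> \<Psi> -` W"
  proof -
    have "?\<Phi> ` U = \<Phi> ` U" using tm by (intro image_cong) auto
    also have "\<dots> = V \<inter> \<Psi> -` W"
    proof
      show "\<Phi> ` U \<subseteq> V \<inter> \<Psi> -` W" using \<Psi>\<Phi> by (auto simp: U_def)
      show "V \<inter> \<Psi> -` W \<subseteq> \<Phi> ` U"
      proof
        fix y assume "y \<in> V \<inter> \<Psi> -` W"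
        then have "\<Psi> y \<in> U" "\<Phi> (\<Psi> y) = y" using \<Phi>\<Psi> by (auto simp: U_def)
        then show "y \<in> \<Phi> ` U" by force
      qed
    qed
    finally show ?thesis .
  qed
  have image_open: "open (?\<Phi> ` U)" unfolding image
    by (rule continuous_open_preimage[OF smooth_on_imp_continuous[OF \<Psi>] V(1) W(1)])
  have inv: "\<Psi> y = inv_into U ?\<Phi> y" if y: "y \<in> ?\<Phi> ` U" for y
  proof -
    obtain q where q: "q \<in> U" "y = ?\<Phi> q" using y by blast
    have "\<Psi> y = q" using \<Psi>\<Phi>[of q] tm[OF q(1)] q by (simp add: U_def)
    then show ?thesis using inv_into_f_f[OF inj q(1)] q(2) by simp
  qed
  have "smooth_on U \<Phi>" by (rule smooth_on_subset[OF \<Phi>(1)]) (simp add: U_def)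
  from smooth_on_cong[OF U _ this, of ?\<Phi>] have "smooth_on U ?\<Phi>" using tm by simp
  moreover have "smooth_on (?\<Phi> ` U) \<Psi>"
    by (rule smooth_on_subset[OF \<Psi>]) (use image in blast)
  from smooth_on_cong[OF image_open inv this] have "smooth_on (?\<Phi> ` U) (inv_into U ?\<Phi>)" .
  ultimately have "smooth_diffeo U (?\<Phi> ` U) ?\<Phi>"
    unfolding smooth_diffeo_def using U image_open inj by (simp add: bij_betw_def)
  moreover have "x \<in> U" using W(2) \<Phi>(2) V(2) by (simp add: U_def)
  moreover have "U \<subseteq> flow_domain N h k A X T"
    using W_sol by (auto simp: U_def flow_domain_def seg)
  ultimately show ?thesis by blast
qed

end
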